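(* Assume $4\le n\le120$ with $n$ even. Then, up to isomorphism, $$\mathrm{MD}_n(\mathbb{F}_2)=\begin{cases}S_{n+1}&(n=2^m\text{ for some }m\ge2)\\ S_{n+2}&(n=2^m-2\text{ for some }m\ge3)\\ \mathrm{O}_n^+(\mathbb{F}_2)&(n\ne2^m,2^m-2\text{ for any }m\ge2\text{ and }n\equiv0,6\bmod8)\\ \mathrm{O}_n^-(\mathbb{F}_2)&(n\neq2^m,2^m-2\text{ for any }m\ge2\text{ and }n\equiv2,4\bmod8).\end{cases}$$ Moreover the natural embeddings $S_5\hookrightarrow\mathrm{O}_4^-(\mathbb{F}_2)$ and $S_8\hookrightarrow\mathrm{O}_6^+(\mathbb{F}_2)$ are (exceptional) isomorphisms $S_5\simeq\mathrm{O}_4^-(\mathbb{F}_2)$, $S_8\simeq\mathrm{O}_6^+(\mathbb{F}_2)$.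
   Context: Definition of $\mathrm{MD}_n(\mathbb{F}_2)=\mathrm{MD}(n+1,n,\mathbb{F}_2)$. Let $N=n+1$, and $\pi:Y\to T_0=\mathbb{P}^1\setminus(\{\infty\}\cup\mu_N)$ the Dwork family $X_1^N+\cdots+X_N^N-NtX_1\cdots X_N=0$ in $\mathbb{P}^{N-1}_{T_0}$. The group $H_0=\{\xi\in\mu_N^N/\Delta\mu_N\mid\prod\xi_i=1\}$ acts by $X_i\mapsto\xi_iX_i$; let $V_B$ be the $H_0$-invariant part of $R^{N-2}\pi_*\mathbb{Z}[\frac1N,\zeta_N]^+$ over $T_0(\mathbb{C})$ ($R^+=R\cap\mathbb{R}$), locally constant of rank $n$ with perfect alternating pairing induced by the cup product, obtained by extension of scalars from $\mathbb{Z}[\frac1N]$. $\mathrm{MD}_n(\mathbb{F}_2)\subset\mathrm{Sp}_n(\mathbb{F}_2)$ is the image of the monodromy representation of $\pi_1(T_0(\mathbb{C}),t)$ on $V_{B,t}/\lambda$, for a prime $\lambda\mid2$ (the action is defined over $\mathbb{F}_2$). Equivalently (the paper's computational description), it is up to conjugacy generated in $\mathrm{SL}_n(\mathbb{F}_2)$ by the reductions mod $2$ of the companion matrices of $(X-1)^n$ and $\prod_{j=1}^{n}(X-\zeta_{n+1}^j)$, where the companion matrix of $X^n+c_1X^{n-1}+\cdots+c_n$ has $1$'s on the subdiagonal, last column $(-c_n,-c_{n-1},\dots,-c_1)^t$ and zeros elsewhere. Orthogonal groups. For $n=2m$, $F^+=\sum_{i=1}^mx_ix_{n+1-i}$, $F^-=\sum_{i=1}^{m-1}x_ix_{n+1-i}+(x_m^2+x_mx_{m+1}+x_{m+1}^2)$,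 and $\mathrm{O}_n^\pm(\mathbb{F}_2)=\{g\in\mathrm{GL}_n(\mathbb{F}_2)\mid F^\pm(gx)=F^\pm(x)\ \forall x\}$. Embeddings. If $n\equiv2\bmod4$, the quadratic map $\sum_{1\le i\le j\le n+2}x_ix_j$ restricted to $W=\{x\in\mathbb{F}_2^{n+2}\mid\sum x_i=0\}$ descends to a non-degenerate quadratic map on $W/\langle(1,\dots,1)\rangle\simeq\mathbb{F}_2^n$, and coordinate permutations embed $S_{n+2}$ in its orthogonal group, isomorphic to $\mathrm{O}_n^\pm(\mathbb{F}_2)$. If $n\equiv0\bmod4$, $\sum_{1\le i\le j\le n+1}x_ix_j$ on $W_1=\{x\in\mathbb{F}_2^{n+1}\mid\sum x_i=0\}\simeq\mathbb{F}_2^n$ is a non-degenerate quadratic map, and coordinate permutations embed $S_{n+1}$ in its orthogonal group, which the paper identifies with $\mathrm{O}_n^-(\mathbb{F}_2)$. *)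

theory Defs
  imports
    Complex_Main
    "HOL-Library.Z2"
    "HOL-Computational_Algebra.Polynomial"
    "HOL-Algebra.Sym_Groups"
    "Jordan_Normal_Form.Determinant"
begin

text \<open>The field with two elements is the type \<^typ>\<open>bit\<close>. Matrices and vectors are those of
  Jordan_Normal_Form, whose indices start at 0: the coordinate \<open>x\<^sub>i\<close> is \<open>x $ (i - 1)\<close>.\<close>

section \<open>Linear and orthogonal groups\<close>

definition GL_F2 :: "nat \<Rightarrow> bit mat monoid" where
  "GL_F2 n = units_of (ring_mat TYPE(bit) n ())"

definition SL_F2 :: "nat \<Rightarrow> bit mat monoid" where
  "SL_F2 n = (GL_F2 n) \<lparr>carrier := {A \<in> carrier (GL_F2 n). det A = 1}\<rparr>"

definition F_plus :: "nat \<Rightarrow> bit vec \<Rightarrow> bit" where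
  "F_plus n x = (\<Sum>i = 1..n div 2. x $ (i - 1) * x $ (n + 1 - i - 1))"

definition F_minus :: "nat \<Rightarrow> bit vec \<Rightarrow> bit" where
  "F_minus n x = (let m = n div 2 in
     (\<Sum>i = 1..m - 1. x $ (i - 1) * x $ (n + 1 - i - 1))
     + ((x $ (m - 1))\<^sup>2 + x $ (m - 1) * x $ m + (x $ m)\<^sup>2))"

definition O_plus_F2 :: "nat \<Rightarrow> bit mat monoid" where
  "O_plus_F2 n = (GL_F2 n)
     \<lparr>carrier := {g \<in> carrier (GL_F2 n). \<forall>x \<in> carrier_vec n. F_plus n (g *\<^sub>v x) = F_plus n x}\<rparr>"

definition O_minus_F2 :: "nat \<Rightarrow> bit mat monoid" where
  "O_minus_F2 n = (GL_F2 n)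
     \<lparr>carrier := {g \<in> carrier (GL_F2 n). \<forall>x \<in> carrier_vec n. F_minus n (g *\<^sub>v x) = F_minus n x}\<rparr>"


section \<open>The monodromy group\<close>

text \<open>For monic \<open>p = X\<^sup>n + c\<^sub>1 X\<^bsup>n-1\<^esup> + \<dots> + c\<^sub>n\<close> the last column is
  \<open>(-c\<^sub>n, \<dots>, -c\<^sub>1)\<close>, so its entry in row \<open>i\<close> (from 0) is minus the coefficient of \<open>X\<^sup>i\<close>.\<close>

definition companion_mat :: "'a :: comm_ring_1 poly \<Rightarrow> 'a mat" where
  "companion_mat p = mat (degree p) (degree p)
     (\<lambda>(i, j). if j = degree p - 1 then - coeff p i else if i = j + 1 then 1 else 0)"

text \<open>Reduction modulo 2 of a complex matrix with entries in the rational integers; it is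
  meaningful only for such matrices.\<close>

definition mod2_mat :: "complex mat \<Rightarrow> bit mat" where
  "mod2_mat = map_mat (\<lambda>z. of_int (THE k :: int. of_int k = z))"

definition zeta :: "nat \<Rightarrow> complex" where
  "zeta N = cis (2 * pi / real N)"

definition poly_unipotent :: "nat \<Rightarrow> complex poly" where
  "poly_unipotent n = [:-1, 1:] ^ n"

definition poly_cyclic :: "nat \<Rightarrow> complex poly" where
  "poly_cyclic n = (\<Prod>j = 1..n. [:- (zeta (n + 1) ^ j), 1:])"

text \<open>Both polynomials have rational integer coefficients, so their companion matrices can be
  reduced by \<^const>\<open>mod2_mat\<close>.\<close>

lemma coeff_poly_unipotent_in_Ints: "coeff (poly_unipotent n) i \<in> \<int>"
proof (induction n arbitrary: i)
  case 0
  show ?case by (simp add: poly_unipotent_def)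
next
  case (Suc n)
  have "poly_unipotent (Suc n) = pCons 0 (poly_unipotent n) - poly_unipotent n"
    by (simp add: poly_unipotent_def)
  with Suc.IH show ?case by (auto simp: coeff_pCons split: nat.split)
qed

lemma poly_cyclic_eq: "poly_cyclic n = (\<Sum>i\<le>n. monom 1 i)"
proof -
  let ?R = "{z :: complex. z ^ Suc n = 1}"
  let ?q = "\<Sum>i\<le>n. monom (1 :: complex) i"
  have zeta_pow: "zeta (n + 1) ^ j = cis (2 * pi * real j / real (Suc n))" for j
    by (simp add: zeta_def DeMoivre mult_ac)
  have bij: "bij_betw (\<lambda>j. zeta (n + 1) ^ j) {..<Suc n} ?R"
    using bij_betw_roots_unity[of "Suc n"] by (simp only: zeta_pow)
  have card: "card (?R - {1}) = n"
    using card_roots_unity_eq[of "Suc n"] by (simp add: card_Diff_singleton)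
  have deg: "degree (poly_cyclic n) = n"
    unfolding poly_cyclic_def by (subst degree_prod_eq_sum_degree) auto
  have "lead_coeff (poly_cyclic n) = 1"
    unfolding poly_cyclic_def by (subst lead_coeff_prod) simp
  then have lc: "coeff (poly_cyclic n) n = coeff ?q n"
    by (simp add: deg coeff_sum)
  have deg_q: "degree ?q \<le> n"
    by (rule degree_sum_le) (auto intro: order.trans[OF degree_monom_le])
  have vals: "poly (poly_cyclic n) z = poly ?q z" if z: "z \<in> ?R - {1}" for z
  proof -
    obtain j where j: "j < Suc n" "z = zeta (n + 1) ^ j"
      using z bij unfolding bij_betw_def by blast
    with z have "j \<noteq> 0" by (intro notI) simp
    with j have "poly (poly_cyclic n) z = 0"
      unfolding poly_cyclic_def poly_prod by (intro prod_zero) (auto intro!: bexI[of _ j])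
    moreover have "(1 - z) * poly ?q z = 0"
      using z by (simp only: poly_sum poly_monom mult_1 sum_gp_basic) simp
    ultimately show ?thesis using z by simp
  qed
  show ?thesis
    by (rule poly_eqI_degree_lead_coeff[OF lc, of "?R - {1}"])
       (use card deg deg_q vals in auto)
qed

lemma coeff_poly_cyclic_in_Ints: "coeff (poly_cyclic n) i \<in> \<int>"
  by (simp add: poly_cyclic_eq coeff_sum)

text \<open>The mod 2 monodromy group of the Dwork family \<open>X\<^sub>1\<^sup>N + \<dots> + X\<^sub>N\<^sup>N = N t X\<^sub>1 \<dots> X\<^sub>N\<close>
  (\<open>N = n + 1\<close>, action on the \<open>H\<^sub>0\<close>-invariant part of the middle cohomology), which is determined
  only up to conjugacy, in its description by generators in a suitable basis. The geometric
  origin of these generators is not formalized.\<close>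

definition MD_F2 :: "nat \<Rightarrow> bit mat monoid" where
  "MD_F2 n = (SL_F2 n) \<lparr>carrier := generate (SL_F2 n)
     {mod2_mat (companion_mat (poly_unipotent n)), mod2_mat (companion_mat (poly_cyclic n))}\<rparr>"


section \<open>Natural embeddings of symmetric groups\<close>

text \<open>Vector spaces over the field with two elements are represented by their additive groups:
  linear maps are the same as group homomorphisms.\<close>

definition vec_space_F2 :: "nat \<Rightarrow> bit vec monoid" where
  "vec_space_F2 N = monoid_vec TYPE(bit) N"

definition sum_zero_space :: "nat \<Rightarrow> bit vec monoid" where
  "sum_zero_space N = (vec_space_F2 N)
     \<lparr>carrier := {x \<in> carrier_vec N. (\<Sum>i<N. x $ i) = 0}\<rparr>"

definition ones_vec :: "nat \<Rightarrow> bit vec" where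
  "ones_vec N = vec N (\<lambda>_. 1)"

definition sum_zero_quotient :: "nat \<Rightarrow> bit vec set monoid" where
  "sum_zero_quotient N = sum_zero_space N Mod generate (sum_zero_space N) {ones_vec N}"

definition quad :: "nat \<Rightarrow> bit vec \<Rightarrow> bit" where
  "quad N x = (\<Sum>i<N. \<Sum>j = i..<N. x $ i * x $ j)"

text \<open>For \<open>4\<close> dividing \<open>N\<close> the form \<^term>\<open>quad N\<close> is constant on each coset in
  \<^term>\<open>sum_zero_quotient N\<close>; this is the form it induces there.\<close>

definition quad_quotient :: "nat \<Rightarrow> bit vec set \<Rightarrow> bit" where
  "quad_quotient N C = the_elem (quad N ` C)"

text \<open>The left action of permutations of \<open>{1..N}\<close> sending the \<open>i\<close>-th unit vector to the
  \<open>\<sigma> i\<close>-th one.\<close>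

definition coord_perm :: "nat \<Rightarrow> (nat \<Rightarrow> nat) \<Rightarrow> bit vec \<Rightarrow> bit vec" where
  "coord_perm N \<sigma> x = vec N (\<lambda>i. x $ (inv' \<sigma> (i + 1) - 1))"

definition quad_isometry ::
  "('a, 'c) monoid_scheme \<Rightarrow> ('a \<Rightarrow> bit) \<Rightarrow> ('b, 'd) monoid_scheme \<Rightarrow> ('b \<Rightarrow> bit) \<Rightarrow> ('a \<Rightarrow> 'b) \<Rightarrow> bool"
where
  "quad_isometry V q V' q' \<phi> \<longleftrightarrow> \<phi> \<in> iso V V' \<and> (\<forall>x \<in> carrier V. q' (\<phi> x) = q x)"

text \<open>The matrix of \<open>\<phi>\<inverse> \<circ> f \<circ> \<phi>\<close>, where \<open>f\<close> is a linear endomorphism of a space which \<open>\<phi>\<close>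
  identifies with the space of column vectors of length \<open>n\<close>.\<close>

definition matrix_via :: "nat \<Rightarrow> (bit vec \<Rightarrow> 'b) \<Rightarrow> ('b \<Rightarrow> 'b) \<Rightarrow> bit mat" where
  "matrix_via n \<phi> f =
     mat n n (\<lambda>(i, j). inv_into (carrier_vec n) \<phi> (f (\<phi> (unit_vec n j))) $ i)"

text \<open>The embedding of \<open>S\<^bsub>n+1\<^esub>\<close> (\<open>n\<close> divisible by 4) and of \<open>S\<^bsub>n+2\<^esub>\<close> (\<open>n\<close> congruent to 2
  modulo 4) into the orthogonal group of a form on column vectors, depending on a chosen isometry
  \<open>\<phi>\<close> to the space on which the permutations act. Two choices give embeddings that are conjugate
  in that orthogonal group.\<close>

definition nat_embedding_space :: "nat \<Rightarrow> (bit vec \<Rightarrow> bit vec) \<Rightarrow> (nat \<Rightarrow> nat) \<Rightarrow> bit mat" where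
  "nat_embedding_space n \<phi> \<sigma> = matrix_via n \<phi> (coord_perm (n + 1) \<sigma>)"

definition nat_embedding_quotient ::
  "nat \<Rightarrow> (bit vec \<Rightarrow> bit vec set) \<Rightarrow> (nat \<Rightarrow> nat) \<Rightarrow> bit mat" where
  "nat_embedding_quotient n \<phi> \<sigma> = matrix_via n \<phi> ((`) (coord_perm (n + 2) \<sigma>))"

end

theory Submission
  imports Defs "HOL-Library.Function_Algebras" "HOL-Number_Theory.Number_Theory"
begin

text \<open>Put \<open>N = n + 1\<close>. In suitable coordinates the second generator is the shift of sum-zero \<open>N\<close>-periodic
  binary sequences, and the first one is the shift followed by the transvection in one vector, for a non-degenerate
  quadratic form whose polar form takes the values \<open>N choose k\<close> on the shifts of this vector. Hence the group
  preserves the form and contains the transvections in all vectors that arise from these shifts by adding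
  non-orthogonal ones. By Lucas' theorem, unless \<open>N = 2\<^sup>m \<plusminus> 1\<close>, five of the shifts form a configuration that
  transpositions cannot form; starting from it all non-singular vectors arise, one hyperbolic plane at a time, and
  their transvections generate the full isometry group. The type of the form is the sign of its Gauss sum, which
  is \<open>(2/N)\<close>: for a prime \<open>p\<close> dividing \<open>N\<close>, the shift by \<open>N/p\<close> has order \<open>p\<close>, so that the Gauss sum is congruent
  modulo \<open>p\<close> to that of the sequences of period \<open>N/p\<close>.

  If \<open>N = 2\<^sup>m \<plusminus> 1\<close>, the \<open>N\<close>-th power of the difference operator has only few terms, and the space of sequences
  becomes the sum-zero permutation module of degree \<open>N\<close>, or that of degree \<open>N + 1\<close> modulo constants, with the shift as
  an \<open>N\<close>-cycle and the transvection as a transposition. For \<open>n = 4\<close> and \<open>n = 6\<close> every non-singular vector gives a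
  transposition, so that the symmetric group is the whole isometry group.\<close>

text \<open>The two companion matrices differ only in the last column, so the quotient of the
  generators is the identity plus a map of rank one. It is a transvection of an invariant form when
  its functional \<open>a \<mapsto> (diff_op ^^ N) a 0\<close> is the pairing with its vector
  \<open>cvec N 0\<close>; together with shift invariance this prescribes the Gram matrix of
  binomial coefficients. The obstacle to generation by transvections is the four-dimensional space
  of plus type, where they generate a proper subgroup of the isometry group. The four-vertex path
  spans the space of minus type instead, and each space after it has at least 64 elements, enough
  for all auxiliary vectors. The starting space has a defect of its own, as no two distinct non-zero
  singular vectors in it are orthogonal; this shapes the fifth vector, whose component
  \<open>z\<close> outside the span has to be singular. For the type, the absolute value of the
  Gauss sum is known in advance. Only a sign is left, and a congruence modulo an odd prime decides a
  sign.\<close>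

declare add_bit_eq_xor [simp del] mult_bit_eq_and [simp del] minus_bit_def [simp del]
  uminus_bit_def [simp del] power_bit_unfold [simp del]

lemma bit_add_self [simp]: "(b :: bit) + b = 0"
  by (cases b) auto

lemma bit_add_self_left [simp]: "(b :: bit) + (b + c) = c"
  by (cases b; cases c) auto

lemma bit_mult_self [simp]: "(b :: bit) * b = b"
  by (cases b) auto

lemma bit_add_eq_0_iff [simp]: "(a :: bit) + b = 0 \<longleftrightarrow> a = b"
  by (cases a; cases b) auto

lemma bit_add_eq_1_iff: "(a :: bit) + b = 1 \<longleftrightarrow> (a = 1) \<noteq> (b = 1)"
  by (cases a; cases b) auto

section \<open>Quadratic spaces over the field with two elements\<close>

text \<open>Scalars are only 0 and 1, so a vector space is an abelian group of exponent two and
  linear means additive. Symmetry of \<open>B\<close> and \<open>B x x = 0\<close> come out of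
  \<open>q_add\<close>. Subspaces are sets inside one type, on which the form as a whole may be
  degenerate.\<close>

locale quadratic_form_F2 =
  fixes q :: "'a :: ab_group_add \<Rightarrow> bit" and B :: "'a \<Rightarrow> 'a \<Rightarrow> bit"
  assumes two_torsion [simp]: "x + x = 0"
    and q_add: "q (x + y) = q x + q y + B x y"
    and B_add_left: "B (x + y) z = B x z + B y z"
begin

lemma two_torsion_left [simp]: "x + (x + y) = (y :: 'a)"
  by (metis add.assoc two_torsion add_0_left)

lemma add_eq_0_iff_eq [simp]: "x + y = 0 \<longleftrightarrow> x = (y :: 'a)"
  by (metis two_torsion two_torsion_left add.right_neutral)

lemma add_eq_iff_eq_add: "x + y = z \<longleftrightarrow> x = y + (z :: 'a)"
  by (metis two_torsion_left add.commute)

lemma B_0_left [simp]: "B 0 z = 0"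
  using B_add_left[of 0 0 z] by simp

lemma q_0 [simp]: "q 0 = 0"
  using q_add[of 0 0] by simp

lemma B_self [simp]: "B x x = 0"
  using q_add[of x x] by simp

lemma B_commute: "B x y = B y x"
  using q_add[of x y] q_add[of y x] by (simp add: add.commute)

lemma B_add_right: "B x (y + z) = B x y + B x z"
  by (simp add: B_commute[of x] B_add_left)

lemma B_0_right [simp]: "B z 0 = 0"
  by (simp add: B_commute[of z])

lemmas form_simps = q_add B_add_left B_add_right

definition subsp :: "'a set \<Rightarrow> bool" where
  "subsp U \<longleftrightarrow> 0 \<in> U \<and> (\<forall>x\<in>U. \<forall>y\<in>U. x + y \<in> U)"

definition nondeg :: "'a set \<Rightarrow> bool" where
  "nondeg U \<longleftrightarrow> (\<forall>x\<in>U. (\<forall>u\<in>U. B x u = 0) \<longrightarrow> x = 0)"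

text \<open>An orthogonal direct summand: every functional \<open>B x\<close>, with \<open>x\<close>
  from the whole type, is represented inside \<open>U\<close>, so that a projection to
  \<open>U\<close> exists. Building such spaces up plane by plane replaces dimension counts and dual
  bases; \<open>nondeg_split\<close> recovers the property for all finite non-degenerate
  subspaces.\<close>

definition split :: "'a set \<Rightarrow> bool" where
  "split U \<longleftrightarrow> subsp U \<and> nondeg U \<and> (\<forall>x. \<exists>y\<in>U. \<forall>u\<in>U. B x u = B y u)"

definition perp :: "'a \<Rightarrow> 'a set \<Rightarrow> bool" where
  "perp x U \<longleftrightarrow> (\<forall>u\<in>U. B x u = 0)"

text \<open>The span of a subspace \<open>U\<close> and the plane of \<open>z\<close> and
  \<open>w\<close>. When both are orthogonal to a split \<open>U\<close> and
  \<open>B z w = 1\<close>, the sum is direct (\<open>bij_adjoin\<close>).\<close>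

definition adjoin :: "'a set \<Rightarrow> 'a \<Rightarrow> 'a \<Rightarrow> 'a set" where
  "adjoin U z w = {u + v |u v. u \<in> U \<and> v \<in> {0, z, w, z + w}}"

lemma subspD: "subsp U \<Longrightarrow> x \<in> U \<Longrightarrow> y \<in> U \<Longrightarrow> x + y \<in> U" "subsp U \<Longrightarrow> 0 \<in> U"
  by (auto simp: subsp_def)

lemma perpD: "perp x U \<Longrightarrow> u \<in> U \<Longrightarrow> B x u = 0" "perp x U \<Longrightarrow> u \<in> U \<Longrightarrow> B u x = 0"
  by (auto simp: perp_def B_commute[of _ x])

lemma perp_add: "perp x U \<Longrightarrow> perp y U \<Longrightarrow> perp (x + y) U"
  by (auto simp: perp_def B_add_left)

lemma perp_0 [simp]: "perp 0 U"
  by (simp add: perp_def)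

lemma splitD: "split U \<Longrightarrow> subsp U" "split U \<Longrightarrow> nondeg U"
  unfolding split_def by simp_all

lemma nondeg_obtain:
  assumes "nondeg U" "x \<in> U" "x \<noteq> 0"
  obtains u where "u \<in> U" "B x u = 1"
  using assms unfolding nondeg_def by (metis bit_not_zero_iff)

lemma split_decomp:
  assumes "split U"
  obtains y z where "y \<in> U" "perp z U" "x = y + z"
proof -
  obtain y where y: "y \<in> U" "\<forall>u\<in>U. B x u = B y u"
    using assms unfolding split_def by blast
  show thesis
  proof (rule that[of y "x + y"])
    show "x = y + (x + y)" by (metis add.commute two_torsion_left)
  qed (use y in \<open>auto simp: perp_def B_add_left\<close>)
qed

lemma perp_in_0: "nondeg U \<Longrightarrow> perp x U \<Longrightarrow> x \<in> U \<Longrightarrow> x = 0"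
  by (auto simp: nondeg_def perp_def)

lemma adjoin_cases [consumes 1]:
  assumes "x \<in> adjoin U z w"
  obtains u where "u \<in> U" "x = u" | u where "u \<in> U" "x = u + z"
    | u where "u \<in> U" "x = u + w" | u where "u \<in> U" "x = u + (z + w)"
  using assms by (auto simp: adjoin_def)

lemma adjoinI0: "u \<in> U \<Longrightarrow> v \<in> {0, z, w, z + w} \<Longrightarrow> u + v \<in> adjoin U z w"
  unfolding adjoin_def by blast

lemma adjoinI: "u \<in> U \<Longrightarrow> u \<in> adjoin U z w" "u \<in> U \<Longrightarrow> u + z \<in> adjoin U z w"
    "u \<in> U \<Longrightarrow> u + w \<in> adjoin U z w" "u \<in> U \<Longrightarrow> u + (z + w) \<in> adjoin U z w"
  using adjoinI0[of u U 0 z w] adjoinI0[of u U _ z w] by auto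

lemma subset_adjoin: "U \<subseteq> adjoin U z w"
  by (auto intro: adjoinI)

lemma adjoin_gens: "subsp U \<Longrightarrow> z \<in> adjoin U z w" "subsp U \<Longrightarrow> w \<in> adjoin U z w"
    "subsp U \<Longrightarrow> z + w \<in> adjoin U z w"
  using adjoinI[of 0 U _ _, unfolded add_0_left] by (blast dest: subspD(2))+

lemma adjoin_subset: "subsp V \<Longrightarrow> U \<subseteq> V \<Longrightarrow> z \<in> V \<Longrightarrow> w \<in> V \<Longrightarrow> adjoin U z w \<subseteq> V"
  unfolding adjoin_def subsp_def by blast

lemma finite_adjoin: "finite U \<Longrightarrow> finite (adjoin U z w)"
proof -
  have "adjoin U z w = (\<lambda>(u, v). u + v) ` (U \<times> {0, z, w, z + w})"
    by (auto simp: adjoin_def)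
  then show "finite U \<Longrightarrow> ?thesis" by simp
qed

lemma subsp_adjoin: assumes "subsp U" shows "subsp (adjoin U z w)"
  unfolding subsp_def
proof (intro conjI ballI)
  show "0 \<in> adjoin U z w" using assms subset_adjoin by (auto simp: subsp_def)
next
  fix x y assume "x \<in> adjoin U z w" "y \<in> adjoin U z w"
  then obtain u v u' v' where *: "u \<in> U" "v \<in> {0, z, w, z + w}" "x = u + v"
      "u' \<in> U" "v' \<in> {0, z, w, z + w}" "y = u' + v'"
    by (auto simp: adjoin_def)
  have "x + y = (u + u') + (v + v')" using *(3,6) by (metis add.assoc add.left_commute)
  moreover have "v + v' \<in> {0, z, w, z + w}"
    using *(2,5) two_torsion_left[of w z] two_torsion_left[of z w] by (auto simp: add.commute[of _ z])
  ultimately show "x + y \<in> adjoin U z w"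
    using *(1,4) subspD(1)[OF assms] unfolding adjoin_def by blast
qed

lemma split_adjoin:
  assumes U: "split U" and z: "perp z U" and w: "perp w U" and zw: "B z w = 1"
  shows "split (adjoin U z w)"
proof -
  note perps = perpD[OF z] perpD[OF w]
  have sU: "subsp U" and nU: "nondeg U" using splitD[OF U] by auto
  have "x = 0" if x: "x \<in> adjoin U z w" and p: "\<forall>u\<in>adjoin U z w. B x u = 0" for x
  proof -
    have "B x z = 0" "B x w = 0" "\<forall>u\<in>U. B x u = 0"
      using p adjoin_gens[OF sU] subset_adjoin by blast+
    then show "x = 0"
      by (cases rule: adjoin_cases[OF x])
         (use perps zw nU in \<open>auto simp: B_add_left B_commute[of w z] nondeg_def\<close>)
  qed
  moreover have "\<exists>y\<in>adjoin U z w. \<forall>u\<in>adjoin U z w. B x u = B y u" for x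
  proof -
    obtain y where y: "y \<in> U" "\<forall>u\<in>U. B x u = B y u" using U unfolding split_def by blast
    \<comment> \<open>The pair is its own dual basis up to a swap: the coefficient of
      \<open>z\<close> is read off by pairing with \<open>w\<close>, and conversely.\<close>
    define v where "v = (if B x w = 1 then z else 0) + (if B x z = 1 then w else 0)"
    have v: "v \<in> {0, z, w, z + w}" by (auto simp: v_def)
    have "y + v \<in> adjoin U z w" using v y by (auto simp: adjoin_def)
    moreover have "\<forall>u\<in>adjoin U z w. B x u = B (y + v) u"
    proof
      fix u assume "u \<in> adjoin U z w"
      then show "B x u = B (y + v) u"
        by (cases rule: adjoin_cases; cases "B x z"; cases "B x w")
           (use y perps zw in \<open>auto simp: v_def form_simps B_commute[of w z]\<close>)
    qed
    ultimately show ?thesis by blast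
  qed
  ultimately show ?thesis
    using subsp_adjoin[OF sU] unfolding split_def nondeg_def by blast
qed

lemma split_0: "split {0}"
  by (auto simp: split_def subsp_def nondeg_def)

text \<open>Removing the \<open>U\<close>-component from a vector outside \<open>U\<close> leaves
  \<open>z \<noteq> 0\<close>. A partner of \<open>z\<close> in \<open>V\<close> exists by
  non-degeneracy, and removing its \<open>U\<close>-component does not change the pairing with
  \<open>z\<close>. Nothing is claimed about the values of \<open>q\<close> on the pair.\<close>

lemma hyperbolic_pair:
  assumes U: "split U" and V: "subsp V" "nondeg V" and UV: "U \<subseteq> V" "U \<noteq> V"
  obtains z w where "z \<in> V" "w \<in> V" "perp z U" "perp w U" "B z w = 1"
proof -
  obtain x where x: "x \<in> V" "x \<notin> U" using UV by blast
  obtain y z where yz: "y \<in> U" "perp z U" "x = y + z" using split_decomp[OF U] .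
  have "y + x = z" using yz by simp
  then have zV: "z \<in> V" using subspD(1)[OF V(1), of y x] UV x yz(1) by auto
  have "z \<noteq> 0" using x yz by auto
  then obtain s where s: "s \<in> V" "B z s = 1" using nondeg_obtain[OF V(2) zV] by blast
  obtain y' w where yw: "y' \<in> U" "perp w U" "s = y' + w" using split_decomp[OF U] .
  have "y' + s = w" using yw by simp
  then have "w \<in> V" using subspD(1)[OF V(1), of y' s] UV s yw(1) by auto
  moreover have "B z w = 1" using s yw perpD[OF yz(2)] by (simp add: B_add_right)
  ultimately show thesis using that zV yz yw by blast
qed

lemma adjoin_psubset:
  assumes "split U" "perp z U" "B z w = 1"
  shows "U \<subset> adjoin U z w"
proof -
  have "z \<notin> U"
    using perp_in_0[of U z] assms splitD by auto
  then show ?thesis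
    using subset_adjoin adjoin_gens[of U z w] assms splitD(1) by blast
qed

text \<open>Stands in for induction on the dimension: a finite non-degenerate \<open>V\<close> is
  reached from any split subspace by adding orthogonal planes, since \<open>hyperbolic_pair\<close>
  applies as long as something is missing.\<close>

lemma adjoin_induct [consumes 6, case_names adjoin]:
  assumes V: "finite V" "subsp V" "nondeg V" and U: "split U" "U \<subseteq> V" and P: "P U"
    and step: "\<And>X z w. split X \<Longrightarrow> U \<subseteq> X \<Longrightarrow> adjoin X z w \<subseteq> V \<Longrightarrow> perp z X \<Longrightarrow> perp w X
       \<Longrightarrow> B z w = 1 \<Longrightarrow> P X \<Longrightarrow> P (adjoin X z w)"
  shows "P V \<and> split V"
proof -
  have "P V \<and> split V" if "split X" "U \<subseteq> X" "X \<subseteq> V" "P X" for X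
    using that
  proof (induction "card V - card X" arbitrary: X rule: less_induct)
    case less
    show ?case
    proof (cases "X = V")
      case True with less show ?thesis by simp
    next
      case False
      obtain z w where zw: "z \<in> V" "w \<in> V" "perp z X" "perp w X" "B z w = 1"
        using hyperbolic_pair[OF \<open>split X\<close> V(2,3) \<open>X \<subseteq> V\<close> False] .
      have sub: "adjoin X z w \<subseteq> V" using adjoin_subset V less zw by blast
      have "X \<subset> adjoin X z w" using adjoin_psubset less zw by blast
      then have "card X < card (adjoin X z w)" "card (adjoin X z w) \<le> card V"
        using V sub by (meson finite_subset psubset_card_mono card_mono)+
      then have "card V - card (adjoin X z w) < card V - card X" by linarith
      then show ?thesis
        by (rule less.hyps)
           (use less zw sub split_adjoin step \<open>X \<subset> adjoin X z w\<close> in blast)+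
    qed
  qed
  then show ?thesis using U P by blast
qed

lemma nondeg_split: "finite V \<Longrightarrow> subsp V \<Longrightarrow> nondeg V \<Longrightarrow> split V"
  using adjoin_induct[of V "{0}" "\<lambda>_. True"] split_0 by (auto simp: subsp_def)

text \<open>A space is not the union of two hyperplanes: if \<open>a\<close> pairs only with
  \<open>y\<close> and \<open>b\<close> only with \<open>y'\<close>, then \<open>a + b\<close> pairs
  with both.\<close>

lemma common_nonorthogonal:
  assumes U: "subsp U" "nondeg U" and y: "y \<in> U" "y' \<in> U" "y \<noteq> 0" "y' \<noteq> 0"
  obtains w where "w \<in> U" "B w y = 1" "B w y' = 1"
proof -
  obtain a where a: "a \<in> U" "B a y = 1" using nondeg_obtain[OF U(2)] y by (metis B_commute)
  obtain b where b: "b \<in> U" "B b y' = 1" using nondeg_obtain[OF U(2)] y by (metis B_commute)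
  have "a + b \<in> U" using U a b by (auto simp: subsp_def)
  then show thesis using that a b
    by (cases "B a y'"; cases "B b y") (auto simp: B_add_left)
qed

lemma separating:
  assumes U: "subsp U" "nondeg U" and y: "y \<in> U" "y' \<in> U" "y \<noteq> 0" "y \<noteq> y'"
  obtains w where "w \<in> U" "B w y = 1" "B w y' = 0"
proof -
  have "y + y' \<in> U" using U y by (auto simp: subsp_def)
  then obtain w where "w \<in> U" "B w y = 1" "B w (y + y') = 1"
    using common_nonorthogonal[OF U, of y "y + y'"] y by auto
  then show thesis using that by (auto simp: B_add_right bit_add_eq_1_iff)
qed

lemma card_adjoin_le: "card (adjoin U z w) \<le> 4 * card U" if "finite U"
proof -
  have "adjoin U z w = (\<lambda>(u, v). u + v) ` (U \<times> {0, z, w, z + w})"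
    by (auto simp: adjoin_def)
  then have "card (adjoin U z w) \<le> card (U \<times> {0, z, w, z + w})"
    using that by (metis card_image_le finite.simps finite_cartesian_product)
  also have "\<dots> \<le> card U * 4"
    unfolding card_cartesian_product
    using card_length[of "[0, z, w, z + w]"] by (intro mult_left_mono) auto
  finally show ?thesis by simp
qed

lemma bij_adjoin:
  assumes "split U" "perp z U" "perp w U" "B z w = 1"
  shows "bij_betw (\<lambda>(u, v). u + v) (U \<times> {0, z, w, z + w}) (adjoin U z w)"
proof -
  have "inj_on (\<lambda>(u, v). u + v) (U \<times> {0, z, w, z + w})"
  proof (rule inj_onI, clarify)
    fix u v u' v' assume a: "u \<in> U" "v \<in> {0, z, w, z + w}" "u' \<in> U" "v' \<in> {0, z, w, z + w}"
      "u + v = u' + v'"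
    then have *: "u + u' = v + v'" by (metis add.commute add.left_commute two_torsion_left)
    moreover have "perp v U" "perp v' U" using a(2,4) assms(2,3) perp_add by auto
    then have "perp (v + v') U" by (rule perp_add)
    moreover have "u + u' \<in> U" using a assms splitD(1) subspD(1) by blast
    ultimately have "u + u' = 0" using perp_in_0[of U "u + u'"] assms(1) splitD(2) by auto
    then show "u = u' \<and> v = v'" using * by (metis add_eq_0_iff_eq)
  qed
  moreover have "adjoin U z w = (\<lambda>(u, v). u + v) ` (U \<times> {0, z, w, z + w})"
    by (auto simp: adjoin_def)
  ultimately show ?thesis by (simp add: bij_betw_def)
qed

lemma card_adjoin:
  assumes "finite U" "split U" "perp z U" "perp w U" "B z w = 1"
  shows "card (adjoin U z w) = 4 * card U"
proof -
  have "z \<noteq> 0" "w \<noteq> 0" "z \<noteq> w" using assms by auto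
  then show ?thesis
    using bij_betw_same_card[OF bij_adjoin[OF assms(2-)]]
    by (simp add: card_cartesian_product card_insert_if add_eq_iff_eq_add)
qed

text \<open>\<open>y\<close> and \<open>y'\<close> are completed to two mutually orthogonal planes,
  which together span at most 16 vectors; the bound on \<open>card U\<close> leaves room for a
  further plane orthogonal to them.\<close>

lemma hyperbolic_pair_orthogonal_to_pair:
  assumes U: "finite U" "subsp U" "nondeg U" "card U > 16" and y: "y \<in> U" "y' \<in> U" "y \<noteq> 0" "y' \<noteq> 0"
    "y \<noteq> y'" "B y y' = 0"
  obtains s t where "s \<in> U" "t \<in> U" "B s y = 0" "B s y' = 0" "B t y = 0" "B t y' = 0" "B s t = 1"
proof -
  obtain w where w: "w \<in> U" "B w y = 1" "B w y' = 0" using separating[OF U(2,3)] y by blast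
  obtain w' where w': "w' \<in> U" "B w' y' = 1" "B w' y = 0" using separating[OF U(2,3), of y' y] y by blast
  \<comment> \<open>Adding \<open>y\<close> changes only the pairing with \<open>w\<close>, since
    \<open>B y y' = 0\<close>; this makes the second plane orthogonal to the first.\<close>
  define w2 where "w2 = (if B w' w = 1 then w' + y else w')"
  have w2: "w2 \<in> U" "B w2 y' = 1" "B w2 y = 0" "B w2 w = 0"
    using w w' y U by (auto simp: w2_def subsp_def form_simps B_commute[of y w])
  let ?P = "adjoin {0} y w"
  have P: "split ?P" by (rule split_adjoin[OF split_0]) (use w in \<open>auto simp: perp_def B_commute\<close>)
  have perp: "perp y' ?P" "perp w2 ?P"
    using w2 w y by (auto simp: perp_def form_simps B_commute[of y' y] B_commute[of y' w] elim!: adjoin_cases)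
  let ?Q = "adjoin ?P y' w2"
  have Q: "split ?Q" by (rule split_adjoin[OF P perp]) (use w2 in \<open>simp add: B_commute\<close>)
  have "?Q \<subseteq> U" using U w w2 y by (intro adjoin_subset) (auto simp: subsp_def)
  moreover have "card ?Q \<le> 16"
  proof -
    have "card ?Q \<le> 4 * card ?P" by (intro card_adjoin_le finite_adjoin) simp
    also have "\<dots> \<le> 4 * (4 * card {0 :: 'a})" by (intro mult_left_mono card_adjoin_le) auto
    finally show ?thesis by simp
  qed
  then have "?Q \<noteq> U" using U by auto
  ultimately obtain s t where st: "s \<in> U" "t \<in> U" "perp s ?Q" "perp t ?Q" "B s t = 1"
    using hyperbolic_pair[OF Q U(2,3)] by blast
  have "y \<in> ?P" by (rule adjoin_gens) (simp add: subsp_def)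
  then have "y \<in> ?Q" using subset_adjoin by blast
  moreover have "y' \<in> ?Q" by (intro adjoin_gens splitD(1) P)
  ultimately show thesis using that st by (auto dest: perpD)
qed

text \<open>Two distinct vectors of equal value are exchanged by the transvection in their sum unless they are
  orthogonal, and then by way of the vector \<open>w\<close> here.\<close>

definition conn :: "'a set \<Rightarrow> bool" where
  "conn U \<longleftrightarrow> (\<forall>y\<in>U. \<forall>y'\<in>U. y \<noteq> 0 \<longrightarrow> y' \<noteq> 0 \<longrightarrow> y \<noteq> y' \<longrightarrow> q y = q y' \<longrightarrow> B y y' = 0 \<longrightarrow>
     (\<exists>w\<in>U. q w = q y \<and> B w y = 1 \<and> B w y' = 1))"

text \<open>If a common partner \<open>w\<close> has the wrong value, \<open>w + y\<close> has the
  right one: \<open>q (w + y) = q w + 1\<close> for singular \<open>y\<close>, and the pairings with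
  \<open>y\<close> and \<open>y'\<close> are unchanged.\<close>

lemma conn_singular:
  assumes U: "subsp U" "nondeg U" and y: "y \<in> U" "y' \<in> U" "y \<noteq> 0" "y' \<noteq> 0" "q y = 0" "B y y' = 0"
  shows "\<exists>w\<in>U. q w = 0 \<and> B w y = 1 \<and> B w y' = 1"
proof -
  obtain w where w: "w \<in> U" "B w y = 1" "B w y' = 1" using common_nonorthogonal[OF U y(1-4)] .
  show ?thesis
  proof (cases "q w = 0")
    case True then show ?thesis using w by blast
  next
    case False
    then have "q (w + y) = 0" "B (w + y) y = 1" "B (w + y) y' = 1" "w + y \<in> U"
      using w y U by (auto simp: form_simps subsp_def)
    then show ?thesis by blast
  qed
qed

lemma conn_large:
  assumes U: "finite U" "subsp U" "nondeg U" "card U > 16"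
  shows "conn U"
  unfolding conn_def
proof (intro ballI impI)
  fix y y' assume y: "y \<in> U" "y' \<in> U" "y \<noteq> 0" "y' \<noteq> 0" "y \<noteq> y'" "q y = q y'" "B y y' = 0"
  show "\<exists>w\<in>U. q w = q y \<and> B w y = 1 \<and> B w y' = 1"
  proof (cases "q y = 0")
    case True then show ?thesis using conn_singular[OF U(2,3)] y by auto
  next
    case False
    then have 1: "q y = 1" by simp
    obtain w where w: "w \<in> U" "B w y = 1" "B w y' = 1" using common_nonorthogonal[OF U(2,3) y(1-4)] .
    obtain s t where st: "s \<in> U" "t \<in> U" "B s y = 0" "B s y' = 0" "B t y = 0" "B t y' = 0" "B s t = 1"
      using hyperbolic_pair_orthogonal_to_pair[OF U y(1-5,7)] .
    \<comment> \<open>On the plane of \<open>s\<close> and \<open>t\<close> the function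
      \<open>q x + B w x\<close> is again quadratic with polar form \<open>B\<close>, so
      \<open>B s t = 1\<close> forces it to take both values.\<close>
    have "\<exists>x\<in>{0, s, t, s + t}. q (w + x) = 1"
      by (cases "q w"; cases "q s + B w s"; cases "q t + B w t")
         (use st in \<open>auto simp: form_simps bit_add_eq_1_iff\<close>)
    then obtain x where x: "x \<in> {0, s, t, s + t}" "q (w + x) = 1" by blast
    have "w + x \<in> U" "B (w + x) y = 1" "B (w + x) y' = 1"
      using x st w U by (auto simp: form_simps subsp_def)
    then show ?thesis using x 1 by auto
  qed
qed

end

section \<open>Transvections and the isometries they generate\<close>

context quadratic_form_F2
begin

definition trv :: "'a \<Rightarrow> 'a \<Rightarrow> 'a" where
  "trv r x = (if B x r = 1 then x + r else x)"

lemma trv_add: "trv r (x + y) = trv r x + trv r y"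
proof -
  have *: "x + r + (y + r) = x + y" by (metis add.assoc add.commute two_torsion_left)
  show ?thesis
    by (cases "B x r"; cases "B y r") (use * in \<open>auto simp: trv_def B_add_left add.assoc add.left_commute\<close>)
qed

lemma trv_0 [simp]: "trv r 0 = 0"
  by (simp add: trv_def)

lemma trv_trv [simp]: "trv r (trv r x) = x"
  by (auto simp: trv_def B_add_left add.assoc)

lemma q_trv: "q r = 1 \<Longrightarrow> q (trv r x) = q x"
  by (auto simp: trv_def q_add)

lemma trv_in: "subsp U \<Longrightarrow> r \<in> U \<Longrightarrow> x \<in> U \<Longrightarrow> trv r x \<in> U"
  by (auto simp: trv_def dest: subspD)

lemma trv_perp: "B x r = 0 \<Longrightarrow> trv r x = x"
  by (simp add: trv_def)

definition trvs :: "'a list \<Rightarrow> 'a \<Rightarrow> 'a" where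
  "trvs rs = foldr trv rs"

lemma trvs_simps [simp]: "trvs [] x = x" "trvs (r # rs) x = trv r (trvs rs x)"
    "trvs (rs @ ss) x = trvs rs (trvs ss x)"
  by (simp_all add: trvs_def)

lemma trvs_add: "trvs rs (x + y) = trvs rs x + trvs rs y"
  by (induction rs) (auto simp: trv_add)

lemma trvs_rev [simp]: "trvs (rev rs) (trvs rs x) = x"
  by (induction rs arbitrary: x) auto

lemma trvs_rev' [simp]: "trvs rs (trvs (rev rs) x) = x"
  using trvs_rev[of "rev rs"] by simp

definition nonsing :: "'a set \<Rightarrow> 'a set" where
  "nonsing U = {r \<in> U. q r = 1}"

lemma q_trvs: "set rs \<subseteq> nonsing U \<Longrightarrow> q (trvs rs x) = q x"
  by (induction rs) (auto simp: q_trv nonsing_def)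

lemma trvs_closed: "subsp U \<Longrightarrow> set rs \<subseteq> nonsing U \<Longrightarrow> x \<in> U \<Longrightarrow> trvs rs x \<in> U"
  by (induction rs) (auto simp: nonsing_def intro: trv_in)

lemma trvs_perp: "set rs \<subseteq> nonsing U \<Longrightarrow> perp x U \<Longrightarrow> trvs rs x = x"
  by (induction rs) (auto simp: nonsing_def trv_perp perp_def)

text \<open>Additivity and preservation of \<open>q\<close> give preservation of \<open>B\<close>,
  so injectivity on a non-degenerate \<open>U\<close> is automatic (\<open>isom_inj\<close>).
  Nothing is demanded outside \<open>U\<close>, whereas products of transvections act on the whole
  type; hence \<open>gen_by_trv\<close> compares the two on \<open>U\<close> only.\<close>

definition isom :: "'a set \<Rightarrow> ('a \<Rightarrow> 'a) \<Rightarrow> bool" where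
  "isom U g \<longleftrightarrow> (\<forall>x\<in>U. g x \<in> U \<and> q (g x) = q x) \<and> (\<forall>x\<in>U. \<forall>y\<in>U. g (x + y) = g x + g y)"

definition gen_by_trv :: "'a set \<Rightarrow> bool" where
  "gen_by_trv U \<longleftrightarrow>
     (\<forall>g. isom U g \<longrightarrow> (\<exists>rs. set rs \<subseteq> nonsing U \<and> (\<forall>x\<in>U. g x = trvs rs x)))"

lemma isom_B: "subsp U \<Longrightarrow> isom U g \<Longrightarrow> x \<in> U \<Longrightarrow> y \<in> U \<Longrightarrow> B (g x) (g y) = B x y"
proof -
  assume a: "subsp U" "isom U g" "x \<in> U" "y \<in> U"
  then have "g x + g y = g (x + y)" "x + y \<in> U" by (auto simp: isom_def dest: subspD)
  with a have "q (g x + g y) = q (x + y)" "q (g x) = q x" "q (g y) = q y"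
    by (auto simp: isom_def dest: subspD)
  then show ?thesis by (simp add: q_add)
qed

lemma isom_trvs: "subsp U \<Longrightarrow> set rs \<subseteq> nonsing U \<Longrightarrow> isom U g \<Longrightarrow> isom U (\<lambda>x. trvs rs (g x))"
  by (auto simp: isom_def trvs_add q_trvs trvs_closed)

lemma isom_inj: "subsp U \<Longrightarrow> nondeg U \<Longrightarrow> isom U g \<Longrightarrow> x \<in> U \<Longrightarrow> g x = 0 \<Longrightarrow> x = 0"
  using isom_B[of U g x] unfolding nondeg_def by (metis B_0_left)

lemma move_vector:
  assumes U: "subsp U" "conn U" and y: "y \<in> U" "y' \<in> U" "y \<noteq> 0" "y' \<noteq> 0" "q y = q y'"
  obtains rs where "set rs \<subseteq> nonsing U" "trvs rs y = y'"
proof (cases "y = y'")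
  case True then show thesis using that[of "[]"] by simp
next
  case False
  have one: "y1 + y2 \<in> nonsing U \<and> trv (y1 + y2) y1 = y2"
    if "y1 \<in> U" "y2 \<in> U" "q y1 = q y2" "B y1 y2 = 1" for y1 y2
    using that U by (auto simp: nonsing_def form_simps trv_def dest: subspD)
  show thesis
  proof (cases "B y y' = 1")
    case True then show thesis using that[of "[y + y']"] one[of y y'] y by simp
  next
    case F: False
    then have "B y y' = 0" by simp
    then obtain w where w: "w \<in> U" "q w = q y" "B w y = 1" "B w y' = 1"
      using U(2) y False unfolding conn_def by blast
    show thesis
      by (rule that[of "[w + y', y + w]"])
         (use one[of w y'] one[of y w] w y B_commute[of y w] in auto)
  qed
qed

text \<open>The condition on \<open>U\<close> under which the stabiliser of a vector of a hyperbolic pair orthogonal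
  to \<open>U\<close> is transitive enough.\<close>

definition roomy :: "'a set \<Rightarrow> bool" where
  "roomy U \<longleftrightarrow> (\<forall>u\<in>U. u \<noteq> 0 \<longrightarrow> q u = 0 \<longrightarrow> (\<exists>s\<in>U. \<exists>t\<in>U. B s u = 0 \<and> B t u = 0 \<and> B s t = 1))"

lemma roomy_large:
  assumes U: "finite U" "subsp U" "nondeg U" "card U > 4"
  shows "roomy U"
  unfolding roomy_def
proof (intro ballI impI)
  fix u assume u: "u \<in> U" "u \<noteq> 0" "q u = 0"
  then obtain w where w: "w \<in> U" "B u w = 1" using nondeg_obtain[OF U(3)] by blast
  let ?P = "adjoin {0} u w"
  have P: "split ?P" by (rule split_adjoin[OF split_0]) (use w in \<open>auto simp: perp_def B_commute\<close>)
  have "?P \<subseteq> U" using U w u by (intro adjoin_subset) (auto dest: subspD)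
  moreover have "card ?P \<le> 4" using card_adjoin_le[of "{0}" u w] by simp
  then have "?P \<noteq> U" using U by auto
  ultimately obtain s t where st: "s \<in> U" "t \<in> U" "perp s ?P" "perp t ?P" "B s t = 1"
    using hyperbolic_pair[OF P U(2,3)] by blast
  moreover have "u \<in> ?P" by (rule adjoin_gens) (simp add: subsp_def)
  ultimately show "\<exists>s\<in>U. \<exists>t\<in>U. B s u = 0 \<and> B t u = 0 \<and> B s t = 1"
    by (meson perpD(1))
qed

lemma gen_by_trv_0: "gen_by_trv {0}"
  unfolding gen_by_trv_def isom_def by (auto intro!: exI[of _ "[]"])

text \<open>Witt's argument: after multiplication by transvections \<open>g\<close> fixes
  \<open>z\<close> and then \<open>w\<close>, and an isometry fixing both preserves their orthogonal
  complement \<open>U\<close>. The delicate point is to move the image of \<open>w\<close> back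
  without disturbing \<open>z\<close>.\<close>

lemma gen_by_trv_adjoin:
  assumes U: "split U" "roomy U" "gen_by_trv U" and zw: "perp z U" "perp w U" "B z w = 1"
    and V: "V = adjoin U z w" "conn V"
  shows "gen_by_trv V"
  unfolding gen_by_trv_def
proof (intro allI impI)
  fix g assume g: "isom V g"
  have sV: "split V" using split_adjoin[OF U(1) zw] V by simp
  have UV: "U \<subseteq> V" and zV: "z \<in> V" and wV: "w \<in> V"
    using subset_adjoin adjoin_gens splitD(1)[OF U(1)] V by auto
  note V' = splitD[OF sV] and U' = splitD[OF U(1)]
  have z0: "z \<noteq> 0" and w0: "w \<noteq> 0" using zw by auto
  have gz: "g z \<in> V" "q (g z) = q z" "g z \<noteq> 0"
    using g zV isom_inj[OF V' g zV] z0 by (auto simp: isom_def)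
  obtain rs1 where rs1: "set rs1 \<subseteq> nonsing V" "trvs rs1 (g z) = z"
    using move_vector[OF V'(1) V(2) gz(1) zV gz(3) z0 gz(2)] .
  define g1 where "g1 = (\<lambda>x. trvs rs1 (g x))"
  have g1: "isom V g1" unfolding g1_def by (rule isom_trvs[OF V'(1) rs1(1) g])
  have g1z: "g1 z = z" using rs1 by (simp add: g1_def)
  define w' where "w' = g1 w"
  have w': "w' \<in> V" "q w' = q w" "B z w' = 1"
    using g1 wV isom_B[OF V'(1) g1 zV wV] g1z zw by (auto simp: isom_def w'_def)
  \<comment> \<open>Equal pairings with \<open>z\<close> make \<open>y1 + y2\<close> orthogonal to
    \<open>z\<close>, so that its transvection fixes \<open>z\<close>.\<close>
  have one: "y1 + y2 \<in> nonsing V \<and> trv (y1 + y2) y1 = y2 \<and> trv (y1 + y2) z = z"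
    if "y1 \<in> V" "y2 \<in> V" "q y1 = q y2" "B y1 y2 = 1" "B z y1 = 1" "B z y2 = 1" for y1 y2
    using that V' by (auto simp: nonsing_def form_simps trv_def dest: subspD)
  have "\<exists>rs. set rs \<subseteq> nonsing V \<and> trvs rs w' = w \<and> trvs rs z = z"
  proof (cases "w' = w")
    case True then show ?thesis by (intro exI[of _ "[]"]) simp
  next
    case ne: False
    show ?thesis
    proof (cases "B w' w = 1")
      case True
      then show ?thesis using one[of w' w] w' wV zw by (intro exI[of _ "[w' + w]"]) auto
    next
      case False
      then have Bww: "B w' w = 0" by simp
      \<comment> \<open>If \<open>w'\<close> and \<open>w\<close> are distinct and orthogonal, no
        single transvection takes one to the other. The detour goes over a vector \<open>v\<close>
        that pairs to 1 with both and with \<open>z\<close>. As \<open>u\<close> is a singular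
        vector of \<open>U\<close>, \<open>roomy\<close> gives a plane orthogonal to it, in which
        the value of \<open>v\<close> is corrected without changing these pairings.\<close>
      define u where "u = w + w'"
      have w'u: "w' = w + u" by (simp add: u_def)
      have "u \<in> V" using w' wV V' by (auto simp: u_def dest: subspD)
      moreover have Bu: "B u z = 0" "B u w = 0" using w' zw Bww
        by (auto simp: u_def form_simps B_commute[of _ z])
      ultimately have uU: "u \<in> U" unfolding V(1)
      proof (cases rule: adjoin_cases)
        case (1 a) then show ?thesis by simp
      qed (use zw Bu in \<open>auto simp: form_simps perpD B_commute[of w z]\<close>)
      have u: "u \<noteq> 0" "q u = 0"
        using ne w' Bww by (auto simp: u_def q_add B_commute[of w w'])
      obtain s t where st: "s \<in> U" "t \<in> U" "B s u = 0" "B t u = 0" "B s t = 1"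
        using U(2) uU u unfolding roomy_def by blast
      have stz: "B s z = 0" "B t z = 0" "B s w = 0" "B t w = 0" using zw st by (auto dest: perpD)
      obtain y where y: "y \<in> V" "B y z = 1" "B y w = 1" "B y w' = 1"
      proof -
        have "z + w \<in> V" using zV wV V' by (auto dest: subspD)
        then show thesis
          by (rule that) (use zw w' Bu w'u in \<open>auto simp: form_simps B_commute[of w z] perpD[OF zw(1) uU] perpD[OF zw(2) uU]\<close>)
      qed
      have "\<exists>a\<in>{0, s, t, s + t}. q (y + a) = q w"
        by (cases "q y"; cases "q s + B y s"; cases "q t + B y t"; cases "q w")
           (use st in \<open>auto simp: form_simps bit_add_eq_1_iff\<close>)
      then obtain a where a: "a \<in> {0, s, t, s + t}" "q (y + a) = q w" by blast
      define v where "v = y + a"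
      have v: "v \<in> V" "B v z = 1" "B v w = 1" "B v w' = 1" "q v = q w"
        using a y st stz UV V' unfolding v_def w'u by (auto simp: form_simps dest: subspD)
      show ?thesis
        by (rule exI[of _ "[v + w, w' + v]"])
           (use one[of v w] one[of w' v] v w' wV zw in \<open>auto simp: B_commute[of z v] B_commute[of w' v]\<close>)
    qed
  qed
  then obtain rs2 where rs2: "set rs2 \<subseteq> nonsing V" "trvs rs2 w' = w" "trvs rs2 z = z" by blast
  define g2 where "g2 = (\<lambda>x. trvs rs2 (g1 x))"
  have g2: "isom V g2" unfolding g2_def by (rule isom_trvs[OF V'(1) rs2(1) g1])
  have fix2: "g2 z = z" "g2 w = w" using rs2 by (simp_all add: g2_def g1z w'_def)
  have "isom U g2"
  proof -
    have "g2 x \<in> U" if x: "x \<in> U" for x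
    proof -
      have xV: "x \<in> V" using x UV by blast
      have *: "B (g2 x) z = 0" "B (g2 x) w = 0"
        using isom_B[OF V'(1) g2 xV zV] isom_B[OF V'(1) g2 xV wV] fix2 zw x by (auto dest: perpD)
      have "g2 x \<in> adjoin U z w" using g2 xV V by (auto simp: isom_def)
      then show ?thesis
        by (cases rule: adjoin_cases)
           (use * zw in \<open>auto simp: form_simps perpD B_commute[of w z]\<close>)
    qed
    then show ?thesis using g2 UV by (auto simp: isom_def subset_iff)
  qed
  then obtain rs3 where rs3: "set rs3 \<subseteq> nonsing U" "\<forall>x\<in>U. g2 x = trvs rs3 x"
    using U(3) unfolding gen_by_trv_def by blast
  have g2_eq: "g2 x = trvs rs3 x" if x: "x \<in> V" for x
  proof -
    have *: "g2 (a + b) = g2 a + g2 b" if "a \<in> V" "b \<in> V" for a b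
      using g2 that by (auto simp: isom_def)
    have zwV: "z + w \<in> V" using zV wV V' by (auto dest: subspD)
    have fz: "trvs rs3 z = z" "trvs rs3 w = w" using trvs_perp[OF rs3(1)] zw by auto
    show ?thesis using x unfolding V(1)
      by (cases rule: adjoin_cases)
         (use rs3 fz fix2 * zV wV zwV UV in \<open>auto simp: trvs_add subset_iff\<close>)
  qed
  show "\<exists>rs. set rs \<subseteq> nonsing V \<and> (\<forall>x\<in>V. g x = trvs rs x)"
  proof (intro exI conjI ballI)
    show "set (rev rs1 @ rev rs2 @ rs3) \<subseteq> nonsing V"
      using rs1 rs2 rs3 UV by (auto simp: nonsing_def)
    fix x assume "x \<in> V"
    then have "trvs rs3 x = trvs rs2 (trvs rs1 (g x))" using g2_eq by (simp add: g2_def g1_def)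
    then show "g x = trvs (rev rs1 @ rev rs2 @ rs3) x" by simp
  qed
qed

end

section \<open>The four-dimensional space of minus type spanned by a path\<close>

context quadratic_form_F2
begin

text \<open>The Dynkin diagram A4 modulo 2. The ten non-singular vectors of the span are the sums
  over connected pieces of the path, that is, the positive roots.\<close>

definition path4 :: "'a \<Rightarrow> 'a \<Rightarrow> 'a \<Rightarrow> 'a \<Rightarrow> bool" where
  "path4 a b c d \<longleftrightarrow> q a = 1 \<and> q b = 1 \<and> q c = 1 \<and> q d = 1 \<and>
     B a b = 1 \<and> B b c = 1 \<and> B c d = 1 \<and> B a c = 0 \<and> B a d = 0 \<and> B b d = 0"

text \<open>\<open>a + c\<close> is the component of \<open>c\<close> orthogonal to the plane of
  \<open>a\<close> and \<open>b\<close>, so the span appears as an orthogonal sum of two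
  planes.\<close>

definition span_path4 :: "'a \<Rightarrow> 'a \<Rightarrow> 'a \<Rightarrow> 'a \<Rightarrow> 'a set" where
  "span_path4 a b c d = adjoin (adjoin {0} a b) (a + c) d"

lemma span_path4_cases:
  assumes "x \<in> span_path4 a b c d"
  shows "x \<in> {0, a, b, c, d, a + b, b + c, c + d, a + b + c, b + c + d, a + b + c + d,
    a + c, a + d, b + d, a + c + d, a + b + d}"
  using assms unfolding span_path4_def
  by (elim adjoin_cases) (simp_all add: add_ac)

context
  fixes a b c d
  assumes path: "path4 a b c d"
begin

lemmas path_simps = path[unfolded path4_def] B_commute[of b a] B_commute[of c a] B_commute[of d a]
  B_commute[of c b] B_commute[of d b] B_commute[of d c]

lemma perp_plane: "perp a {0}" "perp b {0}" "perp (a + c) (adjoin {0} a b)" "perp d (adjoin {0} a b)"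
  unfolding perp_def by (auto elim!: adjoin_cases simp: path_simps form_simps)

lemma split_plane: "split (adjoin {0} a b)"
  by (rule split_adjoin[OF split_0]) (simp_all add: perp_plane path_simps)

lemma split_path4: "split (span_path4 a b c d)"
  unfolding span_path4_def
  by (rule split_adjoin[OF split_plane]) (simp_all add: perp_plane path_simps form_simps)

lemma finite_path4: "finite (span_path4 a b c d)"
  by (simp add: span_path4_def finite_adjoin)

lemma card_path4: "card (span_path4 a b c d) = 16"
proof -
  have "card (adjoin {0} a b) = 4"
    by (subst card_adjoin) (simp_all add: split_0 perp_plane path_simps)
  then show ?thesis unfolding span_path4_def
    by (subst card_adjoin) (simp_all add: finite_adjoin split_plane perp_plane path_simps form_simps)
qed

lemma path4_in: "{a, b, c, d} \<subseteq> span_path4 a b c d"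
proof -
  have a: "a \<in> adjoin {0} a b" and b: "b \<in> adjoin {0} a b"
    by (rule adjoin_gens, simp add: subsp_def)+
  have "a + (a + c) \<in> span_path4 a b c d" "0 + d \<in> span_path4 a b c d"
    unfolding span_path4_def by (rule adjoinI a subspD(2) splitD split_plane)+
  then show ?thesis using a b subset_adjoin unfolding span_path4_def by auto
qed

lemma path4_singular:
  assumes "x \<in> span_path4 a b c d" "q x = 0"
  shows "x \<in> {0, a + c, a + d, b + d, a + c + d, a + b + d}"
  using span_path4_cases[OF assms(1)] assms(2) by (auto simp: path_simps form_simps)

text \<open>That is, the span of a path on four vertices is of minus type.\<close>

lemma path4_no_singular_plane:
  assumes "x \<in> span_path4 a b c d" "y \<in> span_path4 a b c d" "q x = 0" "q y = 0" "B x y = 0"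
    "x \<noteq> 0" "y \<noteq> 0"
  shows "x = y"
  using path4_singular[OF assms(1,3)] path4_singular[OF assms(2,4)] assms(5-)
  by (auto simp: path_simps form_simps)

text \<open>Vacuous, like \<open>roomy_plane\<close>: all three non-zero vectors of this plane have
  value 1, and no two distinct ones are orthogonal.\<close>

lemma conn_plane: "conn (adjoin {0} a b)"
  unfolding conn_def by (auto elim!: adjoin_cases simp: path_simps form_simps)

lemma roomy_plane: "roomy (adjoin {0} a b)"
  unfolding roomy_def by (auto elim!: adjoin_cases simp: path_simps form_simps)

text \<open>With 16 elements the space is too small for \<open>conn_large\<close>. For
  \<open>q y = 1\<close>, a singular common partner \<open>w\<close> would be orthogonal to the
  singular vector \<open>y + y'\<close>, hence equal to it, which contradicts
  \<open>B w y = 1\<close>.\<close>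

lemma conn_path4: "conn (span_path4 a b c d)"
  unfolding conn_def
proof (intro ballI impI)
  let ?U = "span_path4 a b c d"
  note U = splitD[OF split_path4]
  fix y y' assume y: "y \<in> ?U" "y' \<in> ?U" "y \<noteq> 0" "y' \<noteq> 0" "y \<noteq> y'" "q y = q y'" "B y y' = 0"
  show "\<exists>w\<in>?U. q w = q y \<and> B w y = 1 \<and> B w y' = 1"
  proof (cases "q y = 0")
    case True then show ?thesis using conn_singular[OF U y(1-4)] y by auto
  next
    case False
    obtain w where w: "w \<in> ?U" "B w y = 1" "B w y' = 1" using common_nonorthogonal[OF U y(1-4)] .
    have "q w \<noteq> 0"
    proof
      assume "q w = 0"
      moreover have "y + y' \<in> ?U" using U(1) y(1,2) by (rule subspD)
      moreover have "q (y + y') = 0" "B w (y + y') = 0" "w \<noteq> 0" "y + y' \<noteq> 0"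
        using y(5-7) w by (auto simp: form_simps)
      ultimately have "w = y + y'" using path4_no_singular_plane[of w "y + y'"] w by blast
      then show False using w y by (simp add: form_simps B_commute[of y' y])
    qed
    then show ?thesis using w False by auto
  qed
qed

lemma gen_by_trv_path4: "gen_by_trv (span_path4 a b c d)"
proof -
  have "gen_by_trv (adjoin {0} a b)"
    by (rule gen_by_trv_adjoin[OF split_0 _ gen_by_trv_0 perp_plane(1,2) _ refl conn_plane])
       (simp_all add: path_simps roomy_def)
  then show ?thesis
    by (rule gen_by_trv_adjoin[OF split_plane roomy_plane _ perp_plane(3,4) _ span_path4_def conn_path4])
       (simp add: path_simps form_simps)
qed

text \<open>Starting at the span of a path, every intermediate space has at least 16 elements and
  every enlarged one at least 64, beyond the bounds of \<open>roomy_large\<close> and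
  \<open>conn_large\<close>.\<close>

lemma gen_by_trv_main:
  assumes V: "finite V" "subsp V" "nondeg V" and abcd: "span_path4 a b c d \<subseteq> V"
  shows "gen_by_trv V"
proof -
  have "gen_by_trv V \<and> split V"
    using V split_path4 abcd gen_by_trv_path4
  proof (induction rule: adjoin_induct)
    case (adjoin X z w)
    have fX: "finite X" using adjoin V subset_adjoin by (meson finite_subset)
    have "16 \<le> card X" using card_mono[OF fX \<open>span_path4 a b c d \<subseteq> X\<close>] by (simp add: card_path4)
    then have "roomy X" "conn (adjoin X z w)"
      using adjoin fX splitD split_adjoin
      by (auto intro!: roomy_large conn_large simp: finite_adjoin card_adjoin)
    then show ?case using gen_by_trv_adjoin adjoin by blast
  qed
  then show ?thesis ..
qed

end

section \<open>Sets of vectors closed under adding non-orthogonal members\<close>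

definition rich :: "'a set \<Rightarrow> bit \<Rightarrow> bool" where
  "rich U \<alpha> \<longleftrightarrow> (\<forall>\<beta>. \<exists>p\<in>U. \<exists>p'\<in>U. p \<noteq> 0 \<and> p' \<noteq> 0 \<and> p \<noteq> p' \<and> B p p' = 0 \<and> q p = \<alpha> \<and> q p' = \<beta>)"

lemma path4_distinct:
  assumes "path4 a b c d"
  shows "a \<noteq> 0" "b \<noteq> 0" "c \<noteq> 0" "d \<noteq> 0" "a \<noteq> b" "a \<noteq> c" "a \<noteq> d"
proof -
  have *: "B a b = 1" "B b c = 1" "B c d = 1" "B b d = 0" "B a c = 0" "B a d = 0"
    using assms by (auto simp: path4_def)
  show "a \<noteq> 0" "b \<noteq> 0" "c \<noteq> 0" "d \<noteq> 0" "a \<noteq> b" using * by auto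
  show "a \<noteq> c" "a \<noteq> d" using * B_commute[of d b] by auto
qed

lemma rich_path4: assumes path: "path4 a b c d" shows "rich (span_path4 a b c d) 1"
  unfolding rich_def
proof
  note path_simps[OF path, simp]
  have mem: "a \<in> span_path4 a b c d" "c \<in> span_path4 a b c d" "d \<in> span_path4 a b c d"
    using path4_in[OF path] by auto
  then have ad: "a + d \<in> span_path4 a b c d" using split_path4[OF path] by (auto dest: splitD subspD)
  have ne: "a \<noteq> 0" "c \<noteq> 0" "d \<noteq> 0" "a \<noteq> c" "a \<noteq> d"
    using path4_distinct[OF path] by auto
  fix \<beta>
  show "\<exists>p\<in>span_path4 a b c d. \<exists>p'\<in>span_path4 a b c d.
      p \<noteq> 0 \<and> p' \<noteq> 0 \<and> p \<noteq> p' \<and> B p p' = 0 \<and> q p = 1 \<and> q p' = \<beta>"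
  proof (cases "\<beta> = 0")
    case True
    have "a \<noteq> a + d" "a + d \<noteq> 0" "B a (a + d) = 0" "q (a + d) = 0"
      using ne by (auto simp: form_simps)
    then show ?thesis using mem ad ne True by (intro bexI[of _ a] bexI[of _ "a + d"]) auto
  next
    case False
    then show ?thesis using mem ne by (intro bexI[of _ a] bexI[of _ c]) auto
  qed
qed

text \<open>The value 1 is already available in the span of the path. For the value 0 a vector
  \<open>z\<close> orthogonal to that span is brought in, since inside it two distinct non-zero
  singular vectors are never orthogonal.\<close>

lemma rich_large:
  assumes path: "path4 a b c d" and U: "finite U" "split U" "span_path4 a b c d \<subseteq> U" "card U > 16"
  shows "rich U \<alpha>"
proof (cases "\<alpha> = 0")
  case False
  then have "\<alpha> = 1" by simp
  then show ?thesis using rich_path4[OF path] U(3) unfolding rich_def by (meson subsetD)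
next
  case True
  let ?A = "span_path4 a b c d"
  note path_simps[OF path, simp]
  have "?A \<noteq> U" using U card_path4[OF path] by auto
  then obtain z w where z: "z \<in> U" "w \<in> U" "perp z ?A" "perp w ?A" "B z w = 1"
    using hyperbolic_pair[OF split_path4[OF path] splitD[OF U(2)] U(3)] by blast
  have mem: "a \<in> ?A" "c \<in> ?A" "d \<in> ?A" "b \<in> ?A" using path4_in[OF path] by auto
  have zp: "B z b = 0" "B z a = 0" "B z c = 0" "B z d = 0" "B a z = 0" "B c z = 0" "B d z = 0"
    using z mem by (auto dest: perpD)
  have ne: "a \<noteq> d" "a \<noteq> c" using path4_distinct[OF path] by auto
  have z0: "z \<noteq> 0" using z by auto
  have "z \<noteq> a + d" using zp by (auto simp: form_simps)
  have inU: "a + d \<in> U" "a + z \<in> U" "a \<in> U"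
    using mem U(3) z splitD(1)[OF U(2)] by (auto dest: subspD)
  have "\<exists>p'\<in>U. p' \<noteq> 0 \<and> a + d \<noteq> p' \<and> B (a + d) p' = 0 \<and> q p' = 0"
  proof (cases "q z = 0")
    case True
    then show ?thesis using z z0 zp \<open>z \<noteq> a + d\<close> by (intro bexI[of _ z]) (auto simp: form_simps)
  next
    case False
    have "B d c = 1" "B a b = 1" by simp_all
    then have "z \<noteq> d" "z \<noteq> a" using zp by auto
    then show ?thesis using inU zp False by (intro bexI[of _ "a + z"]) (auto simp: form_simps)
  qed
  then obtain p' where p': "p' \<in> U" "p' \<noteq> 0" "a + d \<noteq> p'" "B (a + d) p' = 0" "q p' = 0" by blast
  have ad: "a + d \<noteq> 0" "q (a + d) = 0" using ne by (auto simp: form_simps)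
  show ?thesis unfolding rich_def True
  proof
    fix \<beta>
    show "\<exists>p\<in>U. \<exists>p'\<in>U. p \<noteq> 0 \<and> p' \<noteq> 0 \<and> p \<noteq> p' \<and> B p p' = 0 \<and> q p = 0 \<and> q p' = \<beta>"
    proof (cases "\<beta> = 0")
      case True then show ?thesis using p' ad inU by blast
    next
      case False
      have "a + d \<noteq> a" "a \<noteq> 0" "B (a + d) a = 0" "q a = 1"
        using path4_distinct[OF path] by (auto simp: form_simps)
      then show ?thesis using ad inU False by (intro bexI[of _ "a + d"] bexI[of _ a]) auto
    qed
  qed
qed

text \<open>Models the vectors whose transvections lie in a given group: for
  \<open>B r s = 1\<close> the sum \<open>r + s\<close> is the image of \<open>r\<close> under the
  transvection in \<open>s\<close>, so its transvection is a conjugate.\<close>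

definition trv_closed :: "'a set \<Rightarrow> bool" where
  "trv_closed R \<longleftrightarrow> (\<forall>r\<in>R. q r = 1) \<and> (\<forall>r\<in>R. \<forall>s\<in>R. B r s = 1 \<longrightarrow> r + s \<in> R)"

lemma trvs_in_closed:
  "trv_closed R \<Longrightarrow> set rs \<subseteq> R \<Longrightarrow> x \<in> R \<Longrightarrow> trvs rs x \<in> R"
  by (induction rs) (auto simp: trv_closed_def trv_def)

text \<open>Products of transvections from \<open>U\<close> move \<open>p\<close> to
  \<open>p'\<close> and fix \<open>z\<close>. So one member of \<open>R\<close> in the coset
  \<open>U + z\<close> yields all those whose \<open>U\<close>-component is non-zero and has the
  same value.\<close>

lemma coset_in_closed:
  assumes R: "trv_closed R" and U: "subsp U" "conn U" "nonsing U \<subseteq> R" and z: "perp z U"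
    and p: "p \<in> U" "p' \<in> U" "p \<noteq> 0" "p' \<noteq> 0" "q p = q p'" and pz: "p + z \<in> R"
  shows "p' + z \<in> R"
proof -
  obtain rs where rs: "set rs \<subseteq> nonsing U" "trvs rs p = p'" using move_vector[OF U(1,2) p] .
  have "trvs rs (p + z) \<in> R" by (rule trvs_in_closed[OF R _ pz]) (use rs U in blast)
  then show ?thesis using rs trvs_perp[OF rs(1) z] by (simp add: trvs_add)
qed

text \<open>Each of the cosets of \<open>z\<close>, \<open>w\<close> and \<open>z + w\<close> gets
  one member of \<open>R\<close>, which \<open>coset_in_closed\<close> spreads to all non-singular
  vectors of the coset except possibly \<open>z\<close>, \<open>w\<close>, \<open>z + w\<close>
  themselves; if non-singular, these are sums of members of the two other cosets.\<close>

lemma full_step: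
  assumes R: "trv_closed R" and U: "split U" "conn U" "nonsing U \<subseteq> R"
    and y: "y \<in> U" "y \<noteq> 0" "perp z U" "y + z \<in> R" and s: "s \<in> R" "B s z = 1"
    and rich: "rich U (1 + q z)" and V: "subsp V" "U \<subseteq> V" "R \<subseteq> V"
  obtains w where "w \<in> V" "perp w U" "B z w = 1" "nonsing (adjoin U z w) \<subseteq> R"
proof -
  note U' = splitD[OF U(1)]
  have yz: "B y z = 0" using y by (auto dest: perpD)
  have qR: "q r = 1" if "r \<in> R" for r using that R by (auto simp: trv_closed_def)
  have addR: "r + s \<in> R" if "r \<in> R" "s \<in> R" "B r s = 1" for r s
    using that R by (auto simp: trv_closed_def)
  obtain y' w where w: "y' \<in> U" "y' \<noteq> 0" "perp w U" "y' + w \<in> R" "B z w = 1"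
  proof -
    obtain y' w where w: "y' \<in> U" "perp w U" "s = y' + w" using split_decomp[OF U(1)] .
    have zw: "B z w = 1" using s w y by (auto simp: form_simps B_commute[of w z] dest: perpD)
    show thesis
    proof (cases "y' = 0")
      case False then show thesis using that w zw s by blast
    next
      \<comment> \<open>If \<open>s\<close> is orthogonal to \<open>U\<close>, replacing
        \<open>w\<close> by \<open>z + w\<close> gives a member of \<open>R\<close> with a non-zero
        \<open>U\<close>-component, as the spreading requires.\<close>
      case True
      have "B (y + z) s = 1" using True w zw y by (auto simp: form_simps dest: perpD)
      then have "y + (z + w) \<in> R" using addR[OF y(4) s(1)] True w by (simp add: add.assoc)
      moreover have "B z (z + w) = 1" using zw by (simp add: form_simps)
      ultimately show thesis using that[of y "z + w"] y w perp_add by blast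
    qed
  qed
  note perps = perpD[OF y(3)] perpD[OF w(3)]
  have qy: "q y = 1 + q z" using qR[OF y(4)] yz by (cases "q y"; cases "q z") (auto simp: q_add)
  have qy': "q y' = 1 + q w" using qR[OF w(4)] perps w
    by (cases "q y'"; cases "q w") (auto simp: q_add)
  have cz: "p + z \<in> R" if "p \<in> U" "p \<noteq> 0" "q p = 1 + q z" for p
    using coset_in_closed[OF R U'(1) U(2,3) y(3) y(1) that(1) y(2) that(2) _ y(4)] that qy by simp
  have cw: "p + w \<in> R" if "p \<in> U" "p \<noteq> 0" "q p = 1 + q w" for p
    using coset_in_closed[OF R U'(1) U(2,3) w(3) w(1) that(1) w(2) that(2) _ w(4)] that qy' by simp
  have zw: "perp (z + w) U" using y w perp_add by blast
  \<comment> \<open>\<open>rich\<close> is made for this: \<open>p + z\<close> and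
    \<open>p' + w\<close> lie in \<open>R\<close> by their values and are not orthogonal, and their
    sum has the non-zero \<open>U\<close>-component \<open>p + p'\<close>.\<close>
  obtain p p' where p: "p \<in> U" "p' \<in> U" "p \<noteq> 0" "p' \<noteq> 0" "p \<noteq> p'" "B p p' = 0"
      "q p = 1 + q z" "q p' = 1 + q w"
    using rich unfolding rich_def by blast
  have pp: "(p + p') + (z + w) \<in> R"
  proof -
    have "B (p + z) (p' + w) = 1" using p perps w by (simp add: form_simps)
    then have "(p + z) + (p' + w) \<in> R" using addR cz cw p by blast
    then show ?thesis by (simp add: add_ac)
  qed
  have czw: "x + (z + w) \<in> R" if x: "x \<in> U" "x \<noteq> 0" "q x = 1 + q (z + w)" for x
  proof (rule coset_in_closed[OF R U'(1) U(2,3) zw _ x(1) _ x(2) _ pp])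
    show "p + p' \<in> U" using p U' by (auto dest: subspD)
    show "p + p' \<noteq> 0" using p by simp
    show "q (p + p') = q x" using p x w
      by (cases "q z"; cases "q w") (auto simp: form_simps)
  qed
  have z0: "z \<in> R" if "q z = 1"
  proof -
    have "(p' + w) + (p' + (z + w)) \<in> R"
      by (rule addR[OF cw czw]) (use p w perps that in \<open>auto simp: form_simps B_commute[of w z]\<close>)
    then show ?thesis by (simp add: add_ac)
  qed
  have w0: "w \<in> R" if "q w = 1"
  proof -
    have "(p + z) + (p + (z + w)) \<in> R"
      by (rule addR[OF cz czw]) (use p w perps that in \<open>auto simp: form_simps B_commute[of w z]\<close>)
    then show ?thesis by (simp add: add_ac)
  qed
  have zw0: "z + w \<in> R" if "q (z + w) = 1"
  proof -
    have "q z = q w" using that w by (cases "q z"; cases "q w") (auto simp: form_simps)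
    then have "(p + z) + (p + w) \<in> R"
      by (intro addR[OF cz cw]) (use p w perps in \<open>auto simp: form_simps\<close>)
    then show ?thesis by (simp add: add_ac)
  qed
  have "nonsing (adjoin U z w) \<subseteq> R"
  proof
    fix x assume "x \<in> nonsing (adjoin U z w)"
    then have x: "x \<in> adjoin U z w" "q x = 1" by (auto simp: nonsing_def)
    have *: "q u = 1 + q v" if "q (u + v) = 1" "perp v U" "u \<in> U" for u v
      using that by (cases "q u"; cases "q v") (auto simp: q_add perpD)
    from x(1) show "x \<in> R"
    proof (cases rule: adjoin_cases)
      case (1 u) then show ?thesis using U x by (auto simp: nonsing_def)
    next
      case (2 u) then show ?thesis using cz[of u] z0 *[of u z] x y by (cases "u = 0") auto
    next
      case (3 u) then show ?thesis using cw[of u] w0 *[of u w] x w by (cases "u = 0") auto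
    next
      case (4 u) then show ?thesis using czw[of u] zw0 *[of u "z + w"] x zw by (cases "u = 0") auto
    qed
  qed
  moreover have "w \<in> V"
  proof -
    have "y' + (y' + w) \<in> V" using w V by (auto dest: subspD)
    then show ?thesis by simp
  qed
  ultimately show thesis using that w by blast
qed

text \<open>A space \<open>U\<close> whose non-singular vectors all lie in \<open>R\<close> is
  enlarged along a member of \<open>R\<close> that is neither in \<open>U\<close> nor orthogonal to
  it. The span of the path is rich for the value 1 only, so the first enlargement takes a member
  whose component outside the span is singular; this is what \<open>r\<close> provides.\<close>

theorem all_nonsingular_in_closed:
  assumes V: "finite V" "subsp V" "nondeg V" and R: "trv_closed R" "R \<subseteq> V"
    and span: "\<And>x. x \<in> V \<Longrightarrow> x \<noteq> 0 \<Longrightarrow> \<exists>s\<in>R. B s x = 1"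
    and connected: "\<And>X. X \<subseteq> R \<Longrightarrow> X \<noteq> {} \<Longrightarrow> (\<And>x y. x \<in> X \<Longrightarrow> y \<in> R - X \<Longrightarrow> B x y = 0) \<Longrightarrow> X = R"
    and path: "path4 a b c d" and full4: "nonsing (span_path4 a b c d) \<subseteq> R" and sub: "span_path4 a b c d \<subseteq> V"
    and r: "r \<in> R" "B r a = 1" "B r b = 1" "B r c = 1" "B r d = 0" "r \<noteq> a + b"
  shows "nonsing V \<subseteq> R"
proof -
  let ?A = "span_path4 a b c d"
  note path_simps[OF path, simp]
  have mem: "a \<in> ?A" "b \<in> ?A" "c \<in> ?A" "d \<in> ?A" using path4_in[OF path] by auto
  note A' = splitD[OF split_path4[OF path]]
  have abA: "a + b \<in> ?A" using mem A' by (auto dest: subspD)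
  have big: "nonsing V \<subseteq> R" if "split U" "?A \<subseteq> U" "U \<subseteq> V" "nonsing U \<subseteq> R" "card U > 16" for U
    using that
  proof (induction "card V - card U" arbitrary: U rule: less_induct)
    case less
    note U' = splitD[OF less(2)]
    have fU: "finite U" using finite_subset[OF less(4) V(1)] .
    show ?case
    proof (cases "U = V")
      case True with less show ?thesis by simp
    next
      case False
      have "\<exists>r\<in>R. r \<notin> U \<and> \<not> perp r U"
      proof (rule ccontr)
        assume "\<not> ?thesis"
        then have *: "\<And>r. r \<in> R \<Longrightarrow> r \<in> U \<or> perp r U" by blast
        \<comment> \<open>Under the assumption \<open>R\<close> consists of two mutually orthogonal
          parts, so connectedness puts it inside \<open>U\<close>; then a non-zero vector orthogonal
          to \<open>U\<close> pairs to 1 with no member of \<open>R\<close>.\<close>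
        have "R \<inter> U = R"
        proof (rule connected)
          have "a \<in> nonsing U" using mem less by (auto simp: nonsing_def)
          then show "R \<inter> U \<noteq> {}" using less by (auto simp: nonsing_def)
        qed (use * in \<open>auto dest: perpD\<close>)
        moreover obtain z w where z: "z \<in> V" "w \<in> V" "perp z U" "B z w = 1"
          using hyperbolic_pair[OF less(2) V(2,3) less(4) False] by blast
        moreover have "z \<noteq> 0" using \<open>B z w = 1\<close> by auto
        then obtain s where "s \<in> R" "B s z = 1" using span[OF \<open>z \<in> V\<close>] by blast
        ultimately show False using perpD(2)[of z U s] by auto
      qed
      then obtain r where r: "r \<in> R" "r \<notin> U" "\<not> perp r U" by blast
      obtain y z where yz: "y \<in> U" "perp z U" "r = y + z" using split_decomp[OF less(2)] .
      have y0: "y \<noteq> 0" and z0: "z \<noteq> 0" using yz r by auto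
      have "y + r \<in> V" using yz(1) r less V R by (auto dest: subspD)
      then have zV: "z \<in> V" using yz by simp
      obtain s where s: "s \<in> R" "B s z = 1" using span[OF zV z0] by blast
      have cU: "conn U" by (rule conn_large[OF fU U' less(6)])
      have rich: "rich U (1 + q z)" by (rule rich_large[OF path fU less(2,3,6)])
      obtain w where w: "w \<in> V" "perp w U" "B z w = 1" "nonsing (adjoin U z w) \<subseteq> R"
        using full_step[OF R(1) less(2) cU less(5) yz(1) y0 yz(2) _ s rich V(2) less(4) R(2)] r yz by blast
      have sub: "adjoin U z w \<subseteq> V" by (rule adjoin_subset[OF V(2) less(4) zV w(1)])
      have card: "card (adjoin U z w) = 4 * card U" by (rule card_adjoin[OF fU less(2) yz(2) w(2,3)])
      have "card (adjoin U z w) \<le> card V" using sub V by (simp add: card_mono)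
      then have "card V - card (adjoin U z w) < card V - card U" using card less(6) by linarith
      then show ?thesis
        by (rule less(1))
           (use split_adjoin[OF less(2) yz(2) w(2,3)] sub w card less order.trans[OF less(3) subset_adjoin] in auto)
    qed
  qed
  text \<open>The projection of \<open>r\<close> to the span of the path is \<open>a + b\<close>.\<close>
  define z where "z = r + (a + b)"
  have z0: "z \<noteq> 0" using r by (simp add: z_def)
  have qr: "q r = 1" using R r by (auto simp: trv_closed_def)
  \<comment> \<open>Here \<open>q r = q (a + b) = 1\<close> and \<open>B r (a + b) = 0\<close>. So
    \<open>1 + q z = 1\<close>, the value for which the span is rich.\<close>
  have qz: "q z = 0" unfolding z_def using qr r by (simp add: form_simps)
  have zV: "z \<in> V" using r(1) R abA sub V by (auto simp: z_def dest: subspD)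
  have zp: "perp z ?A" unfolding perp_def
  proof
    have *: "B z a = 0" "B z b = 0" "B z c = 0" "B z d = 0"
      unfolding z_def using r by (auto simp: form_simps)
    fix u assume "u \<in> ?A"
    from span_path4_cases[OF this] show "B z u = 0" using * by (auto simp: B_add_right)
  qed
  have rR: "(a + b) + z \<in> R" using r by (simp add: z_def add_ac)
  obtain s where s: "s \<in> R" "B s z = 1" using span[OF zV z0] by blast
  have "a + b \<noteq> 0" using path4_distinct[OF path] by simp
  then obtain w where w: "w \<in> V" "perp w ?A" "B z w = 1" "nonsing (adjoin ?A z w) \<subseteq> R"
    using full_step[OF R(1) split_path4[OF path] conn_path4[OF path] full4 abA _ zp rR s _ V(2) sub R(2)]
      rich_path4[OF path] qz by auto
  show ?thesis
    by (rule big[of "adjoin ?A z w"])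
       (use w split_adjoin[OF split_path4[OF path] zp w(2,3)] adjoin_subset[OF V(2) sub zV w(1)]
         card_adjoin[OF finite_path4[OF path] split_path4[OF path] zp w(2,3)] card_path4[OF path]
         subset_adjoin in auto)
qed

end

section \<open>The type of a quadratic form\<close>

definition sgn_bit :: "bit \<Rightarrow> int" where
  "sgn_bit b = (if b = 0 then 1 else - 1)"

lemma sgn_bit_simps [simp]: "sgn_bit 0 = 1" "sgn_bit 1 = - 1" "sgn_bit b * sgn_bit b = 1"
  by (auto simp: sgn_bit_def)

lemma sgn_bit_add: "sgn_bit (a + b) = sgn_bit a * sgn_bit b"
  by (cases a; cases b) (auto simp: sgn_bit_def)

text \<open>Both standard forms pair coordinate \<open>i\<close> with coordinate
  \<open>n + 1 - i\<close>, so removing the two outer coordinates splits off one hyperbolic plane;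
  the induction on the type builds the forms from the middle outwards.\<close>

definition mid_vec :: "nat \<Rightarrow> bit vec \<Rightarrow> bit vec" where
  "mid_vec n x = vec n (\<lambda>i. x $ (i + 1))"

lemma mid_vec_carrier [simp]: "mid_vec n x \<in> carrier_vec n"
  by (simp add: mid_vec_def)

lemma mid_vec_add:
  "x \<in> carrier_vec (n + 2) \<Longrightarrow> y \<in> carrier_vec (n + 2) \<Longrightarrow> mid_vec n (x + y) = mid_vec n x + mid_vec n y"
  by (auto simp: mid_vec_def)

lemma Suc_pred_pred: "2 \<le> a \<Longrightarrow> Suc (a - Suc (Suc 0)) = a - Suc 0"
  by simp

lemma F_plus_step:
  "F_plus (2 * m + 2) x = x $ 0 * x $ (2 * m + 1) + F_plus (2 * m) (mid_vec (2 * m) x)"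
proof -
  have "F_plus (2 * m + 2) x = (\<Sum>i = 1..Suc m. x $ (i - 1) * x $ (2 * m + 2 + 1 - i - 1))"
    by (simp add: F_plus_def)
  also have "\<dots> = x $ 0 * x $ (2 * m + 1) + (\<Sum>i = 2..Suc m. x $ (i - 1) * x $ (2 * m + 2 + 1 - i - 1))"
    by (subst sum.atLeast_Suc_atMost) (auto simp: numeral_2_eq_2)
  also have "(\<Sum>i = 2..Suc m. x $ (i - 1) * x $ (2 * m + 2 + 1 - i - 1)) =
      (\<Sum>i = 1..m. mid_vec (2 * m) x $ (i - 1) * mid_vec (2 * m) x $ (2 * m + 1 - i - 1))"
    by (rule sum.reindex_bij_witness[of _ Suc "\<lambda>i. i - 1"])
       (auto simp: mid_vec_def Suc_diff_le Suc_pred_pred intro!: arg_cong2[of _ _ _ _ "(*)"] arg_cong[of _ _ "($) x"])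
  finally show ?thesis by (simp add: F_plus_def)
qed

lemma F_minus_step:
  assumes "m \<ge> 1"
  shows "F_minus (2 * m + 2) x = x $ 0 * x $ (2 * m + 1) + F_minus (2 * m) (mid_vec (2 * m) x)"
proof -
  have "(\<Sum>i = 1..m. x $ (i - 1) * x $ (2 * m + 2 + 1 - i - 1)) =
     x $ 0 * x $ (2 * m + 1) + (\<Sum>i = 2..m. x $ (i - 1) * x $ (2 * m + 2 + 1 - i - 1))"
    using assms by (subst sum.atLeast_Suc_atMost) (auto simp: numeral_2_eq_2)
  also have "(\<Sum>i = 2..m. x $ (i - 1) * x $ (2 * m + 2 + 1 - i - 1)) =
      (\<Sum>i = 1..m - 1. mid_vec (2 * m) x $ (i - 1) * mid_vec (2 * m) x $ (2 * m + 1 - i - 1))"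
    by (rule sum.reindex_bij_witness[of _ Suc "\<lambda>i. i - 1"])
       (auto simp: mid_vec_def Suc_diff_le Suc_pred_pred intro!: arg_cong2[of _ _ _ _ "(*)"] arg_cong[of _ _ "($) x"])
  finally show ?thesis using assms
    by (simp add: F_minus_def Let_def mid_vec_def add.assoc)
qed

section \<open>Gauss sums and the two types of forms\<close>

context quadratic_form_F2
begin

definition gauss_sum :: "'a set \<Rightarrow> int" where
  "gauss_sum U = (\<Sum>x\<in>U. sgn_bit (q x))"

text \<open>Gauss sums multiply over orthogonal sums; the plane contributes 2 or, if
  \<open>q\<close> is 1 on all its non-zero vectors, -2.\<close>

lemma gauss_sum_adjoin:
  assumes "finite U" "split U" and zw: "perp z U" "perp w U" "B z w = 1"
  shows "gauss_sum (adjoin U z w) = gauss_sum U * (1 + sgn_bit (q z) + sgn_bit (q w) + sgn_bit (q (z + w)))"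
proof -
  have *: "z \<noteq> 0" "w \<noteq> 0" "z \<noteq> w" using zw by auto
  have "gauss_sum (adjoin U z w) = (\<Sum>x\<in>U \<times> {0, z, w, z + w}. sgn_bit (q (fst x + snd x)))"
    unfolding gauss_sum_def
    by (subst sum.reindex_bij_betw[OF bij_adjoin[OF assms(2-)], symmetric])
       (auto intro!: sum.cong)
  also have "\<dots> = (\<Sum>x\<in>U. \<Sum>v\<in>{0, z, w, z + w}. sgn_bit (q (x + v)))"
    by (subst sum.cartesian_product) (auto intro!: sum.cong)
  also have "\<dots> = (\<Sum>x\<in>U. \<Sum>v\<in>{0, z, w, z + w}. sgn_bit (q x) * sgn_bit (q v))"
  proof (intro sum.cong refl)
    fix x v assume "x \<in> U" "v \<in> {0, z, w, z + w}"
    then have "B x v = 0" using perpD(2)[OF zw(1)] perpD(2)[OF zw(2)] by (auto simp: B_add_right)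
    then show "sgn_bit (q (x + v)) = sgn_bit (q x) * sgn_bit (q v)" by (simp add: q_add sgn_bit_add)
  qed
  also have "\<dots> = gauss_sum U * (\<Sum>v\<in>{0, z, w, z + w}. sgn_bit (q v))"
    by (simp add: gauss_sum_def sum_product)
  also have "(\<Sum>v\<in>{0, z, w, z + w}. sgn_bit (q v)) = 1 + sgn_bit (q z) + sgn_bit (q w) + sgn_bit (q (z + w))"
    using * by (simp add: add_eq_iff_eq_add)
  finally show ?thesis .
qed

lemma character_sum:
  assumes U: "finite U" "subsp U" "nondeg U" and t: "t \<in> U" "t \<noteq> 0"
  shows "(\<Sum>x\<in>U. sgn_bit (B x t)) = 0"
proof -
  obtain s where s: "s \<in> U" "B t s = 1" using nondeg_obtain[OF U(3) t] .
  have "(\<Sum>x\<in>U. sgn_bit (B x t)) = (\<Sum>x\<in>U. sgn_bit (B (x + s) t))"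
    by (rule sum.reindex_bij_witness[of _ "\<lambda>x. x + s" "\<lambda>x. x + s"])
       (use s U in \<open>auto simp: add.assoc dest: subspD\<close>)
  also have "\<dots> = - (\<Sum>x\<in>U. sgn_bit (B x t))"
    unfolding B_add_left sgn_bit_add B_commute[of s t] s(2) by (simp add: sum_negf)
  finally show ?thesis by simp
qed

text \<open>With \<open>y = x + t\<close> one has \<open>q x + q y = q t + B x t\<close>; summing
  over \<open>x\<close> first leaves a character sum, which vanishes unless
  \<open>t = 0\<close>.\<close>

lemma gauss_sum_square:
  assumes U: "finite U" "subsp U" "nondeg U"
  shows "gauss_sum U ^ 2 = int (card U)"
proof -
  have "gauss_sum U ^ 2 = (\<Sum>x\<in>U. \<Sum>y\<in>U. sgn_bit (q x) * sgn_bit (q y))"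
    by (simp add: gauss_sum_def power2_eq_square sum_product)
  also have "\<dots> = (\<Sum>x\<in>U. \<Sum>t\<in>U. sgn_bit (q x) * sgn_bit (q (x + t)))"
  proof (rule sum.cong[OF refl])
    fix x assume x: "x \<in> U"
    show "(\<Sum>y\<in>U. sgn_bit (q x) * sgn_bit (q y)) = (\<Sum>t\<in>U. sgn_bit (q x) * sgn_bit (q (x + t)))"
      by (rule sum.reindex_bij_witness[of _ "\<lambda>y. x + y" "\<lambda>y. x + y"])
         (use x U in \<open>auto dest: subspD\<close>)
  qed
  also have "\<dots> = (\<Sum>x\<in>U. \<Sum>t\<in>U. sgn_bit (q t) * sgn_bit (B x t))"
    by (simp add: q_add sgn_bit_add mult.assoc[symmetric])
  also have "\<dots> = (\<Sum>t\<in>U. sgn_bit (q t) * (\<Sum>x\<in>U. sgn_bit (B x t)))"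
    by (subst sum.swap) (simp add: sum_distrib_left)
  also have "\<dots> = (\<Sum>t\<in>U. if t = 0 then int (card U) else 0)"
    by (intro sum.cong refl) (auto simp: character_sum[OF U])
  also have "\<dots> = int (card U)" using U by (simp add: sum.delta subsp_def)
  finally show ?thesis .
qed

definition vec_iso :: "nat \<Rightarrow> (bit vec \<Rightarrow> 'a) \<Rightarrow> 'a set \<Rightarrow> bool" where
  "vec_iso n \<chi> V \<longleftrightarrow> bij_betw \<chi> (carrier_vec n) V \<and>
     (\<forall>x\<in>carrier_vec n. \<forall>y\<in>carrier_vec n. \<chi> (x + y) = \<chi> x + \<chi> y)"

definition sc :: "bit \<Rightarrow> 'a \<Rightarrow> 'a" where
  "sc b x = (if b = 1 then x else 0)"

lemma sc_simps [simp]: "sc 0 x = 0" "sc 1 x = x" "B (sc b x) y = b * B x y" "B y (sc b x) = b * B y x"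
    "q (sc b x) = b * q x"
  by (cases b; auto simp: sc_def)+

lemma sc_add: "sc (b + b') x = sc b x + sc b' x"
  by (cases b; cases b') auto

lemma vec_iso_adjoin:
  assumes U: "split U" "vec_iso n \<chi> U" and zw: "perp z U" "perp w U" "B z w = 1"
  defines "\<chi>' \<equiv> \<lambda>x. sc (x $ 0) z + sc (x $ (n + 1)) w + \<chi> (mid_vec n x)"
  shows "vec_iso (n + 2) \<chi>' (adjoin U z w)"
    and "x \<in> carrier_vec (n + 2) \<Longrightarrow> q (\<chi>' x) = x $ 0 * q z + x $ (n + 1) * q w + x $ 0 * x $ (n + 1)
      + q (\<chi> (mid_vec n x))"
proof -
  have \<chi>U: "\<chi> y \<in> U" if "y \<in> carrier_vec n" for y
    using U(2) that by (auto simp: vec_iso_def bij_betw_def)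
  have inj: "x = y" if "\<chi> x = \<chi> y" "x \<in> carrier_vec n" "y \<in> carrier_vec n" for x y
    using U(2) that by (auto simp: vec_iso_def bij_betw_def inj_on_def)
  have perps: "B z (\<chi> (mid_vec n x)) = 0" "B w (\<chi> (mid_vec n x)) = 0"
     "B (\<chi> (mid_vec n x)) z = 0" "B (\<chi> (mid_vec n x)) w = 0" for x
    using perpD[OF zw(1) \<chi>U] perpD[OF zw(2) \<chi>U] by auto
  show "q (\<chi>' x) = x $ 0 * q z + x $ (n + 1) * q w + x $ 0 * x $ (n + 1) + q (\<chi> (mid_vec n x))"
    if "x \<in> carrier_vec (n + 2)"
    using zw perps by (simp add: \<chi>'_def form_simps)
  have "\<chi>' (x + y) = \<chi>' x + \<chi>' y" if "x \<in> carrier_vec (n + 2)" "y \<in> carrier_vec (n + 2)" for x y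
  proof -
    have "\<chi> (mid_vec n x + mid_vec n y) = \<chi> (mid_vec n x) + \<chi> (mid_vec n y)"
      using U(2) by (auto simp: vec_iso_def)
    then show ?thesis using that by (simp add: \<chi>'_def mid_vec_add sc_add add_ac)
  qed
  moreover have "inj_on \<chi>' (carrier_vec (n + 2))"
  proof (rule inj_onI)
    fix x y assume xy: "x \<in> carrier_vec (n + 2)" "y \<in> carrier_vec (n + 2)" "\<chi>' x = \<chi>' y"
    have BB: "B (\<chi>' x) z = x $ (n + 1)" "B (\<chi>' x) w = x $ 0" for x
      using zw perps by (simp_all add: \<chi>'_def form_simps B_commute[of w z])
    have e: "x $ 0 = y $ 0" "x $ (n + 1) = y $ (n + 1)" using BB[of x] BB[of y] xy(3) by simp_all
    then have "\<chi> (mid_vec n x) = \<chi> (mid_vec n y)" using xy(3) by (simp add: \<chi>'_def)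
    then have m: "mid_vec n x = mid_vec n y" by (rule inj) auto
    have "x $ i = y $ i" if "i < n + 2" for i
    proof -
      consider "i = 0" | "i = n + 1" | "1 \<le> i" "i - 1 < n"
        using \<open>i < n + 2\<close> by linarith
      then show ?thesis
      proof cases
        case 3
        have "mid_vec n x $ (i - 1) = mid_vec n y $ (i - 1)" using m by simp
        then show ?thesis using 3 by (simp add: mid_vec_def)
      qed (use e in auto)
    qed
    then show "x = y" using xy by (intro eq_vecI) auto
  qed
  moreover have "\<chi>' ` carrier_vec (n + 2) = adjoin U z w"
  proof (intro equalityI subsetI)
    fix v assume "v \<in> \<chi>' ` carrier_vec (n + 2)"
    then obtain x where x: "v = \<chi>' x" by blast
    have "\<chi> (mid_vec n x) + (sc (x $ 0) z + sc (x $ (n + 1)) w) \<in> adjoin U z w"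
      by (rule adjoinI0[OF \<chi>U]) (auto simp: sc_def)
    then show "v \<in> adjoin U z w" by (simp add: x \<chi>'_def add.commute)
  next
    fix v assume v: "v \<in> adjoin U z w"
    have "\<exists>u\<in>U. \<exists>a b. v = u + (sc a z + sc b w)"
      using v
    proof (cases rule: adjoin_cases)
      case (1 u) then show ?thesis by (intro bexI[of _ u] exI[of _ 0]) auto
    next
      case (2 u) then show ?thesis by (intro bexI[of _ u] exI[of _ 1] exI[of _ 0]) auto
    next
      case (3 u) then show ?thesis by (intro bexI[of _ u] exI[of _ 0] exI[of _ 1]) auto
    next
      case (4 u) then show ?thesis by (intro bexI[of _ u] exI[of _ 1] exI[of _ 1]) auto
    qed
    then obtain u a b where u: "u \<in> U" "v = u + (sc a z + sc b w)" by blast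
    obtain y where y: "y \<in> carrier_vec n" "u = \<chi> y"
      using u(1) U(2) by (auto simp: vec_iso_def bij_betw_def)
    let ?x = "vec (n + 2) (\<lambda>i. if i = 0 then a else if i = n + 1 then b else y $ (i - 1))"
    have "mid_vec n ?x = y" using y by (intro eq_vecI) (auto simp: mid_vec_def)
    then have "\<chi>' ?x = v" by (simp add: \<chi>'_def u y add_ac)
    moreover have "\<chi>' ?x \<in> \<chi>' ` carrier_vec (n + 2)" by (rule imageI[OF vec_carrier])
    ultimately show "v \<in> \<chi>' ` carrier_vec (n + 2)" by (simp only:)
  qed
  ultimately show "vec_iso (n + 2) \<chi>' (adjoin U z w)"
    by (auto simp: vec_iso_def bij_betw_def)
qed

lemma split_off_pair:
  assumes V: "finite V" "subsp V" "nondeg V" and zw: "z \<in> V" "w \<in> V" "B z w = 1"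
  obtains U where "finite U" "split U" "U \<subset> V" "perp z U" "perp w U" "V = adjoin U z w"
proof -
  define U where "U = {x \<in> V. B x z = 0 \<and> B x w = 0}"
  have UV: "U \<subseteq> V" by (auto simp: U_def)
  then have fU: "finite U" using V finite_subset by blast
  have sU: "subsp U" using V by (auto simp: U_def subsp_def B_add_left)
  have p: "perp z U" "perp w U" by (auto simp: U_def perp_def B_commute)
  have V_eq: "V = adjoin U z w"
  proof
    show "V \<subseteq> adjoin U z w"
    proof
      fix x assume x: "x \<in> V"
      define v where "v = sc (B x w) z + sc (B x z) w"
      have v: "v \<in> {0, z, w, z + w}" by (auto simp: v_def sc_def)
      then have "v \<in> V" using V zw by (auto dest: subspD)
      then have "x + v \<in> U" using x V zw
        by (auto simp: U_def v_def form_simps B_commute[of w z] intro: subspD)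
      then have "(x + v) + v \<in> adjoin U z w" using v by (rule adjoinI0)
      then show "x \<in> adjoin U z w" by (simp add: add.assoc)
    qed
    show "adjoin U z w \<subseteq> V" by (rule adjoin_subset[OF V(2) UV zw(1,2)])
  qed
  have "nondeg U" unfolding nondeg_def
  proof (intro ballI impI)
    fix x assume x: "x \<in> U" "\<forall>u\<in>U. B x u = 0"
    have "B x v = 0" if "v \<in> V" for v
      using that unfolding V_eq
      by (cases rule: adjoin_cases) (use x in \<open>auto simp: form_simps U_def\<close>)
    then show "x = 0" using V(3) x UV by (auto simp: nondeg_def)
  qed
  then have "split U" using nondeg_split fU sU by blast
  moreover have "U \<subset> V" using V_eq adjoin_psubset[OF \<open>split U\<close> p(1) zw(3)] by blast
  ultimately show thesis using that fU p V_eq by blast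
qed

definition has_type :: "'a set \<Rightarrow> nat \<Rightarrow> (nat \<Rightarrow> bit vec \<Rightarrow> bit) \<Rightarrow> bool" where
  "has_type V n F \<longleftrightarrow> (\<exists>\<chi>. vec_iso n \<chi> V \<and> (\<forall>x\<in>carrier_vec n. q (\<chi> x) = F n x))"

text \<open>A non-zero singular vector and a suitable singular partner span a plane that is split
  off and doubles the Gauss sum. If there is no such vector, the space is zero or a plane with Gauss
  sum -2, so the sign tells the types apart.\<close>

lemma arf_classification:
  assumes "finite V" "subsp V" "nondeg V"
  shows "\<exists>m. card V = 4 ^ m \<and> (gauss_sum V = 2 ^ m \<and> has_type V (2 * m) F_plus \<or>
    m \<ge> 1 \<and> gauss_sum V = - (2 ^ m) \<and> has_type V (2 * m) F_minus)"
  using assms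
proof (induction "card V" arbitrary: V rule: less_induct)
  case (less V)
  note V = less(2-4)
  have iso0: "vec_iso 0 (\<lambda>_. 0) {0}"
    using imageI[OF vec_carrier[of 0 "\<lambda>_. 0"], of "\<lambda>_. 0"] by (auto simp: vec_iso_def bij_betw_def inj_on_def)
  show ?case
  proof (cases "V = {0}")
    case True
    have "has_type V (2 * 0) F_plus"
      unfolding has_type_def True using iso0 by (auto simp: F_plus_def intro!: exI[of _ "\<lambda>_. 0"])
    then show ?thesis by (rule_tac x=0 in exI) (auto simp: True gauss_sum_def)
  next
    case ne: False
    show ?thesis
    proof (cases "\<exists>z\<in>V. z \<noteq> 0 \<and> q z = 0")
      case True
      then obtain z where z: "z \<in> V" "z \<noteq> 0" "q z = 0" by blast
      obtain w1 where w1: "w1 \<in> V" "B z w1 = 1" using nondeg_obtain[OF V(3) z(1,2)] .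
      \<comment> \<open>Adding \<open>z\<close> flips the value of \<open>w1\<close>, because
        \<open>q z = 0\<close> and \<open>B z w1 = 1\<close>; so \<open>w\<close> is
        singular.\<close>
      define w where "w = w1 + sc (q w1) z"
      have w: "w \<in> V" "B z w = 1" "q w = 0"
        using w1 z V by (cases "q w1"; auto simp: w_def form_simps B_commute[of w1 z] dest: subspD)+
      obtain U where U: "finite U" "split U" "U \<subset> V" "perp z U" "perp w U" "V = adjoin U z w"
        using split_off_pair[OF V z(1) w(1,2)] .
      have "card U < card V" using U V psubset_card_mono by blast
      then obtain m where m: "card U = 4 ^ m" "gauss_sum U = 2 ^ m \<and> has_type U (2 * m) F_plus \<or>
          m \<ge> 1 \<and> gauss_sum U = - (2 ^ m) \<and> has_type U (2 * m) F_minus"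
        using less(1)[of U] U splitD by blast
      have g: "gauss_sum V = gauss_sum U * 2"
        using gauss_sum_adjoin[OF U(1,2,4,5) w(2)] z w U(6) by (simp add: q_add)
      have c: "card V = 4 ^ Suc m" using card_adjoin[OF U(1,2,4,5) w(2)] U(6) m by simp
      have type: "has_type V (2 * Suc m) F"
        if F: "has_type U (2 * m) F"
          "\<And>x. F (2 * m + 2) x = x $ 0 * x $ (2 * m + 1) + F (2 * m) (mid_vec (2 * m) x)" for F
      proof -
        obtain \<chi> where \<chi>: "vec_iso (2 * m) \<chi> U" "\<forall>x\<in>carrier_vec (2 * m). q (\<chi> x) = F (2 * m) x"
          using F(1) by (auto simp: has_type_def)
        show ?thesis
          using vec_iso_adjoin[OF U(2) \<chi>(1) U(4,5) w(2)] F(2) \<chi>(2) z(3) w(3)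
          unfolding has_type_def U(6) by (intro exI conjI ballI) auto
      qed
      from m(2) show ?thesis
      proof
        assume a: "gauss_sum U = 2 ^ m \<and> has_type U (2 * m) F_plus"
        then have "has_type V (2 * Suc m) F_plus" using type F_plus_step by blast
        moreover have "gauss_sum V = 2 ^ Suc m" using a g by simp
        ultimately show ?thesis using c by blast
      next
        assume a: "m \<ge> 1 \<and> gauss_sum U = - (2 ^ m) \<and> has_type U (2 * m) F_minus"
        then have "has_type V (2 * Suc m) F_minus" using type F_minus_step by blast
        moreover have "gauss_sum V = - (2 ^ Suc m)" "Suc m \<ge> 1" using a g by simp_all
        ultimately show ?thesis using c by blast
      qed
    next
      case False
      then have an: "q x = 1" if "x \<in> V" "x \<noteq> 0" for x using that by (metis bit_not_zero_iff)
      obtain z where z: "z \<in> V" "z \<noteq> 0" using ne V by (auto dest: subspD)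
      obtain w where w: "w \<in> V" "B z w = 1" using nondeg_obtain[OF V(3) z] .
      have "w \<noteq> 0" "z + w \<noteq> 0" using w by auto
      moreover have "z + w \<in> V" using V(2) z(1) w(1) by (rule subspD)
      ultimately have qs: "q z = 1" "q w = 1" "q (z + w) = 1" using an[OF z] an[OF w(1)] an[of "z + w"] by simp_all
      obtain U where U: "finite U" "split U" "U \<subset> V" "perp z U" "perp w U" "V = adjoin U z w"
        using split_off_pair[OF V z(1) w] .
      \<comment> \<open>A non-zero \<open>x\<close> orthogonal to \<open>z\<close> would make
        \<open>z + x\<close> singular, as \<open>q z = q x = 1\<close>.\<close>
      have "U = {0}"
      proof (rule ccontr)
        assume "U \<noteq> {0}"
        then obtain x where x: "x \<in> U" "x \<noteq> 0" using splitD[OF U(2)] by (auto dest: subspD)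
        have "z + x \<noteq> 0" using perp_in_0[OF splitD(2)[OF U(2)] U(4)] x z by auto
        moreover have "z + x \<in> V" using x z U(3) V by (auto dest: subspD)
        ultimately have "q (z + x) = 1" by (rule an[rotated])
        moreover have "q x = 1" using x U an by auto
        ultimately show False using qs perpD(1)[OF U(4) x(1)] by (simp add: q_add)
      qed
      then have p: "perp z {0}" "perp w {0}" and V_eq: "V = adjoin {0} z w" using U by auto
      have "gauss_sum V = - 2"
        unfolding V_eq using gauss_sum_adjoin[OF _ split_0 p w(2)] qs by (simp add: gauss_sum_def)
      moreover have "card V = 4" unfolding V_eq using card_adjoin[OF _ split_0 p w(2)] by simp
      moreover have "has_type V (2 * 1) F_minus"
        using vec_iso_adjoin[OF split_0 iso0 p w(2)] qs unfolding has_type_def V_eq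
        by (intro exI conjI ballI)
           (auto simp: F_minus_def Let_def power2_eq_square numeral_2_eq_2 add_ac)
      moreover have "(1 :: nat) \<ge> 1" "(4 :: nat) = 4 ^ 1" "- 2 = - (2 ^ 1 :: int)" by simp_all
      ultimately show ?thesis by metis
    qed
  qed
qed

end

section \<open>Periodic sequences\<close>

text \<open>Sequences on the integers rather than on residues: those of period \<open>d\<close> are
  also of period \<open>N\<close> whenever \<open>d\<close> divides \<open>N\<close>, and the single
  form \<open>qform N\<close> serves all of them.\<close>

definition periodic :: "nat \<Rightarrow> (int \<Rightarrow> 'b) \<Rightarrow> bool" where
  "periodic d a \<longleftrightarrow> (\<forall>i. a (i + int d) = a i)"

lemma periodic_mult: "periodic d a \<Longrightarrow> a (i + k * int d) = a i"
proof (induction k arbitrary: i rule: int_induct[of _ 0])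
  case (step1 k)
  then show ?case unfolding periodic_def
    by (metis add.assoc distrib_right mult_1)
next
  case (step2 k)
  have "a (i + (k - 1) * int d) = a (i + (k - 1) * int d + int d)"
    using step2(3) unfolding periodic_def by metis
  then show ?case using step2 by (simp add: algebra_simps)
qed simp

lemma periodic_mod: "periodic d a \<Longrightarrow> a (i mod int d) = a i"
  using periodic_mult[of d a "i mod int d" "i div int d"] by (simp add: add.commute)

lemma periodic_dvd: "periodic d a \<Longrightarrow> d dvd e \<Longrightarrow> periodic e a"
proof (elim dvdE)
  fix k assume "periodic d a" "e = d * k"
  then have "a (i + int e) = a i" for i
    using periodic_mult[of d a i "int k"] by (simp add: mult.commute)
  then show "periodic e a" by (simp add: periodic_def)
qed

lemma periodic_shift: "periodic d a \<Longrightarrow> periodic d (\<lambda>i. a (i + j))"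
  unfolding periodic_def by (metis add.assoc add.commute)

lemma sum_period_shift:
  assumes "periodic d f" "d > 0"
  shows "(\<Sum>i\<in>{0..<int d}. f (i + j)) = (\<Sum>i\<in>{0..<int d}. f i)"
proof (rule sum.reindex_bij_witness[of _ "\<lambda>i. (i - j) mod int d" "\<lambda>i. (i + j) mod int d"])
  fix a assume "a \<in> {0..<int d}"
  then show "((a + j) mod int d - j) mod int d = a" "((a - j) mod int d + j) mod int d = a"
    by (simp_all add: mod_diff_left_eq mod_add_left_eq)
qed (use assms in \<open>auto simp: periodic_mod\<close>)

lemma sum_periods:
  assumes "periodic d f" "d > 0"
  shows "(\<Sum>i\<in>{0..<int (d * e)}. f i) = of_nat e * (\<Sum>i\<in>{0..<int d}. f i :: 'b :: semiring_1)"
proof (induction e)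
  case (Suc e)
  define A where "A = int (d * e)"
  have A: "0 \<le> A" "int (d * Suc e) = A + int d" by (simp_all add: A_def algebra_simps)
  have "{0..<int (d * Suc e)} = {0..<A} \<union> {A..<A + int d}" unfolding A(2) using A(1) by auto
  then have "(\<Sum>i\<in>{0..<int (d * Suc e)}. f i) = (\<Sum>i\<in>{0..<A}. f i) + (\<Sum>i\<in>{A..<A + int d}. f i)"
    using sum.union_disjoint[of "{0..<A}" "{A..<A + int d}" f] by simp
  also have "(\<Sum>i\<in>{A..<A + int d}. f i) = (\<Sum>i\<in>{0..<int d}. f (i + int e * int d))"
    by (rule sum.reindex_bij_witness[of _ "\<lambda>i. i + A" "\<lambda>i. i - A"]) (auto simp: A_def mult.commute)
  finally show ?case using Suc by (simp add: A_def periodic_mult[OF assms(1)] distrib_right add.commute)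
qed simp

lemma of_nat_bit: "(of_nat k :: bit) = (if odd k then 1 else 0)"
  by (induction k) auto

definition diff_op :: "(int \<Rightarrow> bit) \<Rightarrow> int \<Rightarrow> bit" where
  "diff_op a = (\<lambda>i. a i + a (i + 1))"

lemma diff_op_pow: "(diff_op ^^ m) a i = (\<Sum>k\<le>m. of_nat (m choose k) * a (i + int k))"
proof (induction m arbitrary: i)
  case (Suc m)
  have "(diff_op ^^ Suc m) a i = (\<Sum>k\<le>m. of_nat (m choose k) * a (i + int k))
      + (\<Sum>k\<le>m. of_nat (m choose k) * a (i + 1 + int k))"
    by (simp add: diff_op_def Suc)
  also have "(\<Sum>k\<le>m. of_nat (m choose k) * a (i + int k)) =
      a i + (\<Sum>k\<le>m. of_nat (m choose Suc k) * a (i + int (Suc k)))"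
  proof -
    have "(\<Sum>k\<le>m. of_nat (m choose k) * a (i + int k)) = (\<Sum>k\<le>Suc m. of_nat (m choose k) * a (i + int k))"
      by (simp add: binomial_eq_0)
    also have "\<dots> = a i + (\<Sum>k\<le>m. of_nat (m choose Suc k) * a (i + int (Suc k)))"
      by (subst sum.atMost_Suc_shift) simp
    finally show ?thesis .
  qed
  also have "a i + (\<Sum>k\<le>m. of_nat (m choose Suc k) * a (i + int (Suc k)))
      + (\<Sum>k\<le>m. of_nat (m choose k) * a (i + 1 + int k)) =
    a i + (\<Sum>k\<le>m. of_nat (Suc m choose Suc k) * a (i + int (Suc k)))"
    by (simp add: sum.distrib[symmetric] distrib_right add.commute add.left_commute add.assoc)
  also have "\<dots> = (\<Sum>k\<le>Suc m. of_nat (Suc m choose k) * a (i + int k))"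
    by (subst sum.atMost_Suc_shift) simp
  finally show ?case .
qed simp

lemma periodic_diff_op: "periodic d a \<Longrightarrow> periodic d (diff_op a)"
  unfolding periodic_def diff_op_def by (metis add.commute add.left_commute)

lemma periodic_diff_op_pow: "periodic d a \<Longrightarrow> periodic d ((diff_op ^^ m) a)"
  by (induction m) (auto intro: periodic_diff_op)

lemma sum_diff_op: "periodic d a \<Longrightarrow> d > 0 \<Longrightarrow> (\<Sum>i\<in>{0..<int d}. diff_op a i) = 0"
  unfolding diff_op_def sum.distrib using sum_period_shift[of d a 1] by simp

lemma diff_op_add: "diff_op (a + b) = diff_op a + diff_op b"
  by (auto simp: diff_op_def add_ac)

lemma diff_op_pow_add: "(diff_op ^^ m) (a + b) = (diff_op ^^ m) a + (diff_op ^^ m) b"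
  by (induction m) (simp_all only: funpow.simps comp_apply id_apply diff_op_add)

lemma diff_op_pow_shift: "(diff_op ^^ m) (\<lambda>i. a (i + j)) = (\<lambda>i. (diff_op ^^ m) a (i + j))"
  by (induction m) (auto simp: diff_op_def add_ac)

lemma diff_op_eq_0_imp_const: "diff_op a = 0 \<Longrightarrow> a i = a j"
proof -
  assume "diff_op a = 0"
  then have *: "a (i + 1) = a i" for i by (metis diff_op_def bit_add_eq_0_iff zero_fun_apply)
  have "a i = a 0" for i
  proof (induction i rule: int_induct[of _ 0])
    case (step2 i) then show ?case using *[of "i - 1"] by simp
  qed (use * in auto)
  then show ?thesis by metis
qed

text \<open>For odd \<open>d\<close> the factor \<open>X + 1\<close> of \<open>X ^ d + 1\<close> is
  simple. Concretely: a constant sequence that is a difference has sum zero over a period, and an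
  odd number of equal bits has sum zero only if they are zero.\<close>

lemma diff_op_pow_kernel:
  assumes "periodic d a" "odd d" "m > 0" "(diff_op ^^ m) a = 0"
  shows "diff_op a = 0"
  using assms(3,4)
proof (induction m rule: nat_induct_non_zero)
  case (Suc m)
  let ?b = "(diff_op ^^ m) a"
  have per: "periodic d ?b" using periodic_diff_op_pow[OF assms(1)] .
  have "diff_op ?b = 0" using Suc.prems by (simp only: funpow.simps comp_apply)
  note const = diff_op_eq_0_imp_const[OF this]
  then have "?b = (\<lambda>_. ?b 0)" by blast
  moreover have "?b 0 = 0"
  proof -
    have "?b = diff_op ((diff_op ^^ (m - 1)) a)" using Suc by (cases m) auto
    then have "(\<Sum>i\<in>{0..<int d}. ?b i) = 0"
      using sum_diff_op[of d "(diff_op ^^ (m - 1)) a"] periodic_diff_op_pow[OF assms(1)] odd_pos[OF assms(2)] by simp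
    moreover have "(\<Sum>i\<in>{0..<int d}. ?b i) = (\<Sum>i\<in>{0..<int d}. ?b 0)"
      by (intro sum.cong refl) (rule const)
    ultimately show ?thesis using assms(2) by (simp add: of_nat_bit)
  qed
  ultimately have "?b = 0" by (simp add: zero_fun_def)
  then show ?case by (rule Suc.IH)
qed simp

definition sum_zero_periodic :: "nat \<Rightarrow> (int \<Rightarrow> bit) set" where
  "sum_zero_periodic d = {a. periodic d a \<and> (\<Sum>i\<in>{0..<int d}. a i) = 0}"

lemma sum_zero_periodic_const:
  "odd d \<Longrightarrow> a \<in> sum_zero_periodic d \<Longrightarrow> diff_op a = 0 \<Longrightarrow> a = 0"
proof -
  assume d: "odd d" and a: "a \<in> sum_zero_periodic d" "diff_op a = 0"
  have *: "a i = a 0" for i using diff_op_eq_0_imp_const a by blast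
  have "(\<Sum>i\<in>{0..<int d}. a i) = (\<Sum>i\<in>{0..<int d}. a 0)" by (intro sum.cong refl) (rule *)
  then have "a 0 = 0" using a d by (simp add: sum_zero_periodic_def of_nat_bit)
  then show "a = 0" using * by auto
qed

text \<open>The first \<open>d - 1\<close> values of a period are arbitrary, and the last one is
  their sum.\<close>

lemma card_sum_zero_periodic:
  assumes "d > 0"
  shows "finite (sum_zero_periodic d)" "card (sum_zero_periodic d) = 2 ^ (d - 1)"
proof -
  let ?S = "{0..<int (d - 1)} \<rightarrow>\<^sub>E (UNIV :: bit set)"
  define ext where "ext f = (\<lambda>j. let r = j mod int d in
     if r < int (d - 1) then f r else (\<Sum>i\<in>{0..<int (d - 1)}. f i :: bit))" for f
  have UNIV: "(UNIV :: bit set) = {0, 1}" by (auto intro: bit.exhaust)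
  have split: "{0..<int d} = insert (int (d - 1)) {0..<int (d - 1)}" using assms by auto
  have bij: "bij_betw (\<lambda>a. restrict a {0..<int (d - 1)}) (sum_zero_periodic d) ?S"
  proof (rule bij_betw_byWitness[of _ ext])
    show "\<forall>a\<in>sum_zero_periodic d. ext (restrict a {0..<int (d - 1)}) = a"
    proof (intro ballI ext)
      fix a j assume a: "a \<in> sum_zero_periodic d"
      let ?r = "j mod int d"
      have r: "0 \<le> ?r" "?r < int d" using assms by auto
      have "a (int (d - 1)) + (\<Sum>i\<in>{0..<int (d - 1)}. a i) = 0"
        using a by (simp add: sum_zero_periodic_def split)
      then have "a (int (d - 1)) = (\<Sum>i\<in>{0..<int (d - 1)}. a i)" by simp
      moreover have "?r < int (d - 1) \<or> ?r = int (d - 1)" using r by linarith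
      ultimately have "ext (restrict a {0..<int (d - 1)}) j = a ?r"
        unfolding ext_def Let_def using r(1) by (elim disjE) simp_all
      then show "ext (restrict a {0..<int (d - 1)}) j = a j"
        using a periodic_mod by (auto simp: sum_zero_periodic_def)
    qed
    show "\<forall>f\<in>?S. restrict (ext f) {0..<int (d - 1)} = f"
    proof
      fix f assume f: "f \<in> ?S"
      have "restrict (ext f) {0..<int (d - 1)} i = f i" for i
      proof (cases "i \<in> {0..<int (d - 1)}")
        case True
        then have "i mod int d = i" by (intro mod_pos_pos_trivial) auto
        with True show ?thesis by (simp add: ext_def)
      next
        case False
        then show ?thesis using PiE_arb[OF f False] by auto
      qed
      then show "restrict (ext f) {0..<int (d - 1)} = f" by blast
    qed
    show "(\<lambda>a. restrict a {0..<int (d - 1)}) ` sum_zero_periodic d \<subseteq> ?S" by auto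
    show "ext ` ?S \<subseteq> sum_zero_periodic d"
    proof clarify
      fix f assume "f \<in> ?S"
      have "(\<Sum>i\<in>{0..<int (d - 1)}. ext f i) = (\<Sum>i\<in>{0..<int (d - 1)}. f i)"
        using assms by (intro sum.cong refl) (auto simp: ext_def)
      moreover have "int (d - 1) mod int d = int (d - 1)"
        using assms by (intro mod_pos_pos_trivial) auto
      then have "ext f (int (d - 1)) = (\<Sum>i\<in>{0..<int (d - 1)}. f i)"
        by (simp only: ext_def Let_def less_irrefl if_False)
      ultimately show "ext f \<in> sum_zero_periodic d"
        by (simp add: sum_zero_periodic_def split periodic_def) (simp add: ext_def)
    qed
  qed
  have fin: "finite ?S" by (rule finite_PiE) (auto simp: UNIV)
  have cS: "card ?S = 2 ^ (d - 1)" by (simp add: card_PiE UNIV numeral_2_eq_2)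
  show "finite (sum_zero_periodic d)" "card (sum_zero_periodic d) = 2 ^ (d - 1)"
    using bij_betw_finite[OF bij] bij_betw_same_card[OF bij] fin cS by simp_all
qed

text \<open>The form for which the vectors \<open>cvec N i\<close> below have value 1 and pair to the binomial coefficients
  \<open>N choose k\<close> modulo 2. Only half of the symmetric sequence of coefficients occurs in the quadratic form.\<close>

definition qform :: "nat \<Rightarrow> (int \<Rightarrow> bit) \<Rightarrow> bit" where
  "qform N a = (\<Sum>i\<in>{0..<int N}. a i + (\<Sum>k\<in>{1..N div 2}. of_nat (N choose k) * (a i * a (i + int k))))"

definition bform :: "nat \<Rightarrow> (int \<Rightarrow> bit) \<Rightarrow> (int \<Rightarrow> bit) \<Rightarrow> bit" where
  "bform N a b = (\<Sum>i\<in>{0..<int N}. \<Sum>k\<in>{1..N div 2}.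
     of_nat (N choose k) * (a i * b (i + int k) + b i * a (i + int k)))"

interpretation Q: quadratic_form_F2 "qform N" "bform N" for N
proof
  fix x y z :: "int \<Rightarrow> bit"
  show "x + x = 0" by auto
  show "qform N (x + y) = qform N x + qform N y + bform N x y"
    by (simp add: qform_def bform_def sum.distrib[symmetric] algebra_simps)
  show "bform N (x + y) z = bform N x z + bform N y z"
    by (simp add: bform_def sum.distrib[symmetric] algebra_simps)
qed

text \<open>Shifting the summation index turns \<open>a i * b (i + k)\<close> into
  \<open>a (i + (N - k)) * b i\<close>. So \<open>k\<close> and its mirror image
  \<open>N - k\<close> both occur, with equal coefficients, and together they fill the binomial
  expansion of \<open>diff_op ^^ N\<close> except for its two end terms, which cancel by
  periodicity.\<close>

lemma bform_eq_sum_diff_op: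
  assumes N: "odd N" and a: "periodic N a" and b: "periodic N b"
  shows "bform N a b = (\<Sum>i\<in>{0..<int N}. (diff_op ^^ N) a i * b i)"
proof -
  have N0: "N > 0" using N by (rule odd_pos)
  define h where "h = N div 2"
  have Nh: "N = 2 * h + 1" using N by (simp add: h_def)
  let ?u = "\<lambda>k. of_nat (N choose k) :: bit"
  have shift: "(\<Sum>i\<in>{0..<int N}. a i * b (i + int k)) = (\<Sum>i\<in>{0..<int N}. a (i + int (N - k)) * b i)"
    if "k \<le> N" for k
  proof -
    have p: "periodic N (\<lambda>i. a i * b (i + int k))"
      using a periodic_shift[OF b, of "int k"] by (simp add: periodic_def)
    have "b (i + int (N - k) + int k) = b i" for i
      using b that by (simp add: periodic_def add.assoc flip: of_nat_add)
    then show ?thesis using sum_period_shift[OF p N0, of "int (N - k)"] by simp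
  qed
  have "bform N a b = (\<Sum>k\<in>{1..h}. ?u k * ((\<Sum>i\<in>{0..<int N}. a i * b (i + int k)) + (\<Sum>i\<in>{0..<int N}. b i * a (i + int k))))"
    unfolding bform_def h_def by (subst sum.swap) (simp add: sum.distrib sum_distrib_left distrib_left)
  also have "\<dots> = (\<Sum>k\<in>{1..h}. ?u k * ((\<Sum>i\<in>{0..<int N}. a (i + int (N - k)) * b i) + (\<Sum>i\<in>{0..<int N}. a (i + int k) * b i)))"
    using shift Nh by (intro sum.cong refl) (simp add: mult.commute)
  also have "\<dots> = (\<Sum>i\<in>{0..<int N}. (\<Sum>k\<in>{1..h}. ?u k * (a (i + int (N - k)) + a (i + int k))) * b i)"
    by (simp add: sum_distrib_left sum_distrib_right sum.distrib distrib_left distrib_right mult.assoc)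
       (simp add: sum.swap[of _ "{Suc 0..h}"])
  also have "\<dots> = (\<Sum>i\<in>{0..<int N}. (diff_op ^^ N) a i * b i)"
  proof (intro sum.cong refl arg_cong2[of _ _ _ _ "(*)"])
    fix i
    let ?f = "\<lambda>k. ?u k * a (i + int k)"
    have "(diff_op ^^ N) a i = (\<Sum>k\<le>N. ?f k)" by (rule diff_op_pow)
    also have "{..N} = insert 0 (insert N ({1..h} \<union> {h + 1..N - 1}))" using Nh by auto
    also have "(\<Sum>k\<in>\<dots>. ?f k) = ?f 0 + (?f N + ((\<Sum>k\<in>{1..h}. ?f k) + (\<Sum>k\<in>{h + 1..N - 1}. ?f k)))"
      using Nh by (subst sum.insert, simp, simp)+ (subst sum.union_disjoint; auto)
    also have "?f 0 = ?f N" using a by (simp add: periodic_def)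
    also have "(\<Sum>k\<in>{h + 1..N - 1}. ?f k) = (\<Sum>k\<in>{1..h}. ?u k * a (i + int (N - k)))"
      by (rule sum.reindex_bij_witness[of _ "\<lambda>k. N - k" "\<lambda>k. N - k"])
         (use Nh binomial_symmetric[symmetric, of _ N] in \<open>auto simp flip: of_nat_diff\<close>)
    finally show "(\<Sum>k\<in>{1..h}. ?u k * (a (i + int (N - k)) + a (i + int k))) = (diff_op ^^ N) a i"
      by (simp add: sum.distrib distrib_left add.commute)
  qed
  finally show ?thesis .
qed

text \<open>The unit sequence at \<open>i\<close> plus the constant 1. The constant makes the sum
  over an odd period zero; as differences have sum zero, it contributes nothing to pairings, so that
  \<open>bform_cvec\<close> reads off a single value of \<open>(diff_op ^^ N) a\<close>.\<close>

definition cvec :: "nat \<Rightarrow> int \<Rightarrow> int \<Rightarrow> bit" where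
  "cvec d i = (\<lambda>j. if j mod int d = i mod int d then 0 else 1)"

lemma periodic_cvec: "periodic d (cvec d i)"
  by (simp add: periodic_def cvec_def)

lemma sum_times_cvec:
  assumes "periodic d f" "d > 0"
  shows "(\<Sum>j\<in>{0..<int d}. f j * cvec d i j) = (\<Sum>j\<in>{0..<int d}. f j) + f i"
proof -
  have "f j * cvec d i j = f j + (if j = i mod int d then f j else 0)" if "j \<in> {0..<int d}" for j
    using that by (auto simp: cvec_def)
  then have "(\<Sum>j\<in>{0..<int d}. f j * cvec d i j) =
      (\<Sum>j\<in>{0..<int d}. f j + (if j = i mod int d then f j else 0))"
    by (rule sum.cong[OF refl])
  also have "\<dots> = (\<Sum>j\<in>{0..<int d}. f j) + f (i mod int d)"
    using assms by (simp add: sum.distrib sum.delta')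
  finally show ?thesis using assms by (simp add: periodic_mod)
qed

lemma cvec_in: "odd d \<Longrightarrow> cvec d i \<in> sum_zero_periodic d"
  using sum_times_cvec[of d "\<lambda>_. 1" i] odd_pos[of d]
  by (simp add: sum_zero_periodic_def periodic_cvec of_nat_bit) (simp add: periodic_def of_nat_bit)

lemma sum_zero_periodic_mono:
  assumes "odd N" "d dvd N"
  shows "sum_zero_periodic d \<subseteq> sum_zero_periodic N"
proof
  fix a assume a: "a \<in> sum_zero_periodic d"
  obtain e where N: "N = d * e" using assms by auto
  then have "d > 0" using assms by (cases "d = 0") auto
  then show "a \<in> sum_zero_periodic N"
    using a sum_periods[of d a e] periodic_dvd[OF _ assms(2), of a] unfolding sum_zero_periodic_def N by simp
qed

text \<open>The sum over \<open>N\<close> terms is \<open>e = N / d\<close> times the sum over one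
  period \<open>d\<close>, and \<open>e\<close> is odd; hence one formula for all divisors.\<close>

lemma bform_cvec:
  assumes N: "odd N" "d dvd N" and a: "periodic d a"
  shows "bform N a (cvec d i) = (diff_op ^^ N) a i"
proof -
  obtain e where e: "N = d * e" using N by auto
  have d: "odd d" "d > 0" and "odd e" using N e by (auto intro: odd_pos)
  let ?f = "(diff_op ^^ N) a"
  have per: "periodic d ?f" by (rule periodic_diff_op_pow[OF a])
  have "?f = diff_op ((diff_op ^^ (N - 1)) a)" using odd_pos[OF N(1)] by (cases N) auto
  then have s0: "(\<Sum>j\<in>{0..<int d}. ?f j) = 0"
    using sum_diff_op[OF periodic_diff_op_pow[OF a] d(2), of "N - 1"] by simp
  have "bform N a (cvec d i) = (\<Sum>j\<in>{0..<int N}. ?f j * cvec d i j)"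
    by (rule bform_eq_sum_diff_op[OF N(1) periodic_dvd[OF a N(2)] periodic_dvd[OF periodic_cvec N(2)]])
  also have "\<dots> = of_nat e * (\<Sum>j\<in>{0..<int d}. ?f j * cvec d i j)"
    unfolding e by (rule sum_periods[OF _ d(2)]) (use per periodic_cvec[of d i] in \<open>auto simp: periodic_def e\<close>)
  also have "\<dots> = ?f i"
    using sum_times_cvec[OF per d(2)] s0 \<open>odd e\<close> by (simp add: of_nat_bit)
  finally show ?thesis .
qed

text \<open>Non-degenerate because a vector orthogonal to all \<open>cvec d i\<close> is killed by a
  power of \<open>diff_op\<close>, hence constant, hence zero.\<close>

lemma sum_zero_periodic_form:
  assumes N: "odd N" "d dvd N"
  shows "finite (sum_zero_periodic d)" "Q.subsp (sum_zero_periodic d)" "Q.nondeg N (sum_zero_periodic d)"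
proof -
  have d: "odd d" using N by (auto elim!: dvdE)
  show "finite (sum_zero_periodic d)" using card_sum_zero_periodic odd_pos[OF d] by blast
  show "Q.subsp (sum_zero_periodic d)"
    unfolding Q.subsp_def by (auto simp: sum_zero_periodic_def periodic_def sum.distrib)
  show "Q.nondeg N (sum_zero_periodic d)" unfolding Q.nondeg_def
  proof (intro ballI impI)
    fix x assume x: "x \<in> sum_zero_periodic d" "\<forall>u\<in>sum_zero_periodic d. bform N x u = 0"
    have per: "periodic d x" using x by (simp add: sum_zero_periodic_def)
    have "(diff_op ^^ N) x i = 0" for i
      using bform_cvec[OF N per, of i] x(2) cvec_in[OF d] by auto
    then have "(diff_op ^^ N) x = 0" by auto
    then have "diff_op x = 0" by (rule diff_op_pow_kernel[OF per d odd_pos[OF N(1)]])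
    then show "x = 0" by (rule sum_zero_periodic_const[OF d x(1)])
  qed
qed

lemma qform_shift:
  assumes "odd N" "periodic N a"
  shows "qform N (\<lambda>i. a (i + j)) = qform N a"
proof -
  let ?g = "\<lambda>i. a i + (\<Sum>k\<in>{1..N div 2}. of_nat (N choose k) * (a i * a (i + int k)))"
  have "periodic N ?g"
    using assms(2) periodic_shift[OF assms(2)] by (simp add: periodic_def)
  then have "(\<Sum>i\<in>{0..<int N}. ?g (i + j)) = (\<Sum>i\<in>{0..<int N}. ?g i)"
    by (rule sum_period_shift[OF _ odd_pos[OF assms(1)]])
  then show ?thesis by (simp add: qform_def add_ac)
qed

section \<open>The Gauss sum of the form on periodic sequences\<close>

text \<open>Orbits have length 1 or \<open>p\<close>. An orbit of length \<open>p\<close>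
  contributes a multiple of \<open>p\<close> to the sum and is removed.\<close>

lemma sum_cong_fixed_points:
  fixes h :: "'b \<Rightarrow> int"
  assumes "finite X" "prime p" "\<And>x. x \<in> X \<Longrightarrow> \<sigma> x \<in> X" "\<And>x. x \<in> X \<Longrightarrow> (\<sigma> ^^ p) x = x"
    "\<And>x. x \<in> X \<Longrightarrow> h (\<sigma> x) = h x"
  shows "[sum h X = sum h {x \<in> X. \<sigma> x = x}] (mod int p)"
  using assms
proof (induction "card X" arbitrary: X rule: less_induct)
  case (less X)
  note X = less(2-6)
  show ?case
  proof (cases "\<forall>x\<in>X. \<sigma> x = x")
    case True
    then have "{x \<in> X. \<sigma> x = x} = X" by auto
    then show ?thesis by simp
  next
    case False
    then obtain x where x: "x \<in> X" "\<sigma> x \<noteq> x" by blast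
    have pow_in: "(\<sigma> ^^ k) y \<in> X" if "y \<in> X" for k y
      using that by (induction k) (auto intro: X)
    have h_pow: "h ((\<sigma> ^^ k) y) = h y" if "y \<in> X" for k y
      using that pow_in by (induction k) (auto simp: X(5))
    have p0: "p > 0" using X(2) by (rule prime_gt_0_nat)
    have multi: "(\<sigma> ^^ (r * t)) y = y" if "(\<sigma> ^^ r) y = y" for r t y
      using that by (induction t) (auto simp: funpow_add)
    have no_fix: "(\<sigma> ^^ r) y \<noteq> y" if y: "y \<in> X" "\<sigma> y \<noteq> y" and r: "0 < r" "r < p" for r y
    proof
      assume "(\<sigma> ^^ r) y = y"
      have "\<not> p dvd r" using r by (auto dest: dvd_imp_le)
      then have "coprime r p" using X(2) by (metis coprime_commute prime_imp_coprime)
      \<comment> \<open>\<open>s\<close> inverts \<open>r\<close> modulo \<open>p\<close>, so a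
        point fixed by the \<open>r\<close>-th power is fixed by \<open>\<sigma>\<close>
        itself.\<close>
      then obtain s where s: "[r * s = 1] (mod p)" using cong_solve_coprime_nat[of r p] by auto
      have "(r * s) mod p = 1 mod p" using s by (simp add: cong_def)
      have rs: "r * s = Suc (p * (r * s div p))"
        using mult_div_mod_eq[of p "r * s"] \<open>(r * s) mod p = 1 mod p\<close> prime_gt_1_nat[OF X(2)] by simp
      have "(\<sigma> ^^ (r * s)) y = \<sigma> ((\<sigma> ^^ (p * (r * s div p))) y)"
        using arg_cong[OF rs, of "\<lambda>k. (\<sigma> ^^ k) y"] by simp
      also have "\<dots> = \<sigma> y" using multi[of p] X(4) y by simp
      finally show False using multi[OF \<open>(\<sigma> ^^ r) y = y\<close>] y by simp
    qed
    define Orb where "Orb = (\<lambda>k. (\<sigma> ^^ k) x) ` {..<p}"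
    have OrbX: "Orb \<subseteq> X" using pow_in x by (auto simp: Orb_def)
    have nonfix: "\<sigma> ((\<sigma> ^^ k) x) \<noteq> (\<sigma> ^^ k) x" if "k < p" for k
    proof
      assume "\<sigma> ((\<sigma> ^^ k) x) = (\<sigma> ^^ k) x"
      then have "(\<sigma> ^^ (p - k)) (\<sigma> ((\<sigma> ^^ k) x)) = (\<sigma> ^^ (p - k)) ((\<sigma> ^^ k) x)" by simp
      then have "\<sigma> ((\<sigma> ^^ (p - k + k)) x) = (\<sigma> ^^ (p - k + k)) x" by (simp only: funpow_swap1 funpow_add comp_apply)
      then show False using x X(4) that by simp
    qed
    have inj: "inj_on (\<lambda>k. (\<sigma> ^^ k) x) {..<p}"
    proof (rule linorder_inj_onI')
      fix i j assume ij: "i \<in> {..<p}" "j \<in> {..<p}" "i < j"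
      show "(\<sigma> ^^ i) x \<noteq> (\<sigma> ^^ j) x"
      proof
        assume eq: "(\<sigma> ^^ i) x = (\<sigma> ^^ j) x"
        have "(\<sigma> ^^ (j - i)) ((\<sigma> ^^ i) x) = (\<sigma> ^^ (j - i + i)) x" by (simp only: funpow_add comp_apply)
        also have "\<dots> = (\<sigma> ^^ i) x" using ij eq by simp
        finally show False using no_fix[OF pow_in[OF x(1)] nonfix[of i], of "j - i"] ij
          by (simp add: less_imp_diff_less)
      qed
    qed
    have "sum h Orb = (\<Sum>k<p. h x)"
      unfolding Orb_def using inj h_pow[OF x(1)] by (simp add: sum.reindex)
    then have sumO: "sum h Orb = int p * h x" by simp
    have surj_like: "\<sigma> y \<in> X - Orb" if y: "y \<in> X - Orb" for y
    proof -
      have "\<sigma> y \<notin> Orb"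
      proof
        assume "\<sigma> y \<in> Orb"
        then obtain k where k: "k < p" "\<sigma> y = (\<sigma> ^^ k) x" by (auto simp: Orb_def)
        have "y = (\<sigma> ^^ (p - 1)) (\<sigma> y)"
          using X(4)[of y] y p0 by (metis DiffD1 Suc_pred' comp_apply funpow_Suc_right)
        also have "\<dots> = (\<sigma> ^^ (p - 1 + k)) x" by (simp only: k(2) funpow_add comp_apply)
        also have "\<dots> = (\<sigma> ^^ ((p - 1 + k) mod p)) x"
          by (rule funpow_mod_eq[symmetric]) (use X(4) x in auto)
        finally have "y \<in> Orb" using p0 by (auto simp: Orb_def)
        then show False using y by simp
      qed
      then show ?thesis using y X(3) by auto
    qed
    have "x \<in> Orb" using p0 unfolding Orb_def by (auto intro!: image_eqI[of _ _ 0])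
    then have "card (X - Orb) < card X" using x X(1) by (intro psubset_card_mono) auto
    then have IH: "[sum h (X - Orb) = sum h {x \<in> X - Orb. \<sigma> x = x}] (mod int p)"
      by (rule less(1)) (use X surj_like in auto)
    have fixeq: "{y \<in> X - Orb. \<sigma> y = y} = {y \<in> X. \<sigma> y = y}"
      using nonfix by (auto simp: Orb_def)
    have "sum h X = sum h (X - Orb) + sum h Orb"
      using OrbX X(1) by (metis sum.subset_diff)
    then have "[sum h X = sum h (X - Orb)] (mod int p)" by (simp add: sumO cong_def)
    then show ?thesis using IH fixeq cong_trans by metis
  qed
qed

text \<open>For odd \<open>d\<close> this is the Jacobi symbol (2/d), in the form of the second
  supplementary law.\<close>

definition chi8 :: "nat \<Rightarrow> int" where
  "chi8 d = (if d mod 8 = 1 \<or> d mod 8 = 7 then 1 else - 1)"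

lemma chi8_mult:
  assumes "odd a" "odd b"
  shows "chi8 (a * b) = chi8 a * chi8 b"
proof -
  have odd8: "k mod 8 = 1 \<or> k mod 8 = 3 \<or> k mod 8 = 5 \<or> k mod 8 = 7" if "odd k" for k :: nat
    using that by presburger
  have "(a * b) mod 8 = (a mod 8) * (b mod 8) mod 8" by (simp add: mod_mult_eq)
  then show ?thesis using odd8[OF assms(1)] odd8[OF assms(2)]
    by (elim disjE) (simp_all add: chi8_def)
qed

text \<open>Gauss's lemma: the exponent of -1 counts the doubles of 1, ..., \<open>h\<close> that
  exceed \<open>h = (p - 1) div 2\<close>, which are the doubles of the numbers above
  \<open>h div 2\<close>.\<close>

lemma two_power_half_cong_chi8:
  assumes p: "prime p" "odd p"
  shows "[2 ^ ((p - 1) div 2) = chi8 p] (mod int p)"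
proof -
  have p2: "2 < p" using p prime_ge_2_nat[OF p(1)] by (cases "p = 2") auto
  interpret G: GAUSS p 2
    by unfold_locales (use p p2 in \<open>auto simp: cong_def\<close>)
  define h where "h = (p - 1) div 2"
  have ph: "p = 2 * h + 1" using p by (simp add: h_def)
  then have inth: "(int p - 1) div 2 = int h" by simp
  have C: "G.C = (\<lambda>x. x * 2) ` {0<..int h}"
    unfolding G.C_def G.B_def G.A_def inth by (auto simp: image_iff ph intro!: bexI)
  have "G.E = (\<lambda>x. x * 2) ` {int (h div 2)<..int h}"
    unfolding G.E_def C inth by auto
  then have "card G.E = card {int (h div 2)<..int h}"
    by (simp add: card_image inj_on_def)
  then have cE: "card G.E = h - h div 2" by simp
  have "[2 ^ h = (- 1) ^ (h - h div 2)] (mod int p)"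
    using G.pre_gauss_lemma by (simp add: inth cE)
  moreover have "(- 1) ^ (h - h div 2) = chi8 p"
  proof -
    have "even (h - h div 2) \<longleftrightarrow> h mod 4 = 0 \<or> h mod 4 = 3" by presburger
    also have "\<dots> \<longleftrightarrow> p mod 8 = 1 \<or> p mod 8 = 7" unfolding ph by presburger
    finally show ?thesis by (auto simp: chi8_def)
  qed
  ultimately show ?thesis by (simp add: h_def)
qed

text \<open>Induction over the divisors with the form fixed. For \<open>d = p * e\<close> the square
  of the Gauss sum is \<open>2 ^ (d - 1)\<close>, so only a sign \<open>\<epsilon>\<close> is open.
  Powers of 2 are invertible modulo the odd prime \<open>p\<close>, and 1 and -1 differ modulo
  \<open>p\<close>; so the congruence determines \<open>\<epsilon>\<close>, which multiplies like
  \<open>chi8\<close>.\<close>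

theorem gauss_sum_sum_zero_periodic:
  assumes N: "odd N" and d: "d dvd N"
  shows "Q.gauss_sum N (sum_zero_periodic d) = chi8 d * 2 ^ ((d - 1) div 2)"
  using d
proof (induction d rule: less_induct)
  case (less d)
  have oddd: "odd d" using less N by (auto elim!: dvdE)
  note W = sum_zero_periodic_form[OF N less(2)]
  show ?case
  proof (cases "d = 1")
    case True
    have "sum_zero_periodic 1 = {0}"
    proof -
      have "card (sum_zero_periodic 1) = 1" using card_sum_zero_periodic(2)[of 1] by simp
      moreover have "0 \<in> sum_zero_periodic 1" using W(2) True by (auto simp: Q.subsp_def)
      ultimately show ?thesis by (metis card_1_singletonE singletonD)
    qed
    then show ?thesis using True by (simp add: Q.gauss_sum_def chi8_def)
  next
    case False
    then obtain p where p: "prime p" "p dvd d" using prime_factor_nat by blast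
    then obtain e where e: "d = p * e" by auto
    have oddp: "odd p" and odde: "odd e" using oddd e by auto
    have e0: "e > 0" using odde by (rule odd_pos)
    have "e < d" using e e0 prime_gt_1_nat[OF p(1)] by simp
    moreover have eN: "e dvd N" using less(2) e by auto
    ultimately have IH: "Q.gauss_sum N (sum_zero_periodic e) = chi8 e * 2 ^ ((e - 1) div 2)"
      by (rule less(1))
    define \<sigma> where "\<sigma> = (\<lambda>a :: int \<Rightarrow> bit. \<lambda>i. a (i + int e))"
    have \<sigma>_pow: "(\<sigma> ^^ k) a = (\<lambda>i. a (i + int k * int e))" for k a
      by (induction k) (auto simp: \<sigma>_def algebra_simps)
    let ?h = "\<lambda>a. sgn_bit (qform N a)"
    have perd: "periodic d a" if "a \<in> sum_zero_periodic d" for a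
      using that by (simp add: sum_zero_periodic_def)
    have "[sum ?h (sum_zero_periodic d) = sum ?h {a \<in> sum_zero_periodic d. \<sigma> a = a}] (mod int p)"
    proof (rule sum_cong_fixed_points[OF W(1) p(1)])
      fix a assume a: "a \<in> sum_zero_periodic d"
      have "periodic d (\<sigma> a)" unfolding \<sigma>_def by (rule periodic_shift[OF perd[OF a]])
      moreover have "(\<Sum>i\<in>{0..<int d}. \<sigma> a i) = (\<Sum>i\<in>{0..<int d}. a i)"
        unfolding \<sigma>_def by (rule sum_period_shift[OF perd[OF a] odd_pos[OF oddd]])
      ultimately show "\<sigma> a \<in> sum_zero_periodic d" using a by (simp add: sum_zero_periodic_def)
      show "(\<sigma> ^^ p) a = a"
        unfolding \<sigma>_pow using perd[OF a] by (simp add: periodic_def e)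
      show "?h (\<sigma> a) = ?h a"
        unfolding \<sigma>_def using qform_shift[OF N periodic_dvd[OF perd[OF a] less(2)]] by simp
    qed
    \<comment> \<open>For a sequence of period \<open>e\<close> the sum over \<open>d\<close> is
      \<open>p\<close> times the sum over \<open>e\<close>, and \<open>p\<close> is odd, so the two
      sum-zero conditions agree.\<close>
    moreover have "{a \<in> sum_zero_periodic d. \<sigma> a = a} = sum_zero_periodic e"
    proof (intro equalityI subsetI)
      fix a assume a: "a \<in> {a \<in> sum_zero_periodic d. \<sigma> a = a}"
      then have per: "periodic e a" unfolding periodic_def \<sigma>_def by (metis (mono_tags, lifting) mem_Collect_eq)
      have "(\<Sum>i\<in>{0..<int (e * p)}. a i) = 0" using a by (simp add: sum_zero_periodic_def e mult.commute)
      then show "a \<in> sum_zero_periodic e"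
        using sum_periods[OF per e0, of p] per oddp by (simp add: sum_zero_periodic_def of_nat_bit)
    next
      fix a assume a: "a \<in> sum_zero_periodic e"
      then have "\<sigma> a = a" by (auto simp: \<sigma>_def sum_zero_periodic_def periodic_def)
      moreover have "a \<in> sum_zero_periodic d"
        using sum_zero_periodic_mono[OF oddd, of e] a e by auto
      ultimately show "a \<in> {a \<in> sum_zero_periodic d. \<sigma> a = a}" by simp
    qed
    ultimately have cong: "[Q.gauss_sum N (sum_zero_periodic d) = chi8 e * 2 ^ ((e - 1) div 2)] (mod int p)"
      using IH by (simp add: Q.gauss_sum_def)
    define m where "m = (d - 1) div 2"
    have "(Q.gauss_sum N (sum_zero_periodic d))\<^sup>2 = (2 ^ m)\<^sup>2"
    proof -
      have "d - 1 = m * 2" using oddd by (simp add: m_def)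
      then show ?thesis using Q.gauss_sum_square[OF W] card_sum_zero_periodic(2)[OF odd_pos[OF oddd]]
        by (simp add: power_mult)
    qed
    then have "Q.gauss_sum N (sum_zero_periodic d) = 2 ^ m \<or> Q.gauss_sum N (sum_zero_periodic d) = - (2 ^ m)"
      by (simp add: power2_eq_iff)
    then obtain \<epsilon> :: int where eps: "\<epsilon> = 1 \<or> \<epsilon> = - 1" "Q.gauss_sum N (sum_zero_periodic d) = \<epsilon> * 2 ^ m"
      by (metis mult_1 mult_minus1)
    have chi: "chi8 k = 1 \<or> chi8 k = - 1" for k by (simp add: chi8_def)
    \<comment> \<open>\<open>(p * e - 1) / 2 = (e - 1) / 2 + e * (p - 1) / 2\<close>. So the power
      of 2 splits into the one for \<open>e\<close> and an \<open>e\<close>-th power of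
      \<open>2 ^ ((p - 1) / 2)\<close>, whose sign survives because \<open>e\<close> is odd.\<close>
    have m_eq: "m = (e - 1) div 2 + (p - 1) div 2 * e"
    proof -
      obtain e' p' where "e = 2 * e' + 1" "p = 2 * p' + 1" using odde oddp by (meson oddE)
      then show ?thesis by (simp add: m_def e algebra_simps)
    qed
    have "[2 ^ m = 2 ^ ((e - 1) div 2) * chi8 p ^ e] (mod int p)"
      unfolding m_eq power_add power_mult
      by (intro cong_mult cong_refl cong_pow two_power_half_cong_chi8 p oddp)
    moreover have "chi8 p ^ e = chi8 p" using chi[of p] odde by auto
    ultimately have "[\<epsilon> * (2 ^ ((e - 1) div 2) * chi8 p) = chi8 e * 2 ^ ((e - 1) div 2)] (mod int p)"
      using cong eps(2) by (metis cong_scalar_left cong_sym cong_trans)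
    then have "[(\<epsilon> * chi8 p) * 2 ^ ((e - 1) div 2) = chi8 e * 2 ^ ((e - 1) div 2)] (mod int p)"
      by (simp add: mult_ac)
    moreover have "coprime (2 ^ ((e - 1) div 2)) (int p)"
      using oddp by simp
    ultimately have c: "[\<epsilon> * chi8 p = chi8 e] (mod int p)"
      by (simp add: cong_mult_rcancel)
    have "p > 2" using oddp prime_ge_2_nat[OF p(1)] by (cases "p = 2") auto
    have "\<epsilon> * chi8 p = chi8 e"
    proof (rule ccontr)
      assume ne: "\<epsilon> * chi8 p \<noteq> chi8 e"
      have "int p dvd \<epsilon> * chi8 p - chi8 e" using c by (simp add: cong_iff_dvd_diff)
      then have "int p \<le> \<bar>\<epsilon> * chi8 p - chi8 e\<bar>"
        using ne by (intro zdvd_imp_le) (auto simp: dvd_abs_iff)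
      moreover have "\<bar>\<epsilon> * chi8 p - chi8 e\<bar> \<le> 2" using eps chi[of p] chi[of e] by auto
      ultimately show False using \<open>p > 2\<close> by simp
    qed
    then have "chi8 d = \<epsilon> * (chi8 p * chi8 p)" unfolding e chi8_mult[OF oddp odde] by (simp add: ac_simps)
    also have "chi8 p * chi8 p = 1" using chi[of p] by auto
    finally have "\<epsilon> = chi8 d" by simp
    then show ?thesis using eps(2) by (simp add: m_def)
  qed
qed

lemma type_sum_zero_periodic:
  assumes N: "odd N"
  shows "chi8 N = 1 \<Longrightarrow> Q.has_type N (sum_zero_periodic N) (N - 1) F_plus"
    and "chi8 N = - 1 \<Longrightarrow> Q.has_type N (sum_zero_periodic N) (N - 1) F_minus"
proof -
  obtain m where m: "card (sum_zero_periodic N) = 4 ^ m"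
    "Q.gauss_sum N (sum_zero_periodic N) = 2 ^ m \<and> Q.has_type N (sum_zero_periodic N) (2 * m) F_plus \<or>
     m \<ge> 1 \<and> Q.gauss_sum N (sum_zero_periodic N) = - (2 ^ m) \<and> Q.has_type N (sum_zero_periodic N) (2 * m) F_minus"
    using Q.arf_classification[OF sum_zero_periodic_form[OF N dvd_refl]] by blast
  have "(2 :: nat) ^ (N - 1) = 2 ^ (2 * m)"
    using m(1) card_sum_zero_periodic(2)[OF odd_pos[OF N]] by (simp add: power_mult)
  then have Nm: "N - 1 = 2 * m" by simp
  then have g: "Q.gauss_sum N (sum_zero_periodic N) = chi8 N * 2 ^ m"
    using gauss_sum_sum_zero_periodic[OF N dvd_refl] by simp
  have pos: "(2 :: int) ^ m > 0" by simp
  show "chi8 N = 1 \<Longrightarrow> Q.has_type N (sum_zero_periodic N) (N - 1) F_plus"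
    "chi8 N = - 1 \<Longrightarrow> Q.has_type N (sum_zero_periodic N) (N - 1) F_minus"
    using m(2) g pos unfolding Nm by auto
qed

section \<open>The generators as shift and transvection\<close>

lemma vec_space_simps [simp]: "carrier (vec_space_F2 n) = carrier_vec n" "mult (vec_space_F2 n) = (+)"
    "one (vec_space_F2 n) = 0\<^sub>v n"
  by (simp_all add: vec_space_F2_def monoid_vec_def)

lemma group_vec_space: "group (vec_space_F2 n)"
  unfolding vec_space_F2_def by (rule comm_group.axioms(2)[OF comm_group_vec])

lemma vec_add_self_bit: "x \<in> carrier_vec n \<Longrightarrow> x + x = (0\<^sub>v n :: bit vec)"
  by (intro eq_vecI) auto

text \<open>Over the field with two elements additivity is linearity. The induction is on a bound
  for the support, removing one unit vector at a time.\<close>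

lemma additive_vec_ext:
  fixes f g :: "bit vec \<Rightarrow> bit vec"
  assumes f: "\<And>x. x \<in> carrier_vec n \<Longrightarrow> f x \<in> carrier_vec k"
      "\<And>x y. x \<in> carrier_vec n \<Longrightarrow> y \<in> carrier_vec n \<Longrightarrow> f (x + y) = f x + f y"
    and g: "\<And>x. x \<in> carrier_vec n \<Longrightarrow> g x \<in> carrier_vec k"
      "\<And>x y. x \<in> carrier_vec n \<Longrightarrow> y \<in> carrier_vec n \<Longrightarrow> g (x + y) = g x + g y"
    and fg: "\<And>j. j < n \<Longrightarrow> f (unit_vec n j) = g (unit_vec n j)"
    and x: "x \<in> carrier_vec n"
  shows "f x = g x"
proof -
  have zero: "h (0\<^sub>v n) = 0\<^sub>v k" if h: "\<And>x. x \<in> carrier_vec n \<Longrightarrow> h x \<in> carrier_vec k"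
    "\<And>x y. x \<in> carrier_vec n \<Longrightarrow> y \<in> carrier_vec n \<Longrightarrow> h (x + y) = h x + h y" for h :: "bit vec \<Rightarrow> bit vec"
    using h(2)[of "0\<^sub>v n" "0\<^sub>v n"] vec_add_self_bit[OF h(1)[of "0\<^sub>v n"]] by simp
  have "f x = g x" if "x \<in> carrier_vec n" "\<And>i. m \<le> i \<Longrightarrow> i < n \<Longrightarrow> x $ i = 0" "m \<le> n" for m x
    using that
  proof (induction m arbitrary: x)
    case 0
    then have "x = 0\<^sub>v n" by (intro eq_vecI) auto
    then show ?case using zero[OF f] zero[OF g] by simp
  next
    case (Suc m)
    show ?case
    proof (cases "x $ m = 0")
      case True
      then have "x $ i = 0" if "m \<le> i" "i < n" for i
        using that Suc(3)[of i] by (cases "i = m") auto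
      then show ?thesis using Suc by (intro Suc.IH) auto
    next
      case False
      define y where "y = x + unit_vec n m"
      have y: "y \<in> carrier_vec n" using Suc by (simp add: y_def)
      have "y $ i = 0" if "m \<le> i" "i < n" for i
        using that False Suc by (cases "i = m") (auto simp: y_def)
      then have "f y = g y" using Suc y by (intro Suc.IH) auto
      moreover have "x = y + unit_vec n m"
        using Suc(2) by (intro eq_vecI) (auto simp: y_def add.assoc)
      ultimately show ?thesis using f(2)[OF y] g(2)[OF y] fg[of m] Suc(4) by simp
    qed
  qed
  from this[of x n] show ?thesis using x by simp
qed

lemma mat_of_additive:
  fixes h :: "bit vec \<Rightarrow> bit vec"
  assumes h: "\<And>x. x \<in> carrier_vec n \<Longrightarrow> h x \<in> carrier_vec n"
      "\<And>x y. x \<in> carrier_vec n \<Longrightarrow> y \<in> carrier_vec n \<Longrightarrow> h (x + y) = h x + h y"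
    and x: "x \<in> carrier_vec n"
  shows "mat n n (\<lambda>(i, j). h (unit_vec n j) $ i) *\<^sub>v x = h x"
proof (rule additive_vec_ext[OF _ _ h _ x])
  let ?M = "mat n n (\<lambda>(i, j). h (unit_vec n j) $ i)"
  show "?M *\<^sub>v (x + y) = ?M *\<^sub>v x + ?M *\<^sub>v y" if "x \<in> carrier_vec n" "y \<in> carrier_vec n" for x y
    using that by (intro mult_add_distrib_mat_vec[of _ n n]) auto
  show "?M *\<^sub>v unit_vec n j = h (unit_vec n j)" if "j < n" for j
  proof (rule eq_vecI)
    show "dim_vec (?M *\<^sub>v unit_vec n j) = dim_vec (h (unit_vec n j))"
      using h(1)[of "unit_vec n j"] by simp
    fix i assume "i < dim_vec (h (unit_vec n j))"
    then have "i < n" using h(1)[of "unit_vec n j"] by simp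
    then show "(?M *\<^sub>v unit_vec n j) $ i = h (unit_vec n j) $ i" using that by simp
  qed
qed (auto intro: h mult_mat_vec_carrier[of _ n n])

lemma matrix_via_unique:
  assumes \<phi>: "bij_betw \<phi> (carrier_vec n) C" and A: "A \<in> carrier_mat n n"
    and f: "\<And>x. x \<in> carrier_vec n \<Longrightarrow> \<phi> (A *\<^sub>v x) = f (\<phi> x)"
  shows "matrix_via n \<phi> f = A"
proof (rule eq_matI)
  fix i j assume "i < dim_row A" "j < dim_col A"
  then have ij: "i < n" "j < n" using A by auto
  have "inv_into (carrier_vec n) \<phi> (f (\<phi> (unit_vec n j))) = A *\<^sub>v unit_vec n j"
    using \<phi> A by (subst f[symmetric]) (auto simp: bij_betw_def inv_into_f_f)
  also have "(A *\<^sub>v unit_vec n j) $ i = A $$ (i, j)" using A ij by auto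
  finally show "matrix_via n \<phi> f $$ (i, j) = A $$ (i, j)" using ij by (simp add: matrix_via_def)
qed (use A in \<open>auto simp: matrix_via_def\<close>)

lemma matrix_via_carrier [simp]: "matrix_via n \<phi> f \<in> carrier_mat n n"
  by (simp add: matrix_via_def)

lemma matrix_via_mult:
  assumes G: "group G" and \<phi>: "\<phi> \<in> iso (vec_space_F2 n) G" and f: "f \<in> hom G G" and x: "x \<in> carrier_vec n"
  shows "\<phi> (matrix_via n \<phi> f *\<^sub>v x) = f (\<phi> x)"
proof -
  let ?i = "inv_into (carrier_vec n) \<phi>"
  have i: "?i \<in> iso G (vec_space_F2 n)" using group.iso_set_sym[OF group_vec_space \<phi>] by simp
  have \<phi>i: "\<phi> (?i y) = y" if "y \<in> carrier G" for y
    using \<phi> that by (auto simp: iso_def bij_betw_def intro: f_inv_into_f)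
  have in_G: "f (\<phi> x) \<in> carrier G" if "x \<in> carrier_vec n" for x
    using that \<phi> f by (auto simp: iso_def hom_def)
  have "matrix_via n \<phi> f *\<^sub>v x = ?i (f (\<phi> x))"
    unfolding matrix_via_def
  proof (rule mat_of_additive[OF _ _ x])
    fix x y :: "bit vec" assume x: "x \<in> carrier_vec n" and y: "y \<in> carrier_vec n"
    have "f (\<phi> (x + y)) = f (\<phi> x) \<otimes>\<^bsub>G\<^esub> f (\<phi> y)"
      using x y \<phi> f by (auto simp: iso_def hom_def Pi_iff)
    then show "?i (f (\<phi> (x + y))) = ?i (f (\<phi> x)) + ?i (f (\<phi> y))"
      using i in_G[OF x] in_G[OF y] by (auto simp: iso_def hom_def)
    show "?i (f (\<phi> x)) \<in> carrier_vec n"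
      using i in_G[OF x] by (auto simp: iso_def hom_def)
  qed
  then show ?thesis using \<phi>i in_G[OF x] by simp
qed

lemma ring_mat_monoid: "monoid (ring_mat TYPE(bit) n ())"
  using ring_mat[where 'a = bit, of n "()"] by (simp add: ring_def)

lemma GL_group: "group (GL_F2 n)"
  unfolding GL_F2_def by (rule monoid.units_group[OF ring_mat_monoid])

lemma GL_simps [simp]: "mult (GL_F2 n) = (*)" "one (GL_F2 n) = 1\<^sub>m n"
  by (simp_all add: GL_F2_def units_of_def ring_mat_def)

lemma GL_carrier:
  "A \<in> carrier (GL_F2 n) \<longleftrightarrow> A \<in> carrier_mat n n \<and> (\<exists>B\<in>carrier_mat n n. B * A = 1\<^sub>m n \<and> A * B = 1\<^sub>m n)"
  by (auto simp: GL_F2_def units_of_def ring_mat_def Units_def)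

lemma SL_eq_GL: "SL_F2 n = GL_F2 n"
proof -
  have "det A = 1" if A: "A \<in> carrier (GL_F2 n)" for A
  proof -
    obtain B where AB: "A \<in> carrier_mat n n" "B \<in> carrier_mat n n" "B * A = 1\<^sub>m n"
      using iffD1[OF GL_carrier A] by blast
    have "det B * det A = det (1\<^sub>m n)" unfolding AB(3)[symmetric] by (rule det_mult[OF AB(2,1), symmetric])
    then have "det B * det A = 1" by (simp only: det_one)
    then have "det A \<noteq> 0" by (intro notI) simp
    then show ?thesis by simp
  qed
  then have "{A \<in> carrier (GL_F2 n). det A = 1} = carrier (GL_F2 n)" by blast
  then show ?thesis by (simp add: SL_F2_def)
qed

lemma GL_inv_mult_vec:
  assumes "A \<in> carrier (GL_F2 n)" "x \<in> carrier_vec n"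
  shows "A *\<^sub>v (inv\<^bsub>GL_F2 n\<^esub> A *\<^sub>v x) = x" "inv\<^bsub>GL_F2 n\<^esub> A *\<^sub>v (A *\<^sub>v x) = x"
    "inv\<^bsub>GL_F2 n\<^esub> A \<in> carrier_mat n n" "inv\<^bsub>GL_F2 n\<^esub> A *\<^sub>v x \<in> carrier_vec n" "A *\<^sub>v x \<in> carrier_vec n"
proof -
  interpret group "GL_F2 n" by (rule GL_group)
  have c: "A \<in> carrier_mat n n" "inv\<^bsub>GL_F2 n\<^esub> A \<in> carrier_mat n n"
    using iffD1[OF GL_carrier assms(1)] iffD1[OF GL_carrier inv_closed[OF assms(1)]] by simp_all
  have "A * inv\<^bsub>GL_F2 n\<^esub> A = 1\<^sub>m n" "inv\<^bsub>GL_F2 n\<^esub> A * A = 1\<^sub>m n"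
    using r_inv[of A] l_inv[of A] assms by simp_all
  then show "A *\<^sub>v (inv\<^bsub>GL_F2 n\<^esub> A *\<^sub>v x) = x" "inv\<^bsub>GL_F2 n\<^esub> A *\<^sub>v (A *\<^sub>v x) = x"
    "inv\<^bsub>GL_F2 n\<^esub> A \<in> carrier_mat n n" "inv\<^bsub>GL_F2 n\<^esub> A *\<^sub>v x \<in> carrier_vec n" "A *\<^sub>v x \<in> carrier_vec n"
    using c assms(2) by (simp_all flip: assoc_mult_mat_vec[of _ n n _ n])
qed

lemma matrix_via_GL:
  assumes G: "group G" and \<phi>: "\<phi> \<in> iso (vec_space_F2 n) G" and f: "f \<in> hom G G" "g \<in> hom G G"
    and fg: "\<And>x. x \<in> carrier G \<Longrightarrow> f (g x) = x" "\<And>x. x \<in> carrier G \<Longrightarrow> g (f x) = x"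
  shows "matrix_via n \<phi> f \<in> carrier (GL_F2 n)"
proof -
  have bij: "bij_betw \<phi> (carrier_vec n) (carrier G)" using \<phi> by (simp add: iso_def)
  have \<phi>G: "\<phi> x \<in> carrier G" if "x \<in> carrier_vec n" for x using bij that by (auto simp: bij_betw_def)
  have one: "matrix_via n \<phi> (\<lambda>x. x) = 1\<^sub>m n" by (rule matrix_via_unique[OF bij]) auto
  have "matrix_via n \<phi> a * matrix_via n \<phi> b = 1\<^sub>m n"
    if "a \<in> hom G G" "b \<in> hom G G" "\<And>x. x \<in> carrier G \<Longrightarrow> a (b x) = x" for a b
  proof -
    have "matrix_via n \<phi> (\<lambda>x. x) = matrix_via n \<phi> a * matrix_via n \<phi> b"
    proof (rule matrix_via_unique[OF bij])
      fix x :: "bit vec" assume x: "x \<in> carrier_vec n"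
      have "\<phi> (matrix_via n \<phi> a *\<^sub>v (matrix_via n \<phi> b *\<^sub>v x)) = a (\<phi> (matrix_via n \<phi> b *\<^sub>v x))"
        by (rule matrix_via_mult[OF G \<phi> that(1) mult_mat_vec_carrier[OF matrix_via_carrier x]])
      also have "\<dots> = \<phi> x" using matrix_via_mult[OF G \<phi> that(2) x] that(3) \<phi>G x by simp
      finally show "\<phi> (matrix_via n \<phi> a * matrix_via n \<phi> b *\<^sub>v x) = \<phi> x"
        using x by (simp add: assoc_mult_mat_vec[of _ n n _ n])
    qed (rule mult_carrier_mat[OF matrix_via_carrier matrix_via_carrier])
    then show ?thesis using one by simp
  qed
  then show ?thesis using f fg by (auto simp: GL_carrier intro!: bexI[of _ "matrix_via n \<phi> g"])
qed

section \<open>Companion matrices modulo 2\<close>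

definition companion_bit :: "nat \<Rightarrow> (nat \<Rightarrow> bit) \<Rightarrow> bit mat" where
  "companion_bit n c = mat n n (\<lambda>(i, j). if j = n - 1 then c i else if i = j + 1 then 1 else 0)"

lemma companion_bit_mult_vec:
  assumes x: "x \<in> carrier_vec n" and i: "i < n"
  shows "(companion_bit n c *\<^sub>v x) $ i = c i * x $ (n - 1) + (if i = 0 then 0 else x $ (i - 1))"
proof -
  have "(companion_bit n c *\<^sub>v x) $ i =
      (\<Sum>j\<in>{0..<n}. (if j = n - 1 then c i * x $ j else 0) + (if i = j + 1 then x $ j else 0))"
    using x i by (auto simp: companion_bit_def scalar_prod_def intro!: sum.cong)
  also have "\<dots> = c i * x $ (n - 1) + (\<Sum>j\<in>{0..<n}. if i = j + 1 then x $ j else 0)"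
    using i by (simp add: sum.distrib sum.delta)
  also have "(\<Sum>j\<in>{0..<n}. if i = j + 1 then x $ j else 0) = (if i = 0 then 0 else x $ (i - 1))"
  proof (cases i)
    case (Suc k)
    then have "(\<Sum>j\<in>{0..<n}. if i = j + 1 then x $ j else 0) = (\<Sum>j\<in>{0..<n}. if j = k then x $ j else 0)"
      by (intro sum.cong) auto
    then show ?thesis using Suc i by (simp add: sum.delta)
  qed auto
  finally show ?thesis .
qed

lemma mod2_of_int: "(of_int (THE k :: int. of_int k = (of_int m :: complex)) :: bit) = of_int m"
  by simp

lemma mod2_companion:
  fixes p :: "complex poly"
  assumes "Polynomial.degree p = n" "\<And>i. i < n \<Longrightarrow> Polynomial.coeff p i = of_int (k i)"
  shows "mod2_mat (companion_mat p) = companion_bit n (\<lambda>i. of_int (k i))"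
proof (rule eq_matI)
  fix i j assume "i < dim_row (companion_bit n (\<lambda>i. of_int (k i)))" "j < dim_col (companion_bit n (\<lambda>i. of_int (k i)))"
  then have ij: "i < n" "j < n" by (simp_all add: companion_bit_def)
  have m: "(of_int (THE k :: int. of_int k = z) :: bit) = of_int m" if "z = of_int m" for z :: complex and m
    using that mod2_of_int by simp
  have "companion_mat p $$ (i, j) = of_int (if j = n - 1 then - k i else if i = j + 1 then 1 else 0)"
    using ij assms by (simp add: companion_mat_def)
  from m[OF this] show "mod2_mat (companion_mat p) $$ (i, j) = companion_bit n (\<lambda>i. of_int (k i)) $$ (i, j)"
    using ij assms(1) by (simp add: mod2_mat_def companion_mat_def companion_bit_def uminus_bit_def)
qed (auto simp: assms mod2_mat_def companion_mat_def companion_bit_def)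

lemma mod2_unipotent: "mod2_mat (companion_mat (poly_unipotent n)) = companion_bit n (\<lambda>i. of_nat (n choose i))"
proof -
  have "mod2_mat (companion_mat (poly_unipotent n)) =
      companion_bit n (\<lambda>i. of_int (int (n choose i) * (- 1) ^ (n - i)))"
    by (rule mod2_companion) (simp_all add: poly_unipotent_def degree_linear_power coeff_linear_poly_power)
  also have "(\<lambda>i. of_int (int (n choose i) * (- 1) ^ (n - i)) :: bit) = (\<lambda>i. of_nat (n choose i))"
    by (rule ext) (auto simp: uminus_bit_def)
  finally show ?thesis .
qed

lemma mod2_cyclic: "mod2_mat (companion_mat (poly_cyclic n)) = companion_bit n (\<lambda>_. 1)"
proof -
  have "Polynomial.coeff (poly_cyclic n) i = of_int (if i \<le> n then 1 else 0)" for i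
    by (simp add: poly_cyclic_eq coeff_sum)
  moreover have "Polynomial.degree (poly_cyclic n) = n"
    unfolding poly_cyclic_def by (subst degree_prod_eq_sum_degree) auto
  ultimately have "mod2_mat (companion_mat (poly_cyclic n)) = companion_bit n (\<lambda>i. of_int (if i \<le> n then 1 else 0))"
    by (intro mod2_companion) auto
  also have "\<dots> = companion_bit n (\<lambda>_. 1)"
    unfolding companion_bit_def by (intro cong_mat) auto
  finally show ?thesis .
qed

section \<open>Shift and transvection in coordinates\<close>

definition shift :: "(int \<Rightarrow> bit) \<Rightarrow> int \<Rightarrow> bit" where
  "shift a = (\<lambda>i. a (i - 1))"

definition unshift :: "(int \<Rightarrow> bit) \<Rightarrow> int \<Rightarrow> bit" where
  "unshift a = (\<lambda>i. a (i + 1))"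

lemma shift_unshift [simp]: "shift (unshift a) = a" "unshift (shift a) = a"
  by (auto simp: shift_def unshift_def)

lemma shift_add: "shift (a + b) = shift a + shift b" "unshift (a + b) = unshift a + unshift b"
  by (auto simp: shift_def unshift_def)

definition periodic_group :: "nat \<Rightarrow> (int \<Rightarrow> bit) monoid" where
  "periodic_group N = \<lparr>carrier = sum_zero_periodic N, mult = (+), one = 0\<rparr>"

lemma periodic_group_simps [simp]: "carrier (periodic_group N) = sum_zero_periodic N"
    "mult (periodic_group N) = (+)" "one (periodic_group N) = 0"
  by (simp_all add: periodic_group_def)

locale odd_period =
  fixes N :: nat
  assumes odd_N: "odd N" and N_gt_1: "N > 1"
begin

abbreviation "W \<equiv> sum_zero_periodic N"
abbreviation "T \<equiv> Q.trv N"

lemmas W_form = sum_zero_periodic_form[OF odd_N dvd_refl]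
lemmas W_subsp = Q.subspD[OF W_form(2)]

lemma N_pos: "N > 0" using odd_N by (rule odd_pos)

lemma W_periodic: "a \<in> W \<Longrightarrow> periodic N a"
  by (simp add: sum_zero_periodic_def)

lemma periodic_group: "group (periodic_group N)"
proof (rule groupI)
  fix x assume "x \<in> carrier (periodic_group N)"
  then show "\<exists>y\<in>carrier (periodic_group N). y \<otimes>\<^bsub>periodic_group N\<^esub> x = \<one>\<^bsub>periodic_group N\<^esub>"
    by (intro bexI[of _ x]) (auto simp: Q.two_torsion)
qed (use W_subsp in \<open>auto simp: add.assoc\<close>)

lemma shift_W: "a \<in> W \<Longrightarrow> shift a \<in> W" "a \<in> W \<Longrightarrow> unshift a \<in> W"
  using periodic_shift[of N a "- 1"] sum_period_shift[of N a "- 1"]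
    periodic_shift[of N a 1] sum_period_shift[of N a 1] N_pos
  by (auto simp: sum_zero_periodic_def shift_def unshift_def)

lemma q_shift: "a \<in> W \<Longrightarrow> qform N (shift a) = qform N a" "a \<in> W \<Longrightarrow> qform N (unshift a) = qform N a"
  using qform_shift[OF odd_N W_periodic, of a "- 1"] qform_shift[OF odd_N W_periodic, of a 1]
  by (auto simp: shift_def unshift_def)

lemma B_shift: "a \<in> W \<Longrightarrow> b \<in> W \<Longrightarrow> bform N (shift a) (shift b) = bform N a b"
  using q_shift(1)[of "a + b"] q_shift(1)[of a] q_shift(1)[of b] W_subsp(1)[of a b]
  by (auto simp: shift_add Q.q_add)

lemma cvec_W: "cvec N i \<in> W"
  by (rule cvec_in[OF odd_N])

lemma B_cvec: "a \<in> W \<Longrightarrow> bform N a (cvec N i) = (diff_op ^^ N) a i"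
  by (rule bform_cvec[OF odd_N dvd_refl W_periodic])

lemma shift_cvec: "shift (cvec N i) = cvec N (i + 1)"
proof
  fix j
  have "(j - 1) mod int N = i mod int N \<longleftrightarrow> j mod int N = (i + 1) mod int N"
    unfolding mod_eq_dvd_iff by (simp add: algebra_simps)
  then show "shift (cvec N i) j = cvec N (i + 1) j" by (simp add: shift_def cvec_def)
qed

lemma T_W: "r \<in> W \<Longrightarrow> x \<in> W \<Longrightarrow> T r x \<in> W"
  by (rule Q.trv_in[OF W_form(2)])

lemma hom_shift: "shift \<in> hom (periodic_group N) (periodic_group N)"
    "unshift \<in> hom (periodic_group N) (periodic_group N)"
  by (auto simp: hom_def shift_W shift_add)

lemma hom_T: "r \<in> W \<Longrightarrow> T r \<in> hom (periodic_group N) (periodic_group N)"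
  by (auto simp: hom_def T_W Q.trv_add)

text \<open>The coordinates in which shift and transvection become the two companion matrices.\<close>

definition coords :: "(int \<Rightarrow> bit) \<Rightarrow> bit vec" where
  "coords a = vec (N - 1) (\<lambda>i. (diff_op ^^ (N - 1)) a (int i + 1) + (diff_op ^^ (N - 1)) a 0)"

lemma coords_carrier [simp]: "coords a \<in> carrier_vec (N - 1)" "dim_vec (coords a) = N - 1"
  by (simp_all add: coords_def)

lemmas coords_carrier' [simp] = coords_carrier[simplified]

text \<open>Index \<open>N - 2\<close> reads position \<open>N - 1\<close>, which is position -1 by
  periodicity. This is the coordinate that a companion matrix multiplies by its last column.\<close>

lemma coords_last:
  assumes "a \<in> W"
  shows "coords a $ (N - 2) = (diff_op ^^ (N - 1)) a (- 1) + (diff_op ^^ (N - 1)) a 0"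
proof -
  have "N - 2 < N - 1" using N_gt_1 by linarith
  then have "coords a $ (N - 2) = (diff_op ^^ (N - 1)) a (int (N - 2) + 1) + (diff_op ^^ (N - 1)) a 0"
    by (simp only: coords_def index_vec)
  moreover have "int (N - 2) + 1 = - 1 + int N" using N_gt_1 by linarith
  ultimately show ?thesis
    using periodic_diff_op_pow[OF W_periodic[OF assms]] by (simp only: periodic_def)
qed

lemma coords_add: "coords (a + b) = coords a + coords b"
  by (rule eq_vecI) (auto simp: coords_def diff_op_pow_add add_ac)

text \<open>Vanishing coordinates of \<open>c\<close> make \<open>(diff_op ^^ (N - 1)) c\<close>
  constant, so \<open>diff_op ^^ N\<close> kills \<open>c\<close> and
  \<open>diff_op_pow_kernel\<close> applies.\<close>

lemma coords_inj: "inj_on coords W"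
proof (rule inj_onI)
  fix a b assume ab: "a \<in> W" "b \<in> W" "coords a = coords b"
  define c where "c = a + b"
  have c: "c \<in> W" using ab W_subsp by (auto simp: c_def)
  let ?D = "(diff_op ^^ (N - 1)) c"
  have "coords c = 0\<^sub>v (N - 1)" using ab vec_add_self_bit[OF coords_carrier(1)] by (simp add: c_def coords_add)
  then have *: "?D (int i + 1) = ?D 0" if "i < N - 1" for i
    using that by (auto simp: coords_def dest!: arg_cong[of _ _ "\<lambda>v. v $ i"])
  have per: "periodic N ?D" by (rule periodic_diff_op_pow[OF W_periodic[OF c]])
  have D0: "?D j = ?D 0" if "0 \<le> j" "j < int N" for j
  proof (cases "j = 0")
    case False
    then have "j = int (nat (j - 1)) + 1" "nat (j - 1) < N - 1" using that by auto
    then show ?thesis using *[of "nat (j - 1)"] by simp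
  qed simp
  have D0': "?D j = ?D 0" for j
    using D0[of "j mod int N"] periodic_mod[OF per, of j] N_pos by simp
  have "diff_op ?D = 0" using D0' by (auto simp: diff_op_def fun_eq_iff) (metis bit_add_self)
  then have "(diff_op ^^ N) c = 0" using N_pos by (cases N) auto
  then have "diff_op c = 0" by (rule diff_op_pow_kernel[OF W_periodic[OF c] odd_N N_pos])
  then have "c = 0" by (rule sum_zero_periodic_const[OF odd_N c])
  then show "a = b" by (simp add: c_def Q.add_eq_0_iff_eq)
qed

lemma coords_iso: "coords \<in> iso (periodic_group N) (vec_space_F2 (N - 1))"
proof -
  \<comment> \<open>Surjectivity is by counting. The bijection with column vectors from the
    classification of forms supplies the cardinality, whichever type occurs.\<close>
  obtain F where "Q.has_type N W (N - 1) F"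
  proof -
    have "chi8 N = 1 \<or> chi8 N = - 1" by (simp add: chi8_def)
    then show thesis using that type_sum_zero_periodic[OF odd_N] by blast
  qed
  then obtain \<chi> where \<chi>: "bij_betw \<chi> (carrier_vec (N - 1) :: bit vec set) W"
    by (auto simp: Q.has_type_def Q.vec_iso_def)
  have fin: "finite (carrier_vec (N - 1) :: bit vec set)"
    using bij_betw_finite[OF \<chi>] W_form(1) by simp
  have "coords ` W = carrier_vec (N - 1)"
  proof (rule card_seteq[OF fin])
    show "card (carrier_vec (N - 1) :: bit vec set) \<le> card (coords ` W)"
      using bij_betw_same_card[OF \<chi>] by (simp add: card_image[OF coords_inj])
  qed auto
  then show ?thesis using coords_inj by (auto simp: iso_def hom_def bij_betw_def coords_add)
qed

definition vecs :: "bit vec \<Rightarrow> int \<Rightarrow> bit" where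
  "vecs = inv_into W coords"

lemma vecs_iso: "vecs \<in> iso (vec_space_F2 (N - 1)) (periodic_group N)"
  using group.iso_set_sym[OF periodic_group coords_iso] by (simp add: vecs_def)

lemma coords_vecs: "x \<in> carrier_vec (N - 1) \<Longrightarrow> coords (vecs x) = x"
  using coords_iso f_inv_into_f[of x coords W] by (simp add: vecs_def iso_def bij_betw_def)

lemma vecs_coords: "a \<in> W \<Longrightarrow> vecs (coords a) = a"
  using coords_inj by (simp add: vecs_def inv_into_f_f)

lemma vecs_W: "x \<in> carrier_vec (N - 1) \<Longrightarrow> vecs x \<in> W"
  using vecs_iso by (auto simp: iso_def hom_def)

lemma diff_pow_shift: "(diff_op ^^ m) (shift a) = shift ((diff_op ^^ m) a)"
  using diff_op_pow_shift[of m a "- 1"] by (simp add: shift_def)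

text \<open>These are the differences between the last columns of \<open>matA\<close> and
  \<open>matB\<close>, so the transvection in \<open>cvec N 0\<close> accounts exactly for the
  difference of the generators.\<close>

lemma coords_cvec: assumes "i < N - 1" shows "coords (cvec N 0) $ i = of_nat ((N - 1) choose i) + 1"
proof -
  let ?n = "N - 1"
  let ?c = "cvec N 0"
  have "coords ?c $ i = (\<Sum>k\<le>?n. of_nat (?n choose k) * (?c (int i + 1 + int k) + ?c (int k)))"
    using assms by (simp add: coords_def diff_op_pow sum.distrib distrib_left)
  also have "\<dots> = (\<Sum>k\<le>?n. of_nat (?n choose k) * ((if k = ?n - i then 1 else 0) + (if k = 0 then 1 else 0)))"
  proof (intro sum.cong refl arg_cong2[of _ _ _ _ "(*)"])
    fix k assume k: "k \<in> {..?n}"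
    have "(int i + 1 + int k) mod int N = 0 \<longleftrightarrow> k = ?n - i"
    proof
      assume "(int i + 1 + int k) mod int N = 0"
      then have "int N dvd int (i + 1 + k)" by (simp add: mod_eq_0_iff_dvd add_ac)
      then have "N dvd i + 1 + k" by (simp only: of_nat_dvd_iff)
      then obtain m where m: "i + 1 + k = N * m" by auto
      have "i + 1 + k < N * 2" using k assms by auto
      then have "m < 2" using m by simp
      moreover have "m \<noteq> 0" using m by (intro notI) simp
      ultimately have "m = 1" by simp
      then show "k = ?n - i" using m by simp
    next
      assume "k = ?n - i"
      then have "int i + 1 + int k = int N" using assms by simp
      then show "(int i + 1 + int k) mod int N = 0" by simp
    qed
    moreover have "int k mod int N = 0 \<longleftrightarrow> k = 0" using k N_pos by (auto simp: mod_pos_pos_trivial)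
    ultimately show "?c (int i + 1 + int k) + ?c (int k) = (if k = ?n - i then 1 else 0) + (if k = 0 then 1 else 0)"
      by (simp add: cvec_def)
  qed
  also have "\<dots> = of_nat (?n choose (?n - i)) + of_nat (?n choose 0)"
    by (simp add: distrib_left sum.distrib sum.delta' if_distrib[of "(*) _"] cong: if_cong)
  also have "?n choose (?n - i) = ?n choose i" using assms binomial_symmetric[of i ?n] by simp
  finally show ?thesis by simp
qed

definition matA :: "bit mat" where "matA = companion_bit (N - 1) (\<lambda>i. of_nat ((N - 1) choose i))"
definition matB :: "bit mat" where "matB = companion_bit (N - 1) (\<lambda>_. 1)"

lemma mat_carrier [simp]: "matA \<in> carrier_mat (N - 1) (N - 1)" "matB \<in> carrier_mat (N - 1) (N - 1)"
  by (simp_all add: matA_def matB_def companion_bit_def)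

text \<open>The reference value at 0 is replaced by the one at -1, which adds the last coordinate to
  every entry: the effect of a last column of ones.\<close>

lemma coords_shift:
  assumes a: "a \<in> W" and i: "i < N - 1"
  shows "coords (shift a) $ i = (if i = 0 then 0 else coords a $ (i - 1)) + coords a $ (N - 2)"
proof -
  show ?thesis
    unfolding coords_last[OF a] using i unfolding coords_def diff_pow_shift
    by (cases i) (simp_all add: shift_def add_ac)
qed

lemma coords_B: assumes "a \<in> W" shows "matB *\<^sub>v coords a = coords (shift a)"
proof (rule eq_vecI)
  fix i assume "i < dim_vec (coords (shift a))"
  then have i: "i < N - 1" by simp
  show "(matB *\<^sub>v coords a) $ i = coords (shift a) $ i"
    unfolding matB_def companion_bit_mult_vec[OF coords_carrier(1) i] coords_shift[OF assms i]
    by (simp add: add.commute numeral_2_eq_2)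
qed (simp add: matB_def companion_bit_def)

lemma coords_A: assumes a: "a \<in> W" shows "matA *\<^sub>v coords a = coords (T (cvec N 0) (shift a))"
proof (rule eq_vecI)
  fix i assume "i < dim_vec (coords (T (cvec N 0) (shift a)))"
  then have i: "i < N - 1" by simp
  \<comment> \<open>The pairing that decides the transvection is the last coordinate of
    \<open>a\<close>, the factor of the last column in \<open>matA\<close>.\<close>
  have "bform N (shift a) (cvec N 0) = (diff_op ^^ N) a (- 1)"
    using B_cvec[OF shift_W(1)[OF a], of 0] unfolding diff_pow_shift by (simp add: shift_def)
  also have "\<dots> = coords a $ (N - 2)"
  proof -
    have "(diff_op ^^ N) a = diff_op ((diff_op ^^ (N - 1)) a)" using N_pos by (cases N) auto
    then show ?thesis unfolding coords_last[OF a] by (simp add: diff_op_def)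
  qed
  finally have B: "bform N (shift a) (cvec N 0) = coords a $ (N - 2)" .
  have "coords (T (cvec N 0) (shift a)) $ i = coords (shift a) $ i + coords a $ (N - 2) * coords (cvec N 0) $ i"
    using B i by (cases "coords a $ (N - 2)") (auto simp: Q.trv_def coords_add)
  then show "(matA *\<^sub>v coords a) $ i = coords (T (cvec N 0) (shift a)) $ i"
    unfolding matA_def companion_bit_mult_vec[OF coords_carrier(1) i] coords_shift[OF a i] coords_cvec[OF i]
    by (simp add: distrib_left distrib_right add_ac mult.commute numeral_2_eq_2)
qed (simp add: matA_def companion_bit_def)

lemma vecs_B: "x \<in> carrier_vec (N - 1) \<Longrightarrow> vecs (matB *\<^sub>v x) = shift (vecs x)"
  using coords_B[OF vecs_W, of x] vecs_coords[OF shift_W(1)[OF vecs_W], of x] coords_vecs by metis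

lemma vecs_A: "x \<in> carrier_vec (N - 1) \<Longrightarrow> vecs (matA *\<^sub>v x) = T (cvec N 0) (shift (vecs x))"
  using coords_A[OF vecs_W, of x] vecs_coords[OF T_W[OF cvec_W shift_W(1)[OF vecs_W]], of x 0] coords_vecs by metis

lemma MD_eq: "MD_F2 (N - 1) = (GL_F2 (N - 1))\<lparr>carrier := generate (GL_F2 (N - 1)) {matA, matB}\<rparr>"
  unfolding MD_F2_def SL_eq_GL mod2_unipotent mod2_cyclic matA_def matB_def ..

end

context quadratic_form_F2
begin

text \<open>\<open>trv r\<close> takes \<open>s\<close> to \<open>r + s\<close>, so the transvection
  in \<open>r + s\<close> is the conjugate of \<open>trv s\<close> by \<open>trv r\<close>.\<close>

lemma trv_of_sum:
  assumes "B r s = 1"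
  shows "trv (r + s) x = trv r (trv s (trv r x))"
  by (cases "B x r"; cases "B x s")
     (use assms in \<open>auto simp: trv_def form_simps add_ac B_commute[of s r]\<close>)

text \<open>The non-singular vectors of the span are the sums over intervals of the path, and each
  interval pairs to 1 with the vertex or interval that extends it.\<close>

lemma path4_in_closed:
  assumes path: "path4 a b c d" and R: "trv_closed R" "a \<in> R" "b \<in> R" "c \<in> R" "d \<in> R"
  shows "nonsing (span_path4 a b c d) \<subseteq> R"
proof
  note path_simps[OF path, simp]
  have add: "r + s \<in> R" if "r \<in> R" "s \<in> R" "B r s = 1" for r s
    using that R by (auto simp: trv_closed_def)
  have 1: "a + b \<in> R" "b + c \<in> R" "c + d \<in> R" by (rule add; simp add: R)+
  have 2: "a + b + c \<in> R" "b + c + d \<in> R" by (rule add; simp add: R 1 form_simps)+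
  have 3: "a + b + c + d \<in> R" by (rule add; simp add: R 2 form_simps)
  fix x assume "x \<in> nonsing (span_path4 a b c d)"
  then have "x \<in> span_path4 a b c d" "q x = 1" by (auto simp: nonsing_def)
  then show "x \<in> R" using span_path4_cases[of x a b c d] R 1 2 3 by (auto simp: form_simps)
qed

end

section \<open>Generic periods\<close>

text \<open>The congruence of \<open>(1 + X) ^ (2 * n)\<close> and \<open>(1 + X ^ 2) ^ n\<close>
  modulo 2, read off by coefficients; Pascal's rule applied twice gives the induction step.\<close>

lemma odd_binomial_double: "odd ((2 * n) choose m) \<longleftrightarrow> even m \<and> odd (n choose (m div 2))"
proof (induction n arbitrary: m)
  case 0
  have "m div 2 > 0" if "m \<ge> 2" using that by simp
  then show ?case by (cases "m = 0"; cases "m = 1") (auto simp: binomial_eq_0)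
next
  case (Suc n)
  show ?case
  proof (cases m)
    case (Suc m1)
    show ?thesis
    proof (cases m1)
      case 0 then show ?thesis using Suc by simp
    next
      case (Suc k)
      have "(2 * Suc n) choose m = ((2 * n) choose k) + 2 * ((2 * n) choose Suc k) + ((2 * n) choose Suc (Suc k))"
        using Suc \<open>m = Suc m1\<close> by simp
      then show ?thesis using Suc \<open>m = Suc m1\<close> Suc.IH[of k] Suc.IH[of "Suc (Suc k)"] by auto
    qed
  qed simp
qed

lemma odd_binomial_half: "odd (n choose k) \<longleftrightarrow> (odd k \<longrightarrow> odd n) \<and> odd ((n div 2) choose (k div 2))"
proof (cases "even n")
  case True
  then show ?thesis using odd_binomial_double[of "n div 2" k] by auto
next
  case False
  then obtain m where m: "n = Suc (2 * m)" by (metis oddE Suc_eq_plus1)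
  show ?thesis
  proof (cases k)
    case (Suc j)
    have "odd (n choose k) \<longleftrightarrow> odd ((2 * m) choose j) \<noteq> odd ((2 * m) choose Suc j)"
      unfolding m Suc by simp
    then show ?thesis unfolding odd_binomial_double m Suc by (cases "even j") auto
  qed simp
qed

text \<open>Lucas' theorem at the prime 2, by recursion on binary digits.\<close>

lemma odd_binomial_iff_bits: "odd (n choose k) \<longleftrightarrow> (\<forall>i. bit k i \<longrightarrow> bit n i)" for n k :: nat
proof (induction k arbitrary: n rule: less_induct)
  case (less k)
  show ?case
  proof (cases "k = 0")
    case False
    have "(\<forall>i. bit k i \<longrightarrow> bit n i) \<longleftrightarrow> (bit k 0 \<longrightarrow> bit n 0) \<and> (\<forall>i. bit k (Suc i) \<longrightarrow> bit n (Suc i))"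
      by (metis not0_implies_Suc)
    then show ?thesis using less[of "k div 2" "n div 2"] False odd_binomial_half[of n k]
      by (simp add: bit_0 bit_Suc)
  qed simp
qed

definition generic_period :: "nat \<Rightarrow> bool" where
  "generic_period N \<longleftrightarrow> odd N \<and> N > 1 \<and> (\<forall>m. N \<noteq> 2 ^ m + 1 \<and> N \<noteq> 2 ^ m - 1)"

text \<open>The binary expansion of a generic period has a zero at some position \<open>b\<close>, only ones below it, and a one
  at some position \<open>s\<close> above it. By Lucas' theorem the vectors \<open>cvec\<close> at \<open>1\<close>, \<open>0\<close>, \<open>2\<^sup>s\<close>, \<open>2\<^sup>s - 2\<^sup>b + 1\<close> then form
  a path, and the one at \<open>2\<^sup>s + 1\<close> pairs to 1, 1, 1, 0 with them. Among transpositions only the sum of the first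
  two vectors of the path would do so.\<close>

lemma generic_period_bits:
  assumes "generic_period N"
  obtains b s where "1 \<le> b" "b < s" "2 ^ s + 1 < N"
    "odd (N choose 1)" "odd (N choose 2 ^ s)" "odd (N choose (2 ^ s + 1))" "odd (N choose (2 ^ b - 1))"
    "even (N choose 2 ^ b)" "even (N choose (2 ^ s - 1))" "even (N choose (2 ^ s - 2 ^ b))"
    "even (N choose (2 ^ s - (2 ^ b - 1)))"
proof -
  have oddN: "odd N" "N > 1" and ne: "\<And>m. N \<noteq> 2 ^ m + 1" "\<And>m. N \<noteq> 2 ^ m - 1"
    using assms by (auto simp: generic_period_def)
  define b where "b = (LEAST i. \<not> bit N i)"
  have ex: "\<not> bit N N" by (simp add: bit_iff_odd)
  have b: "\<not> bit N b" unfolding b_def by (rule LeastI[of "\<lambda>i. \<not> bit N i", OF ex])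
  have below: "bit N i" if "i < b" for i using not_less_Least[of i "\<lambda>i. \<not> bit N i"] that by (auto simp: b_def)
  have b1: "1 \<le> b" using b oddN by (cases b) (auto simp: bit_0)
  have "\<exists>s>b. bit N s"
  proof (rule ccontr)
    assume "\<not> ?thesis"
    then have no: "\<not> bit N s" if "b < s" for s using that by blast
    \<comment> \<open>Without a one above \<open>b\<close> the number would be
      \<open>2 ^ b - 1\<close>, which is not generic.\<close>
    have "N = (mask b :: nat)"
    proof (rule bit_eqI)
      fix i show "bit N i = bit (mask b :: nat) i"
        using b below[of i] no[of i] by (cases i b rule: linorder_cases) (auto simp: bit_mask_iff)
    qed
    then show False using ne(2)[of b] by (simp add: mask_eq_exp_minus_1)
  qed
  then obtain s where s: "b < s" "bit N s" by blast
  have pow: "(2 :: nat) ^ b \<ge> 2" "(2 :: nat) ^ s = 2 ^ b * 2 ^ (s - b)" "(2 :: nat) ^ (s - b) \<ge> 2"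
    using b1 s power_increasing[of 1 b "2 :: nat"] power_increasing[of 1 "s - b" "2 :: nat"]
    by (auto simp: power_add[symmetric])
  have bitpow: "bit (2 ^ k :: nat) i \<longleftrightarrow> i = k" for k i by (auto simp: bit_exp_iff)
  have "2 ^ s \<le> N" using s(2) by (metis bit_iff_odd div_less even_zero not_le)
  moreover have "2 ^ s \<noteq> N" using oddN s b1 by auto
  ultimately have lt: "2 ^ s + 1 < N" using ne(1)[of s] by linarith
  have even_half: "odd ((2 :: nat) ^ (s - b) - 1)" using s by simp
  have o1: "odd (N choose 1)" using oddN by simp
  have o2: "odd (N choose 2 ^ s)" using s by (simp add: odd_binomial_iff_bits bitpow)
  have o3: "odd (N choose (2 ^ s + 1))"
  proof -
    have "(2 ^ s + 1) div 2 = (2 :: nat) ^ (s - 1)" "odd (2 ^ s + 1 :: nat)"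
      using s b1 by (cases s; simp)+
    moreover have "bit (N div 2) (s - 1)" using s b1 by (cases s) (auto simp: bit_Suc)
    then have "odd ((N div 2) choose 2 ^ (s - 1))" by (simp add: odd_binomial_iff_bits bitpow)
    ultimately show ?thesis using oddN odd_binomial_half[of N "2 ^ s + 1"] by simp
  qed
  have o4: "odd (N choose (2 ^ b - 1))"
    unfolding mask_eq_exp_minus_1[symmetric] odd_binomial_iff_bits
    using below by (simp add: bit_mask_iff)
  have even_if: "even (N choose k)" if "bit k b" for k
    using that b odd_binomial_iff_bits by blast
  have e1: "even (N choose 2 ^ b)" by (rule even_if) (simp add: bitpow)
  have e2: "even (N choose (2 ^ s - 1))"
    unfolding mask_eq_exp_minus_1[symmetric] by (rule even_if) (use s in \<open>simp add: bit_mask_iff\<close>)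
  have split: "(2 :: nat) ^ s - 2 ^ b = 2 ^ b * (2 ^ (s - b) - 1)"
    using pow by (simp add: diff_mult_distrib2)
  have e3: "even (N choose (2 ^ s - 2 ^ b))"
    by (rule even_if) (use even_half in \<open>simp add: bit_iff_odd split\<close>)
  \<comment> \<open>The index is \<open>2 ^ b * (2 ^ (s - b) - 1) + 1\<close>. As
    \<open>b \<ge> 1\<close>, the final 1 does not reach digit \<open>b\<close>, which is the lowest
    digit of \<open>2 ^ (s - b) - 1\<close>.\<close>
  have e4: "even (N choose (2 ^ s - (2 ^ b - 1)))"
  proof (rule even_if)
    have le: "(2 :: nat) ^ b \<le> 2 ^ s" using s by (simp add: power_increasing)
    have "(2 :: nat) ^ s - (2 ^ b - 1) = 2 ^ b * (2 ^ (s - b) - 1) + 1"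
      using split pow(1) le by linarith
    moreover have "(2 ^ b * (2 ^ (s - b) - 1) + 1) div 2 ^ b = (2 :: nat) ^ (s - b) - 1"
      using pow(1) by (subst div_mult_self4) auto
    ultimately show "bit ((2 :: nat) ^ s - (2 ^ b - 1)) b" using even_half by (simp add: bit_iff_odd)
  qed
  show thesis by (rule that[OF b1 s(1) lt o1 o2 o3 o4 e1 e2 e3 e4])
qed

context odd_period
begin

text \<open>For \<open>1 \<le> k \<le> h\<close> the zeros of \<open>cvec N 0\<close> and of its
  shift by \<open>k\<close> lie at different places, so each product sum has an odd number
  \<open>N - 2\<close> of ones. The value is then half a row of Pascal's triangle without its first
  entry, \<open>2 ^ (2 * h) - 1\<close> modulo 2.\<close>

lemma q_cvec_0: "qform N (cvec N 0) = 1"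
proof -
  define h where "h = N div 2"
  have Nh: "N = 2 * h + 1" using odd_N by (simp add: h_def)
  let ?c = "cvec N 0"
  have s0: "(\<Sum>i\<in>{0..<int N}. ?c i) = 0" using cvec_W[of 0] by (simp add: sum_zero_periodic_def)
  have prod: "(\<Sum>i\<in>{0..<int N}. ?c i * ?c (i + int k)) = 1" if k: "k \<in> {1..h}" for k
  proof -
    have "?c (i + int k) = cvec N (- int k) i" for i
    proof -
      have "(i + int k) mod int N = 0 \<longleftrightarrow> i mod int N = (- int k) mod int N"
        unfolding mod_eq_0_iff_dvd mod_eq_dvd_iff by simp
      then show ?thesis by (simp add: cvec_def)
    qed
    then have "(\<Sum>i\<in>{0..<int N}. ?c i * ?c (i + int k)) = ?c (- int k)"
      using sum_times_cvec[OF periodic_cvec N_pos, of 0 "- int k"] s0 by simp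
    also have "\<dots> = 1"
    proof -
      have "\<not> N dvd k" using k Nh by (auto dest: dvd_imp_le)
      then have "(- int k) mod int N \<noteq> 0" by (simp add: mod_eq_0_iff_dvd)
      then show ?thesis by (simp add: cvec_def)
    qed
    finally show ?thesis .
  qed
  have "qform N ?c = (\<Sum>i\<in>{0..<int N}. ?c i) + (\<Sum>k\<in>{1..h}. of_nat (N choose k) * (\<Sum>i\<in>{0..<int N}. ?c i * ?c (i + int k)))"
    unfolding qform_def h_def sum.distrib sum_distrib_left by (subst sum.swap) simp
  also have "\<dots> = (\<Sum>k\<in>{1..h}. of_nat (N choose k))" using s0 prod by simp
  also have "\<dots> = of_nat (\<Sum>k\<in>{1..h}. N choose k)" by simp
  also have "\<dots> = 1"
  proof -
    have "(\<Sum>k\<le>h. N choose k) = 1 + (\<Sum>k\<in>{1..h}. N choose k)"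
      by (simp add: atMost_atLeast0 sum.atLeast_Suc_atMost)
    moreover have "(\<Sum>k\<le>h. N choose k) = 2 ^ (2 * h)" unfolding Nh by (rule binomial_r_part_sum)
    moreover have "h > 0" using Nh N_gt_1 by simp
    ultimately have "odd (\<Sum>k\<in>{1..h}. N choose k)"
      by (metis even_add even_power odd_one mult_pos_pos zero_less_numeral dvd_refl)
    then show ?thesis by (simp add: of_nat_bit)
  qed
  finally show ?thesis .
qed

text \<open>All values of \<open>cvec\<close> in the expansion but one are 1. A full row of binomial
  coefficients has even sum, so only the exceptional index contributes.\<close>

lemma B_cvec_cvec:
  assumes "i < j" "j < N"
  shows "bform N (cvec N (int i)) (cvec N (int j)) = of_nat (N choose (j - i))"
proof -
  have "bform N (cvec N (int i)) (cvec N (int j)) = (\<Sum>k\<le>N. of_nat (N choose k) * cvec N (int i) (int j + int k))"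
    by (simp add: B_cvec[OF cvec_W] diff_op_pow)
  also have "\<dots> = (\<Sum>k\<le>N. of_nat (N choose k) * (1 + (if k = N - (j - i) then 1 else 0)))"
  proof (intro sum.cong refl arg_cong2[of _ _ _ _ "(*)"])
    fix k assume k: "k \<in> {..N}"
    have "(int j + int k) mod int N = int i mod int N \<longleftrightarrow> k = N - (j - i)"
    proof
      assume "(int j + int k) mod int N = int i mod int N"
      then have "int N dvd (int j + int k) - int i" by (simp only: mod_eq_dvd_iff)
      also have "(int j + int k) - int i = int (j - i + k)" using assms by simp
      finally have "int N dvd int (j - i + k)" .
      then have "N dvd j - i + k" by (simp only: of_nat_dvd_iff)
      then obtain m where m: "j - i + k = N * m" by auto
      have "j - i + k < N * 2" using k assms by auto
      then have "m < 2" using m by simp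
      moreover have "m \<noteq> 0" using m assms by (intro notI) simp
      ultimately have "m = 1" by simp
      then show "k = N - (j - i)" using m by simp
    next
      assume "k = N - (j - i)"
      then have "int j + int k = int i + int N" using assms by simp
      then show "(int j + int k) mod int N = int i mod int N" by simp
    qed
    then show "cvec N (int i) (int j + int k) = 1 + (if k = N - (j - i) then 1 else 0)"
      by (simp add: cvec_def)
  qed
  also have "\<dots> = of_nat (\<Sum>k\<le>N. N choose k) + of_nat (N choose (N - (j - i)))"
    by (simp add: distrib_left sum.distrib sum.delta' if_distrib[of "(*) _"] cong: if_cong)
  also have "(\<Sum>k\<le>N. N choose k) = 2 ^ N" by (rule choose_row_sum)
  also have "N choose (N - (j - i)) = N choose (j - i)" using assms binomial_symmetric[of "j - i" N] by simp
  finally show ?thesis using N_pos by (simp add: of_nat_bit)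
qed

lemma cvec_separates:
  assumes "x \<in> W" "x \<noteq> 0"
  obtains i where "i < N" "bform N x (cvec N (int i)) = 1"
proof -
  have "\<exists>j. (diff_op ^^ N) x j \<noteq> 0"
  proof (rule ccontr)
    assume "\<not> ?thesis"
    then have "(diff_op ^^ N) x = 0" by auto
    then have "diff_op x = 0" by (rule diff_op_pow_kernel[OF W_periodic[OF assms(1)] odd_N N_pos])
    then show False using sum_zero_periodic_const[OF odd_N assms(1)] assms(2) by blast
  qed
  then obtain j where j: "(diff_op ^^ N) x j = 1" by auto
  have "(diff_op ^^ N) x (j mod int N) = 1"
    using periodic_mod[OF periodic_diff_op_pow[OF W_periodic[OF assms(1)]]] j by simp
  moreover have "j mod int N = int (nat (j mod int N))" "nat (j mod int N) < N" using N_pos by (auto simp: nat_less_iff)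
  ultimately show thesis using that[of "nat (j mod int N)"] B_cvec[OF assms(1)] by simp
qed

text \<open>Axioms satisfied by the vectors whose transvections lie in a group containing the monodromy group.\<close>

definition monodromy_closed :: "(int \<Rightarrow> bit) set \<Rightarrow> bool" where
  "monodromy_closed R \<longleftrightarrow> R \<subseteq> W \<and> Q.trv_closed N R \<and> cvec N 0 \<in> R \<and> (\<forall>r\<in>R. shift r \<in> R)"

lemma cvec_in_closed: "monodromy_closed R \<Longrightarrow> cvec N (int k) \<in> R"
proof (induction k)
  case (Suc k)
  then have "shift (cvec N (int k)) \<in> R" by (simp add: monodromy_closed_def)
  then show ?case by (simp add: shift_cvec add.commute)
qed (simp add: monodromy_closed_def)

lemma q_cvec: "qform N (cvec N (int k)) = 1"
proof (induction k)
  case (Suc k)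
  have "qform N (shift (cvec N (int k))) = 1" using Suc q_shift(1)[OF cvec_W] by simp
  then show ?case by (simp add: shift_cvec add.commute)
qed (simp add: q_cvec_0)

lemma all_nonsingular:
  assumes gen: "generic_period N" and R: "monodromy_closed R"
  shows "Q.nonsing N W \<subseteq> R" "\<exists>a b c d. Q.path4 N a b c d \<and> Q.span_path4 a b c d \<subseteq> W"
proof -
  obtain b s where bs: "1 \<le> b" "b < s" "2 ^ s + 1 < N"
    "odd (N choose 1)" "odd (N choose 2 ^ s)" "odd (N choose (2 ^ s + 1))" "odd (N choose (2 ^ b - 1))"
    "even (N choose 2 ^ b)" "even (N choose (2 ^ s - 1))" "even (N choose (2 ^ s - 2 ^ b))"
    "even (N choose (2 ^ s - (2 ^ b - 1)))"
    using generic_period_bits[OF gen] .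
  define l :: nat where "l = 2 ^ b - 1"
  define t :: nat where "t = 2 ^ s"
  define C where "C = (\<lambda>i :: nat. cvec N (int i))"
  have qC: "qform N (C i) = 1" and CW: "C i \<in> W" for i by (simp_all add: C_def q_cvec cvec_W)
  have "(2 :: nat) ^ 1 \<le> 2 ^ b" "(2 :: nat) ^ (b + 1) \<le> 2 ^ s" 
    by (rule power_increasing; use bs(1,2) in simp)+
  then have lt: "1 \<le> l" "2 * l + 2 \<le> t" by (auto simp: l_def t_def)
  have odds: "odd (N choose 1)" "odd (N choose t)" "odd (N choose (t + 1))" "odd (N choose l)"
    "even (N choose (l + 1))" "even (N choose (t - 1))" "even (N choose (t - l - 1))" "even (N choose (t - l))"
    using bs by (simp_all add: l_def t_def)
  have tN: "t + 1 < N" using bs by (simp add: t_def)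
  have Bs: "bform N (C i) (C j) = of_nat (N choose (j - i))" if "i < j" "j < N" for i j
    using B_cvec_cvec[OF that] by (simp add: C_def)
  have Bs': "bform N (C j) (C i) = of_nat (N choose (j - i))" if "i < j" "j < N" for i j
    using Bs[OF that] Q.B_commute by metis
  have path: "Q.path4 N (C 1) (C 0) (C t) (C (t - l))"
    unfolding Q.path4_def using lt tN odds
    by (simp add: qC Bs Bs' of_nat_bit del: binomial_1)
  have cR: "C i \<in> R" for i using cvec_in_closed[OF R] by (simp add: C_def)
  have RW: "R \<subseteq> W" and closed: "Q.trv_closed N R" using R by (auto simp: monodromy_closed_def)
  have sub: "Q.span_path4 (C 1) (C 0) (C t) (C (t - l)) \<subseteq> W"
    unfolding Q.span_path4_def by (intro Q.adjoin_subset W_form W_subsp CW) (auto simp: W_subsp)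
  show "\<exists>a b c d. Q.path4 N a b c d \<and> Q.span_path4 a b c d \<subseteq> W" using path sub by blast
  show "Q.nonsing N W \<subseteq> R"
  proof (rule Q.all_nonsingular_in_closed[OF W_form closed RW _ _ path _ sub])
    show "\<exists>s\<in>R. bform N s x = 1" if "x \<in> W" "x \<noteq> 0" for x
      using cvec_separates[OF that] cR Q.B_commute unfolding C_def by metis
    show "Q.nonsing N (Q.span_path4 (C 1) (C 0) (C t) (C (t - l))) \<subseteq> R"
      by (rule Q.path4_in_closed[OF path closed cR cR cR cR])
    show "C (t + 1) \<in> R" by (rule cR)
    show "bform N (C (t + 1)) (C 1) = 1" "bform N (C (t + 1)) (C 0) = 1" "bform N (C (t + 1)) (C t) = 1"
      "bform N (C (t + 1)) (C (t - l)) = 0"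
      using lt tN odds Suc_diff_le[of "t - l" t]
      by (simp_all add: Bs' of_nat_bit del: binomial_1)
    \<comment> \<open>At position 2 the left side is 1, as \<open>t \<ge> 4\<close>, and the right
      side is 1 + 1 = 0.\<close>
    show "C (t + 1) \<noteq> C 1 + C 0"
    proof
      assume "C (t + 1) = C 1 + C 0"
      then have "C (t + 1) 2 = C 1 2 + C 0 2" by simp
      then show False using lt tN by (simp add: C_def cvec_def mod_pos_pos_trivial)
    qed
    fix X assume X: "X \<subseteq> R" "X \<noteq> {}" "\<And>x y. x \<in> X \<Longrightarrow> y \<in> R - X \<Longrightarrow> bform N x y = 0"
    \<comment> \<open>Neighbouring shifts pair to \<open>N choose 1\<close>, which is odd, and every
      non-zero vector of \<open>W\<close> pairs to 1 with some shift. So a non-empty part of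
      \<open>R\<close> orthogonal to the rest contains all shifts, and then everything.\<close>
    have adj: "bform N (C i) (C (Suc i)) = 1" if "Suc i < N" for i
      using Bs[of i "Suc i"] that odds(1) by (simp add: of_nat_bit)
    have const: "C i \<in> X \<longleftrightarrow> C 0 \<in> X" if "i < N" for i
      using that
    proof (induction i)
      case (Suc i)
      then have "C (Suc i) \<in> X \<longleftrightarrow> C i \<in> X"
        using adj[of i] X(3)[of "C i" "C (Suc i)"] X(3)[of "C (Suc i)" "C i"] cR
          Q.B_commute[of N "C i" "C (Suc i)"] by (metis DiffI zero_neq_one)
      then show ?case using Suc by simp
    qed simp
    have ne0: "r \<noteq> 0" if "r \<in> R" for r using that closed by (auto simp: Q.trv_closed_def)
    have "C 0 \<in> X"
    proof (rule ccontr)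
      assume "C 0 \<notin> X"
      obtain x where x: "x \<in> X" using X by blast
      then obtain i where i: "i < N" "bform N x (C i) = 1"
        using cvec_separates[of x] X(1) RW ne0 unfolding C_def by blast
      then have "C i \<notin> X" using const \<open>C 0 \<notin> X\<close> by blast
      then show False using X(3)[OF x, of "C i"] cR i by simp
    qed
    show "X = R"
    proof (rule ccontr)
      assume "X \<noteq> R"
      then obtain r where r: "r \<in> R - X" using X by blast
      then obtain i where i: "i < N" "bform N r (C i) = 1"
        using cvec_separates[of r] RW ne0 unfolding C_def by blast
      then have "C i \<in> X" using const \<open>C 0 \<in> X\<close> by blast
      then show False using X(3)[of "C i" r] r i Q.B_commute[of N r] by simp
    qed
  qed
qed

end

section \<open>Orthogonal groups\<close>

lemma isoD:
  assumes "\<phi> \<in> iso (vec_space_F2 n) G"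
  shows "bij_betw \<phi> (carrier_vec n) (carrier G)" "x \<in> carrier_vec n \<Longrightarrow> \<phi> x \<in> carrier G"
    "x \<in> carrier_vec n \<Longrightarrow> y \<in> carrier_vec n \<Longrightarrow> \<phi> (x + y) = \<phi> x \<otimes>\<^bsub>G\<^esub> \<phi> y"
    "inv_into (carrier_vec n) \<phi> \<in> iso G (vec_space_F2 n)"
    "a \<in> carrier G \<Longrightarrow> \<phi> (inv_into (carrier_vec n) \<phi> a) = a"
    "x \<in> carrier_vec n \<Longrightarrow> inv_into (carrier_vec n) \<phi> (\<phi> x) = x"
    "a \<in> carrier G \<Longrightarrow> inv_into (carrier_vec n) \<phi> a \<in> carrier_vec n"
proof -
  show bij: "bij_betw \<phi> (carrier_vec n) (carrier G)" using assms by (simp add: iso_def)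
  show "x \<in> carrier_vec n \<Longrightarrow> \<phi> x \<in> carrier G"
    "x \<in> carrier_vec n \<Longrightarrow> y \<in> carrier_vec n \<Longrightarrow> \<phi> (x + y) = \<phi> x \<otimes>\<^bsub>G\<^esub> \<phi> y"
    using assms by (auto simp: iso_def hom_def)
  show "inv_into (carrier_vec n) \<phi> \<in> iso G (vec_space_F2 n)"
    using group.iso_set_sym[OF group_vec_space assms] by simp
  show "a \<in> carrier G \<Longrightarrow> \<phi> (inv_into (carrier_vec n) \<phi> a) = a"
    by (rule bij_betw_inv_into_right[OF bij])
  show "x \<in> carrier_vec n \<Longrightarrow> inv_into (carrier_vec n) \<phi> (\<phi> x) = x"
    by (rule bij_betw_inv_into_left[OF bij])
  show "a \<in> carrier G \<Longrightarrow> inv_into (carrier_vec n) \<phi> a \<in> carrier_vec n"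
    using bij by (auto simp: bij_betw_def intro: inv_into_into)
qed

definition map_via :: "nat \<Rightarrow> (bit vec \<Rightarrow> 'b) \<Rightarrow> bit mat \<Rightarrow> 'b \<Rightarrow> 'b" where
  "map_via n \<phi> A a = \<phi> (A *\<^sub>v inv_into (carrier_vec n) \<phi> a)"

lemma map_via_hom:
  assumes \<phi>: "\<phi> \<in> iso (vec_space_F2 n) G" and A: "A \<in> carrier_mat n n"
  shows "map_via n \<phi> A \<in> hom G G"
proof (rule homI)
  note \<phi>' = isoD[OF \<phi>]
  fix a assume a: "a \<in> carrier G"
  then show "map_via n \<phi> A a \<in> carrier G"
    unfolding map_via_def using \<phi>'(2,7) A by (auto intro: mult_mat_vec_carrier[of _ n n])
  fix b assume b: "b \<in> carrier G"
  have "inv_into (carrier_vec n) \<phi> (a \<otimes>\<^bsub>G\<^esub> b) = inv_into (carrier_vec n) \<phi> a + inv_into (carrier_vec n) \<phi> b"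
    using \<phi>'(4) a b by (auto simp: iso_def hom_def)
  then have "A *\<^sub>v inv_into (carrier_vec n) \<phi> (a \<otimes>\<^bsub>G\<^esub> b) =
      A *\<^sub>v inv_into (carrier_vec n) \<phi> a + A *\<^sub>v inv_into (carrier_vec n) \<phi> b"
    using mult_add_distrib_mat_vec[OF A \<phi>'(7)[OF a] \<phi>'(7)[OF b]] by simp
  then show "map_via n \<phi> A (a \<otimes>\<^bsub>G\<^esub> b) = map_via n \<phi> A a \<otimes>\<^bsub>G\<^esub> map_via n \<phi> A b"
    unfolding map_via_def using \<phi>'(3,7) a b A by (simp add: mult_mat_vec_carrier[of _ n n])
qed

lemma map_via_mult:
  assumes \<phi>: "\<phi> \<in> iso (vec_space_F2 n) G" and A: "A \<in> carrier_mat n n" "A' \<in> carrier_mat n n"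
    and a: "a \<in> carrier G"
  shows "map_via n \<phi> (A * A') a = map_via n \<phi> A (map_via n \<phi> A' a)"
  unfolding map_via_def using A isoD(6,7)[OF \<phi>] a
  by (simp add: mult_mat_vec_carrier[of _ n n] assoc_mult_mat_vec[of _ n n _ n])

text \<open>Change of coordinates: the endomorphism that \<open>A\<close> describes in the
  coordinates \<open>\<phi>\<close>, written in the coordinates \<open>\<psi>\<close>.\<close>

definition conj_mat :: "nat \<Rightarrow> (bit vec \<Rightarrow> 'b) \<Rightarrow> (bit vec \<Rightarrow> 'b) \<Rightarrow> bit mat \<Rightarrow> bit mat" where
  "conj_mat n \<phi> \<psi> A = matrix_via n \<psi> (map_via n \<phi> A)"

lemma conj_mat_mult_vec:
  assumes "group G" "\<phi> \<in> iso (vec_space_F2 n) G" "\<psi> \<in> iso (vec_space_F2 n) G" "A \<in> carrier_mat n n"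
    "x \<in> carrier_vec n"
  shows "\<psi> (conj_mat n \<phi> \<psi> A *\<^sub>v x) = map_via n \<phi> A (\<psi> x)"
  unfolding conj_mat_def by (rule matrix_via_mult[OF assms(1,3) map_via_hom[OF assms(2,4)] assms(5)])

lemma conj_mat_inverse:
  assumes "group G" and \<phi>: "\<phi> \<in> iso (vec_space_F2 n) G" and \<psi>: "\<psi> \<in> iso (vec_space_F2 n) G"
    and A: "A \<in> carrier_mat n n"
  shows "conj_mat n \<psi> \<phi> (conj_mat n \<phi> \<psi> A) = A"
  unfolding conj_mat_def[of n \<psi>]
proof (rule matrix_via_unique[OF isoD(1)[OF \<phi>] A])
  fix x :: "bit vec" assume x: "x \<in> carrier_vec n"
  have "map_via n \<psi> (conj_mat n \<phi> \<psi> A) (\<phi> x) = map_via n \<phi> A (\<psi> (inv_into (carrier_vec n) \<psi> (\<phi> x)))"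
    unfolding map_via_def[of n \<psi>]
    by (rule conj_mat_mult_vec[OF assms isoD(7)[OF \<psi> isoD(2)[OF \<phi> x]]])
  also have "\<dots> = \<phi> (A *\<^sub>v x)"
    unfolding map_via_def isoD(5)[OF \<psi> isoD(2)[OF \<phi> x]] isoD(6)[OF \<phi> x] ..
  finally show "\<phi> (A *\<^sub>v x) = map_via n \<psi> (conj_mat n \<phi> \<psi> A) (\<phi> x)" ..
qed

lemma conj_mat_mult:
  assumes G: "group G" and \<phi>: "\<phi> \<in> iso (vec_space_F2 n) G" and \<psi>: "\<psi> \<in> iso (vec_space_F2 n) G"
    and A: "A \<in> carrier_mat n n" "A' \<in> carrier_mat n n"
  shows "conj_mat n \<phi> \<psi> (A * A') = conj_mat n \<phi> \<psi> A * conj_mat n \<phi> \<psi> A'"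
  unfolding conj_mat_def[of n \<phi> \<psi> "A * A'"]
proof (rule matrix_via_unique[OF isoD(1)[OF \<psi>]])
  have c: "conj_mat n \<phi> \<psi> A \<in> carrier_mat n n" for A by (simp add: conj_mat_def)
  then show "conj_mat n \<phi> \<psi> A * conj_mat n \<phi> \<psi> A' \<in> carrier_mat n n" using mult_carrier_mat by blast
  fix x :: "bit vec" assume x: "x \<in> carrier_vec n"
  have "\<psi> (conj_mat n \<phi> \<psi> A * conj_mat n \<phi> \<psi> A' *\<^sub>v x) = \<psi> (conj_mat n \<phi> \<psi> A *\<^sub>v (conj_mat n \<phi> \<psi> A' *\<^sub>v x))"
    using x c by (simp add: assoc_mult_mat_vec[of _ n n _ n])
  also have "\<dots> = map_via n \<phi> A (map_via n \<phi> A' (\<psi> x))"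
    using conj_mat_mult_vec[OF G \<phi> \<psi>] A x c by (simp add: mult_mat_vec_carrier[of _ n n])
  also have "\<dots> = map_via n \<phi> (A * A') (\<psi> x)"
    using map_via_mult[OF \<phi> A isoD(2)[OF \<psi> x]] by simp
  finally show "\<psi> (conj_mat n \<phi> \<psi> A * conj_mat n \<phi> \<psi> A' *\<^sub>v x) = map_via n \<phi> (A * A') (\<psi> x)" .
qed

lemma conj_mat_one:
  assumes \<phi>: "\<phi> \<in> iso (vec_space_F2 n) G" and \<psi>: "\<psi> \<in> iso (vec_space_F2 n) G"
  shows "conj_mat n \<phi> \<psi> (1\<^sub>m n) = 1\<^sub>m n"
  unfolding conj_mat_def
  by (rule matrix_via_unique[OF isoD(1)[OF \<psi>]]) (use isoD(2,5,7)[OF \<phi>] isoD(2)[OF \<psi>] in \<open>auto simp: map_via_def\<close>)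

lemma conj_mat_GL:
  assumes G: "group G" and \<phi>: "\<phi> \<in> iso (vec_space_F2 n) G" and \<psi>: "\<psi> \<in> iso (vec_space_F2 n) G"
    and A: "A \<in> carrier (GL_F2 n)"
  shows "conj_mat n \<phi> \<psi> A \<in> carrier (GL_F2 n)"
proof -
  obtain C where C: "A \<in> carrier_mat n n" "C \<in> carrier_mat n n" "C * A = 1\<^sub>m n" "A * C = 1\<^sub>m n"
    using iffD1[OF GL_carrier A] by blast
  then show ?thesis
    using conj_mat_mult[OF G \<phi> \<psi> C(1,2)] conj_mat_mult[OF G \<phi> \<psi> C(2,1)] conj_mat_one[OF \<phi> \<psi>]
    by (auto simp: GL_carrier conj_mat_def intro!: bexI[of _ "conj_mat n \<phi> \<psi> C"])
qed

definition isometry_group :: "nat \<Rightarrow> (bit vec \<Rightarrow> bit) \<Rightarrow> bit mat monoid" where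
  "isometry_group n F = (GL_F2 n) \<lparr>carrier := {g \<in> carrier (GL_F2 n). \<forall>x\<in>carrier_vec n. F (g *\<^sub>v x) = F x}\<rparr>"

lemma O_eq_isometry_group: "O_plus_F2 n = isometry_group n (F_plus n)" "O_minus_F2 n = isometry_group n (F_minus n)"
  by (simp_all add: O_plus_F2_def O_minus_F2_def isometry_group_def)

lemma isometry_group_conj:
  assumes G: "group G" and \<phi>: "\<phi> \<in> iso (vec_space_F2 n) G" and \<psi>: "\<psi> \<in> iso (vec_space_F2 n) G"
  shows "conj_mat n \<phi> \<psi> \<in> iso (isometry_group n (\<lambda>x. q (\<phi> x))) (isometry_group n (\<lambda>x. q (\<psi> x)))"
proof -
  have into: "conj_mat n \<phi> \<psi> g \<in> carrier (isometry_group n (\<lambda>x. q (\<psi> x)))"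
    if \<phi>: "\<phi> \<in> iso (vec_space_F2 n) G" and \<psi>: "\<psi> \<in> iso (vec_space_F2 n) G"
      and g: "g \<in> carrier (isometry_group n (\<lambda>x. q (\<phi> x)))" for \<phi> \<psi> g
  proof -
    have gGL: "g \<in> carrier (GL_F2 n)" and gq: "\<And>x. x \<in> carrier_vec n \<Longrightarrow> q (\<phi> (g *\<^sub>v x)) = q (\<phi> x)"
      using g by (auto simp: isometry_group_def)
    have gm: "g \<in> carrier_mat n n" using iffD1[OF GL_carrier gGL] by blast
    have "q (\<psi> (conj_mat n \<phi> \<psi> g *\<^sub>v x)) = q (\<psi> x)" if x: "x \<in> carrier_vec n" for x
      unfolding conj_mat_mult_vec[OF G \<phi> \<psi> gm x] map_via_def
      using gq[OF isoD(7)[OF \<phi> isoD(2)[OF \<psi> x]]] isoD(5)[OF \<phi> isoD(2)[OF \<psi> x]] by simp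
    then show ?thesis using conj_mat_GL[OF G \<phi> \<psi> gGL] by (simp add: isometry_group_def)
  qed
  have mat: "g \<in> carrier_mat n n" if "g \<in> carrier (isometry_group n F)" for g F
    using that GL_carrier by (auto simp: isometry_group_def)
  have "bij_betw (conj_mat n \<phi> \<psi>) (carrier (isometry_group n (\<lambda>x. q (\<phi> x)))) (carrier (isometry_group n (\<lambda>x. q (\<psi> x))))"
    by (rule bij_betw_byWitness[of _ "conj_mat n \<psi> \<phi>"])
       (use into[OF \<phi> \<psi>] into[OF \<psi> \<phi>] conj_mat_inverse[OF G \<phi> \<psi> mat] conj_mat_inverse[OF G \<psi> \<phi> mat] in auto)
  moreover have "conj_mat n \<phi> \<psi> \<in> hom (isometry_group n (\<lambda>x. q (\<phi> x))) (isometry_group n (\<lambda>x. q (\<psi> x)))"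
    using into[OF \<phi> \<psi>] conj_mat_mult[OF G \<phi> \<psi> mat mat]
    by (intro homI) (auto simp: isometry_group_def)
  ultimately show ?thesis by (simp add: iso_def)
qed

section \<open>The monodromy group inside the isometry group\<close>

context odd_period
begin

declare One_nat_def [simp del]

abbreviation "GL \<equiv> GL_F2 (N - 1)"
abbreviation rep :: "((int \<Rightarrow> bit) \<Rightarrow> int \<Rightarrow> bit) \<Rightarrow> bit mat" where "rep \<equiv> matrix_via (N - 1) vecs"

lemma vecs_rep:
  "f \<in> hom (periodic_group N) (periodic_group N) \<Longrightarrow> x \<in> carrier_vec (N - 1) \<Longrightarrow> vecs (rep f *\<^sub>v x) = f (vecs x)"
  by (rule matrix_via_mult[OF periodic_group vecs_iso])

lemma rep_eqI:
  "A \<in> carrier_mat (N - 1) (N - 1) \<Longrightarrow> (\<And>x. x \<in> carrier_vec (N - 1) \<Longrightarrow> vecs (A *\<^sub>v x) = f (vecs x)) \<Longrightarrow> rep f = A"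
  using matrix_via_unique[of vecs "N - 1" W A f] isoD(1)[OF vecs_iso] by simp

lemma matB_eq: "matB = rep shift"
  by (rule rep_eqI[symmetric]) (simp_all add: vecs_B)

lemma matA_eq: "matA = rep (\<lambda>a. T (cvec N 0) (shift a))"
  by (rule rep_eqI[symmetric]) (simp_all add: vecs_A)

lemma hom_comp_shift: "r \<in> W \<Longrightarrow> (\<lambda>a. T r (shift a)) \<in> hom (periodic_group N) (periodic_group N)"
  "r \<in> W \<Longrightarrow> (\<lambda>a. unshift (T r a)) \<in> hom (periodic_group N) (periodic_group N)"
  by (auto simp: hom_def shift_W T_W shift_add Q.trv_add)

lemma matB_GL: "matB \<in> carrier GL"
  unfolding matB_eq by (rule matrix_via_GL[OF periodic_group vecs_iso hom_shift]) auto

lemma matA_GL: "matA \<in> carrier GL"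
  unfolding matA_eq
  by (rule matrix_via_GL[OF periodic_group vecs_iso hom_comp_shift[OF cvec_W[of 0]]]) auto

definition MD_set :: "bit mat set" where
  "MD_set = generate GL {matA, matB}"

lemma MD_eq': "MD_F2 (N - 1) = GL\<lparr>carrier := MD_set\<rparr>"
  by (simp add: MD_eq MD_set_def)

lemma MD_subgroup: "subgroup MD_set GL"
  unfolding MD_set_def by (rule group.generate_is_subgroup[OF GL_group]) (use matA_GL matB_GL in auto)

lemmas MD_closed = subgroup.m_closed[OF MD_subgroup, simplified] subgroup.m_inv_closed[OF MD_subgroup]

lemma MD_gens: "matA \<in> MD_set" "matB \<in> MD_set"
  unfolding MD_set_def by (auto intro: generate.incl)

lemma inv_matB_carrier: "inv\<^bsub>GL\<^esub> matB \<in> carrier_mat (N - 1) (N - 1)"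
  using GL_inv_mult_vec(3)[OF matB_GL, of "0\<^sub>v (N - 1)"] by simp

lemma shift_vecs_inv:
  assumes x: "x \<in> carrier_vec (N - 1)"
  shows "shift (vecs (inv\<^bsub>GL\<^esub> matB *\<^sub>v x)) = vecs x"
  using vecs_B[OF GL_inv_mult_vec(4)[OF matB_GL x]] GL_inv_mult_vec(1)[OF matB_GL x] by simp

definition MD_vectors :: "(int \<Rightarrow> bit) set" where
  "MD_vectors = {r \<in> Q.nonsing N W. rep (T r) \<in> MD_set}"

lemma MD_vectorsD: "r \<in> MD_vectors \<Longrightarrow> r \<in> W" "r \<in> MD_vectors \<Longrightarrow> qform N r = 1"
    "r \<in> MD_vectors \<Longrightarrow> rep (T r) \<in> MD_set"
  by (auto simp: MD_vectors_def Q.nonsing_def)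

text \<open>The transvection in \<open>cvec N 0\<close> is the quotient of the generators,
  conjugation by \<open>matB\<close> shifts the vector of a transvection, and sums are conjugates by
  \<open>trv_of_sum\<close>.\<close>

lemma monodromy_closed_MD: "monodromy_closed MD_vectors"
  unfolding monodromy_closed_def Q.trv_closed_def
proof (intro conjI ballI impI)
  have q0: "qform N (cvec N 0) = 1" by (rule q_cvec_0)
  have "rep (T (cvec N 0)) = matA * inv\<^bsub>GL\<^esub> matB"
  proof (rule rep_eqI)
    show "matA * inv\<^bsub>GL\<^esub> matB \<in> carrier_mat (N - 1) (N - 1)"
      by (rule mult_carrier_mat[OF mat_carrier(1) inv_matB_carrier])
    fix x :: "bit vec" assume x: "x \<in> carrier_vec (N - 1)"
    have "matA * inv\<^bsub>GL\<^esub> matB *\<^sub>v x = matA *\<^sub>v (inv\<^bsub>GL\<^esub> matB *\<^sub>v x)"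
      by (rule assoc_mult_mat_vec[OF mat_carrier(1) inv_matB_carrier x])
    then show "vecs (matA * inv\<^bsub>GL\<^esub> matB *\<^sub>v x) = T (cvec N 0) (vecs x)"
      using vecs_A[OF GL_inv_mult_vec(4)[OF matB_GL x]] shift_vecs_inv[OF x] by simp
  qed
  then show "cvec N 0 \<in> MD_vectors"
    using MD_gens MD_closed q0 cvec_W by (simp add: MD_vectors_def Q.nonsing_def)
next
  fix r assume r: "r \<in> MD_vectors"
  note r' = MD_vectorsD[OF r]
  have "rep (T (shift r)) = matB * rep (T r) * inv\<^bsub>GL\<^esub> matB"
  proof (rule rep_eqI)
    have BT: "matB * rep (T r) \<in> carrier_mat (N - 1) (N - 1)"
      by (rule mult_carrier_mat[OF mat_carrier(2) matrix_via_carrier])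
    show "matB * rep (T r) * inv\<^bsub>GL\<^esub> matB \<in> carrier_mat (N - 1) (N - 1)"
      by (rule mult_carrier_mat[OF BT inv_matB_carrier])
    fix x :: "bit vec" assume x: "x \<in> carrier_vec (N - 1)"
    let ?y = "inv\<^bsub>GL\<^esub> matB *\<^sub>v x"
    have y: "?y \<in> carrier_vec (N - 1)" by (rule GL_inv_mult_vec(4)[OF matB_GL x])
    have "matB * rep (T r) * inv\<^bsub>GL\<^esub> matB *\<^sub>v x = matB *\<^sub>v (rep (T r) *\<^sub>v ?y)"
      unfolding assoc_mult_mat_vec[OF BT inv_matB_carrier x]
      by (rule assoc_mult_mat_vec[OF mat_carrier(2) matrix_via_carrier y])
    then have "vecs (matB * rep (T r) * inv\<^bsub>GL\<^esub> matB *\<^sub>v x) = vecs (matB *\<^sub>v (rep (T r) *\<^sub>v ?y))"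
      by (simp only:)
    also have "\<dots> = shift (vecs (rep (T r) *\<^sub>v ?y))"
      by (rule vecs_B[OF mult_mat_vec_carrier[OF matrix_via_carrier y]])
    also have "vecs (rep (T r) *\<^sub>v ?y) = T r (vecs ?y)" by (rule vecs_rep[OF hom_T[OF r'(1)] y])
    also have "shift (T r (vecs ?y)) = T (shift r) (shift (vecs ?y))"
      using B_shift[OF vecs_W[OF y] r'(1)] by (simp add: Q.trv_def shift_add)
    finally show "vecs (matB * rep (T r) * inv\<^bsub>GL\<^esub> matB *\<^sub>v x) = T (shift r) (vecs x)"
      using shift_vecs_inv[OF x] by simp
  qed
  then show "shift r \<in> MD_vectors"
    using r' MD_gens MD_closed shift_W(1)[OF r'(1)] q_shift(1)[OF r'(1)] by (simp add: MD_vectors_def Q.nonsing_def)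
next
  fix r s assume r: "r \<in> MD_vectors" and s: "s \<in> MD_vectors" and rs: "bform N r s = 1"
  note r' = MD_vectorsD[OF r] and s' = MD_vectorsD[OF s]
  have "rep (T (r + s)) = rep (T r) * (rep (T s) * rep (T r))"
  proof (rule rep_eqI)
    show "rep (T r) * (rep (T s) * rep (T r)) \<in> carrier_mat (N - 1) (N - 1)"
      by (intro mult_carrier_mat[of _ _ "N - 1"] matrix_via_carrier)
    fix x :: "bit vec" assume x: "x \<in> carrier_vec (N - 1)"
    have "rep (T r) * (rep (T s) * rep (T r)) *\<^sub>v x = rep (T r) *\<^sub>v (rep (T s) *\<^sub>v (rep (T r) *\<^sub>v x))"
      using x by (simp add: assoc_mult_mat_vec[of _ "N - 1" "N - 1" _ "N - 1"] mult_carrier_mat[of _ _ "N - 1"])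
    then show "vecs (rep (T r) * (rep (T s) * rep (T r)) *\<^sub>v x) = T (r + s) (vecs x)"
      using vecs_rep[OF hom_T[OF r'(1)]] vecs_rep[OF hom_T[OF s'(1)]] x
      by (simp add: Q.trv_of_sum[OF rs] mult_mat_vec_carrier[of _ "N - 1" "N - 1"])
  qed
  then show "r + s \<in> MD_vectors"
    using r' s' rs MD_closed W_subsp by (simp add: MD_vectors_def Q.nonsing_def Q.q_add)
qed (auto simp: MD_vectorsD)

lemma rep_trvs:
  assumes "set rs \<subseteq> MD_vectors"
  shows "rep (Q.trvs N rs) \<in> MD_set"
  using assms
proof (induction rs)
  case Nil
  have "rep (Q.trvs N []) = 1\<^sub>m (N - 1)" by (rule rep_eqI) auto
  then show ?case using subgroup.one_closed[OF MD_subgroup] by (simp only: GL_simps)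
next
  case (Cons r rs)
  have rsW: "set rs \<subseteq> Q.nonsing N W" using Cons by (auto simp: MD_vectors_def)
  have hom: "Q.trvs N rs \<in> hom (periodic_group N) (periodic_group N)"
    using Q.trvs_closed[OF W_form(2) rsW] by (auto simp: hom_def Q.trvs_add)
  have r: "r \<in> W" using Cons MD_vectorsD by auto
  have "rep (Q.trvs N (r # rs)) = rep (T r) * rep (Q.trvs N rs)"
  proof (rule rep_eqI)
    fix x :: "bit vec" assume x: "x \<in> carrier_vec (N - 1)"
    then show "vecs (rep (T r) * rep (Q.trvs N rs) *\<^sub>v x) = Q.trvs N (r # rs) (vecs x)"
      using vecs_rep[OF hom_T[OF r]] vecs_rep[OF hom x]
      by (simp add: assoc_mult_mat_vec[of _ "N - 1" "N - 1" _ "N - 1"] mult_mat_vec_carrier[of _ "N - 1" "N - 1"])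
  qed (intro mult_carrier_mat[of _ _ "N - 1"] matrix_via_carrier)
  moreover have "rep (T r) \<in> MD_set" "rep (Q.trvs N rs) \<in> MD_set"
    using Cons MD_vectorsD(3)[of r] by auto
  ultimately show ?case using MD_closed(1) by (simp only:)
qed

lemma MD_preserves:
  assumes "g \<in> MD_set"
  shows "g \<in> carrier GL \<and> (\<forall>x\<in>carrier_vec (N - 1). qform N (vecs (g *\<^sub>v x)) = qform N (vecs x))"
proof -
  let ?P = "\<lambda>g. g \<in> carrier GL \<and> (\<forall>x\<in>carrier_vec (N - 1). qform N (vecs (g *\<^sub>v x)) = qform N (vecs x))"
  have inv: "?P (inv\<^bsub>GL\<^esub> g)" if g: "?P g" for g
  proof
    show "inv\<^bsub>GL\<^esub> g \<in> carrier GL" using g group.inv_closed[OF GL_group] by blast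
    show "\<forall>x\<in>carrier_vec (N - 1). qform N (vecs (inv\<^bsub>GL\<^esub> g *\<^sub>v x)) = qform N (vecs x)"
      using g GL_inv_mult_vec(1,4)[of g "N - 1"] by metis
  qed
  have gens: "?P g" if "g \<in> {matA, matB}" for g
    using that matA_GL matB_GL
    by (auto simp: vecs_A vecs_B q_shift vecs_W Q.q_trv[OF q_cvec_0])
  show ?thesis
    using assms unfolding MD_set_def
  proof (induction rule: generate.induct)
    case one then show ?case using group.is_monoid[OF GL_group, THEN monoid.one_closed] by simp
  next
    case (eng g h)
    have "g \<in> carrier GL" "h \<in> carrier GL" using eng by auto
    then have m: "g \<in> carrier_mat (N - 1) (N - 1)" "h \<in> carrier_mat (N - 1) (N - 1)"
      by (simp_all add: GL_carrier)
    have "g * h \<in> carrier GL"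
      using eng monoid.m_closed[OF group.is_monoid[OF GL_group[of "N - 1"]]] by simp
    moreover have "qform N (vecs (g * h *\<^sub>v x)) = qform N (vecs x)" if x: "x \<in> carrier_vec (N - 1)" for x
    proof -
      have "h *\<^sub>v x \<in> carrier_vec (N - 1)" by (rule mult_mat_vec_carrier[OF m(2) x])
      then show ?thesis using eng x by (simp add: assoc_mult_mat_vec[OF m x])
    qed
    ultimately show ?case by simp
  qed (use inv gens in blast)+
qed

text \<open>Stated for arbitrary coordinates \<open>\<phi>\<close>: it serves the coordinates
  \<open>vecs\<close> of the generators as well as coordinates that come from a permutation
  module.\<close>

lemma isometry_is_trvs:
  assumes gen: "Q.gen_by_trv N W" and g: "g \<in> carrier (isometry_group n (\<lambda>x. qform N (\<phi> x)))"
    and \<phi>: "\<phi> \<in> iso (vec_space_F2 n) (periodic_group N)"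
  obtains rs where "set rs \<subseteq> Q.nonsing N W" "\<And>x. x \<in> carrier_vec n \<Longrightarrow> \<phi> (g *\<^sub>v x) = Q.trvs N rs (\<phi> x)"
proof -
  have gGL: "g \<in> carrier (GL_F2 n)" and gq: "\<And>x. x \<in> carrier_vec n \<Longrightarrow> qform N (\<phi> (g *\<^sub>v x)) = qform N (\<phi> x)"
    using g by (auto simp: isometry_group_def)
  have gm: "g \<in> carrier_mat n n" using iffD1[OF GL_carrier gGL] by blast
  have hom: "map_via n \<phi> g \<in> hom (periodic_group N) (periodic_group N)" by (rule map_via_hom[OF \<phi> gm])
  have "Q.isom N W (map_via n \<phi> g)"
    unfolding Q.isom_def
  proof (intro conjI ballI)
    fix a assume a: "a \<in> W"
    show "map_via n \<phi> g a \<in> W" using hom a by (auto simp: hom_def)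
    show "qform N (map_via n \<phi> g a) = qform N a"
      using gq[OF isoD(7)[OF \<phi>], of a] isoD(5)[OF \<phi>, of a] a by (simp add: map_via_def)
    fix b assume "b \<in> W"
    then show "map_via n \<phi> g (a + b) = map_via n \<phi> g a + map_via n \<phi> g b"
      using hom a by (auto simp: hom_def)
  qed
  then obtain rs where rs: "set rs \<subseteq> Q.nonsing N W" "\<forall>a\<in>W. map_via n \<phi> g a = Q.trvs N rs a"
    using gen unfolding Q.gen_by_trv_def by blast
  have "\<phi> (g *\<^sub>v x) = Q.trvs N rs (\<phi> x)" if x: "x \<in> carrier_vec n" for x
    using rs(2) isoD(2)[OF \<phi> x] isoD(6)[OF \<phi> x] by (auto simp: map_via_def)
  then show thesis using that rs(1) by blast
qed

lemma MD_generic: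
  assumes gen: "generic_period N"
  shows "MD_F2 (N - 1) = isometry_group (N - 1) (\<lambda>x. qform N (vecs x))"
proof -
  have sub: "Q.nonsing N W \<subseteq> MD_vectors" and path: "\<exists>a b c d. Q.path4 N a b c d \<and> Q.span_path4 a b c d \<subseteq> W"
    using all_nonsingular[OF gen monodromy_closed_MD] by auto
  have g: "Q.gen_by_trv N W" using Q.gen_by_trv_main[OF _ W_form] path by blast
  have "carrier (isometry_group (N - 1) (\<lambda>x. qform N (vecs x))) = MD_set"
  proof (intro equalityI subsetI)
    fix k assume k: "k \<in> carrier (isometry_group (N - 1) (\<lambda>x. qform N (vecs x)))"
    then obtain rs where rs: "set rs \<subseteq> Q.nonsing N W"
        "\<And>x. x \<in> carrier_vec (N - 1) \<Longrightarrow> vecs (k *\<^sub>v x) = Q.trvs N rs (vecs x)"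
      using isometry_is_trvs[OF g _ vecs_iso] by blast
    have "k \<in> carrier GL" using k by (simp add: isometry_group_def)
    then have "k \<in> carrier_mat (N - 1) (N - 1)" using GL_carrier by blast
    then have "rep (Q.trvs N rs) = k" using rs(2) by (rule rep_eqI)
    then show "k \<in> MD_set" using rep_trvs[of rs] rs(1) sub by auto
  next
    fix k assume "k \<in> MD_set"
    then show "k \<in> carrier (isometry_group (N - 1) (\<lambda>x. qform N (vecs x)))"
      using MD_preserves by (simp add: isometry_group_def)
  qed
  then show ?thesis unfolding MD_eq' isometry_group_def by simp
qed

lemma type_iso:
  assumes "Q.has_type N W (N - 1) F"
  obtains \<chi> where "\<chi> \<in> iso (vec_space_F2 (N - 1)) (periodic_group N)"
    "\<And>x. x \<in> carrier_vec (N - 1) \<Longrightarrow> qform N (\<chi> x) = F (N - 1) x"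
proof -
  obtain \<chi> where \<chi>: "Q.vec_iso (N - 1) \<chi> W" "\<forall>x\<in>carrier_vec (N - 1). qform N (\<chi> x) = F (N - 1) x"
    using assms by (auto simp: Q.has_type_def)
  have "\<chi> \<in> iso (vec_space_F2 (N - 1)) (periodic_group N)"
    using \<chi>(1) by (auto simp: Q.vec_iso_def iso_def hom_def bij_betw_def)
  then show thesis using that \<chi>(2) by blast
qed

lemma MD_generic_iso:
  assumes gen: "generic_period N" and type: "Q.has_type N W (N - 1) F"
  shows "MD_F2 (N - 1) \<cong> isometry_group (N - 1) (F (N - 1))"
proof -
  obtain \<chi> where \<chi>: "\<chi> \<in> iso (vec_space_F2 (N - 1)) (periodic_group N)"
    "\<And>x. x \<in> carrier_vec (N - 1) \<Longrightarrow> qform N (\<chi> x) = F (N - 1) x" by (rule type_iso[OF type]) blast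
  have "isometry_group (N - 1) (\<lambda>x. qform N (\<chi> x)) = isometry_group (N - 1) (F (N - 1))"
  proof -
    have "{g \<in> carrier GL. \<forall>x\<in>carrier_vec (N - 1). qform N (\<chi> (g *\<^sub>v x)) = qform N (\<chi> x)} =
      {g \<in> carrier GL. \<forall>x\<in>carrier_vec (N - 1). F (N - 1) (g *\<^sub>v x) = F (N - 1) x}"
      using \<chi>(2) GL_inv_mult_vec(5) by (intro Collect_cong conj_cong ball_cong refl) metis
    then show ?thesis by (simp only: isometry_group_def)
  qed
  then show ?thesis
    unfolding MD_generic[OF gen] is_iso_def
    using isometry_group_conj[OF periodic_group vecs_iso \<chi>(1), of "qform N"] by auto
qed

end

theorem MD_orthogonal:
  assumes "even n" "n > 0" "generic_period (n + 1)"
  shows "n mod 8 = 0 \<or> n mod 8 = 6 \<Longrightarrow> MD_F2 n \<cong> O_plus_F2 n"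
    and "n mod 8 = 2 \<or> n mod 8 = 4 \<Longrightarrow> MD_F2 n \<cong> O_minus_F2 n"
proof -
  interpret odd_period "n + 1" by unfold_locales (use assms in auto)
  show "MD_F2 n \<cong> O_plus_F2 n" if n: "n mod 8 = 0 \<or> n mod 8 = 6"
  proof -
    have "(n + 1) mod 8 = 1 \<or> (n + 1) mod 8 = 7" using n by presburger
    then have "chi8 (n + 1) = 1" by (simp add: chi8_def)
    from MD_generic_iso[OF assms(3) type_sum_zero_periodic(1)[OF odd_N this]]
    show ?thesis by (simp add: O_eq_isometry_group)
  qed
  show "MD_F2 n \<cong> O_minus_F2 n" if n: "n mod 8 = 2 \<or> n mod 8 = 4"
  proof -
    have "\<not> ((n + 1) mod 8 = 1 \<or> (n + 1) mod 8 = 7)" using n by presburger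
    then have "chi8 (n + 1) = - 1" by (simp add: chi8_def)
    from MD_generic_iso[OF assms(3) type_sum_zero_periodic(2)[OF odd_N this]]
    show ?thesis by (simp add: O_eq_isometry_group)
  qed
qed

section \<open>Symmetric groups\<close>

text \<open>Conjugating one transposition through \<open>z\<close> by another gives every
  transposition, and these generate.\<close>

lemma subgroup_with_star_is_sym_group:
  assumes H: "subgroup H (sym_group M)" and z: "z \<in> {1..M}"
    and star: "\<And>j. j \<in> {1..M} \<Longrightarrow> j \<noteq> z \<Longrightarrow> Transposition.transpose z j \<in> H"
  shows "H = carrier (sym_group M)"
proof
  show "H \<subseteq> carrier (sym_group M)" using subgroup.subset[OF H] .
  have comp: "p \<circ> p' \<in> H" if "p \<in> H" "p' \<in> H" for p p'
    using subgroup.m_closed[OF H that] by (simp add: sym_group_mult)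
  have tr: "Transposition.transpose i j \<in> H" if ij: "i \<in> {1..M}" "j \<in> {1..M}" "i \<noteq> j" for i j
  proof -
    consider "i = z" | "j = z" | "i \<noteq> z" "j \<noteq> z" by blast
    then show ?thesis
    proof cases
      case 1 then show ?thesis using star ij by auto
    next
      case 2 then show ?thesis using star[of i] ij by (simp add: transpose_commute)
    next
      case 3
      have "Transposition.transpose i z \<circ> Transposition.transpose z j \<circ> Transposition.transpose i z = Transposition.transpose i j"
        using 3 ij by (intro transpose_comp_triple) auto
      then show ?thesis
        using comp[OF comp, of "Transposition.transpose i z" "Transposition.transpose z j" "Transposition.transpose i z"]
          star[of i] star[of j] 3 ij by (simp add: transpose_commute)
    qed
  qed
  show "carrier (sym_group M) \<subseteq> H"
  proof
    fix p assume "p \<in> carrier (sym_group M)"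
    then have "p permutes {1..M}" by (simp add: sym_group_carrier)
    then show "p \<in> H" using finite_atLeastAtMost
    proof (induction rule: permutes_induct)
      case id then show ?case using subgroup.one_closed[OF H] by (simp only: sym_group_one)
    next
      case (swap a b p) then show ?case using comp tr by blast
    qed
  qed
qed

text \<open>Points start at 1, as in \<open>sym_group\<close>; those above \<open>N\<close> are
  fixed, so that the cycle also lives in degree \<open>N + 1\<close>.\<close>

definition cycle_perm :: "nat \<Rightarrow> nat \<Rightarrow> nat" where
  "cycle_perm N i = (if 1 \<le> i \<and> i < N then i + 1 else if i = N \<and> N \<ge> 1 then 1 else i)"

definition inv_cycle_perm :: "nat \<Rightarrow> nat \<Rightarrow> nat" where
  "inv_cycle_perm N i = (if 1 < i \<and> i \<le> N then i - 1 else if i = 1 \<and> N \<ge> 1 then N else i)"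

lemma inv_cycle_perm_comp: "cycle_perm N (inv_cycle_perm N i) = i" "inv_cycle_perm N (cycle_perm N i) = i"
proof -
  show "cycle_perm N (inv_cycle_perm N i) = i"
  proof (cases "1 < i \<and> i \<le> N")
    case True
    then have "1 \<le> i - 1 \<and> i - 1 < N" "i - 1 + 1 = i" by auto
    with True show ?thesis by (simp only: cycle_perm_def inv_cycle_perm_def if_True simp_thms)
  qed (auto simp: cycle_perm_def inv_cycle_perm_def)
  show "inv_cycle_perm N (cycle_perm N i) = i"
  proof (cases "1 \<le> i \<and> i < N")
    case True
    then have "1 < i + 1 \<and> i + 1 \<le> N" "i + 1 - 1 = i" by auto
    with True show ?thesis by (simp only: cycle_perm_def inv_cycle_perm_def if_True simp_thms)
  next
    case False
    show ?thesis
    proof (cases "i = N \<and> N \<ge> 1")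
      case True
      then show ?thesis by (simp add: cycle_perm_def inv_cycle_perm_def)
    next
      case no: False
      then have "cycle_perm N i = i" using False by (simp only: cycle_perm_def if_False)
      moreover have "\<not> (1 < i \<and> i \<le> N)" "\<not> (i = 1 \<and> N \<ge> 1)" using False no by linarith+
      ultimately show ?thesis by (simp only: inv_cycle_perm_def if_False)
    qed
  qed
qed

lemma cycle_perm_permutes: "N \<le> M \<Longrightarrow> cycle_perm N permutes {1..M}"
proof (rule permutes_subset[of _ "{1..N}"])
  show "cycle_perm N permutes {1..N}"
  proof (rule bij_imp_permutes)
    show "bij_betw (cycle_perm N) {1..N} {1..N}"
      by (rule bij_betw_byWitness[of _ "inv_cycle_perm N"])
         (simp_all add: inv_cycle_perm_comp image_subset_iff, auto simp: cycle_perm_def inv_cycle_perm_def)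
  qed (auto simp: cycle_perm_def)
qed auto

lemma inv_cycle_perm: "inv' (cycle_perm N) = inv_cycle_perm N"
  by (rule inv_equality) (simp_all add: inv_cycle_perm_comp)

lemma subgroup_with_cycle_conj:
  assumes H: "subgroup H (sym_group M)" and N: "N \<le> M" and c: "cycle_perm N \<in> H"
    and t: "Transposition.transpose i j \<in> H"
  shows "Transposition.transpose (cycle_perm N i) (cycle_perm N j) \<in> H"
proof -
  have comp: "p \<circ> p' \<in> H" if "p \<in> H" "p' \<in> H" for p p'
    using subgroup.m_closed[OF H that] by (simp add: sym_group_mult)
  have "inv' (cycle_perm N) \<in> H"
    using subgroup.m_inv_closed[OF H c] subgroup.mem_carrier[OF H c] by simp
  moreover have "cycle_perm N \<circ> Transposition.transpose i j \<circ> inv' (cycle_perm N) =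
      Transposition.transpose (cycle_perm N i) (cycle_perm N j)"
  proof
    fix x show "(cycle_perm N \<circ> Transposition.transpose i j \<circ> inv' (cycle_perm N)) x =
      Transposition.transpose (cycle_perm N i) (cycle_perm N j) x"
      unfolding inv_cycle_perm Transposition.transpose_def
      using inv_cycle_perm_comp[of N] by auto
  qed
  ultimately show ?thesis using comp c t by metis
qed

text \<open>The cycle fixes \<open>N + 1\<close>, so its conjugations carry the given transposition
  to all transpositions through \<open>N + 1\<close>.\<close>

lemma cycle_and_star_transposition_generate:
  assumes H: "subgroup H (sym_group (N + 1))" and c: "cycle_perm N \<in> H"
    and t: "Transposition.transpose 1 (N + 1) \<in> H"
  shows "H = carrier (sym_group (N + 1))"
proof (rule subgroup_with_star_is_sym_group[OF H])
  have "Transposition.transpose (Suc i) (N + 1) \<in> H" if "Suc i \<le> N" for i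
    using that
  proof (induction i)
    case (Suc i)
    then have "Transposition.transpose (cycle_perm N (Suc i)) (cycle_perm N (N + 1)) \<in> H"
      by (intro subgroup_with_cycle_conj[OF H _ c]) auto
    then show ?case using Suc by (simp add: cycle_perm_def)
  qed (use t in simp)
  then show "Transposition.transpose (N + 1) j \<in> H" if "j \<in> {1..N + 1}" "j \<noteq> N + 1" for j
    using that by (cases j) (auto simp: transpose_commute)
qed auto

text \<open>1 and \<open>N\<close> are neighbours on the cycle. Conjugation gives all transpositions
  of neighbours, and chaining these gives all transpositions through 1.\<close>

lemma cycle_and_transposition_generate:
  assumes H: "subgroup H (sym_group N)" and c: "cycle_perm N \<in> H" and N: "N > 1"
    and t: "Transposition.transpose 1 N \<in> H"
  shows "H = carrier (sym_group N)"
proof (rule subgroup_with_star_is_sym_group[OF H])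
  have comp: "p \<circ> p' \<in> H" if "p \<in> H" "p' \<in> H" for p p'
    using subgroup.m_closed[OF H that] by (simp add: sym_group_mult)
  have adj: "Transposition.transpose (Suc i) (Suc (Suc i)) \<in> H" if "Suc i < N" for i
    using that
  proof (induction i)
    case 0
    have "Transposition.transpose (cycle_perm N 1) (cycle_perm N N) \<in> H"
      by (rule subgroup_with_cycle_conj[OF H _ c t]) auto
    then show ?case using N by (simp add: cycle_perm_def transpose_commute numeral_2_eq_2)
  next
    case (Suc i)
    then have "Transposition.transpose (cycle_perm N (Suc i)) (cycle_perm N (Suc (Suc i))) \<in> H"
      by (intro subgroup_with_cycle_conj[OF H _ c]) auto
    then show ?case using Suc by (simp add: cycle_perm_def)
  qed
  have "Transposition.transpose 1 (Suc (Suc i)) \<in> H" if "Suc i < N" for i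
    using that
  proof (induction i)
    case 0 then show ?case using adj[of 0] by simp
  next
    case (Suc i)
    have "Transposition.transpose 1 (Suc (Suc i)) \<circ> Transposition.transpose (Suc (Suc i)) (Suc (Suc (Suc i))) \<circ> Transposition.transpose 1 (Suc (Suc i))
      = Transposition.transpose 1 (Suc (Suc (Suc i)))"
      by (intro transpose_comp_triple) auto
    then show ?case using comp[OF comp] Suc adj[of "Suc i"] by (metis Suc_lessD)
  qed
  then show "Transposition.transpose 1 j \<in> H" if "j \<in> {1..N}" "j \<noteq> 1" for j
  proof -
    have "j = Suc (Suc (j - 2))" "Suc (j - 2) < N" using that by auto
    then show ?thesis using \<open>\<And>i. Suc i < N \<Longrightarrow> Transposition.transpose 1 (Suc (Suc i)) \<in> H\<close> by metis
  qed
qed (use N in auto)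

text \<open>A faithful action of the symmetric group of degree \<open>M\<close> on \<open>G\<close>,
  identified with \<open>W\<close> by \<open>\<gamma>\<close>, in which the shift is the permutation
  \<open>c\<close> and the transvection is \<open>t\<close>. The instances are the sum-zero vectors
  with \<open>M = N\<close> and their quotient by constants with \<open>M = N + 1\<close>.\<close>

locale perm_model = odd_period N for N +
  fixes M :: nat and G :: "('g, 'h) monoid_scheme" and \<gamma> :: "(int \<Rightarrow> bit) \<Rightarrow> 'g"
    and act :: "(nat \<Rightarrow> nat) \<Rightarrow> 'g \<Rightarrow> 'g" and c t :: "nat \<Rightarrow> nat"
  assumes group_G: "group G"
    and \<gamma>: "\<gamma> \<in> iso (periodic_group N) G"
    and act_hom: "\<And>\<sigma>. \<sigma> permutes {1..M} \<Longrightarrow> act \<sigma> \<in> hom G G"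
    and act_comp: "\<And>\<sigma> \<tau> a. \<sigma> permutes {1..M} \<Longrightarrow> \<tau> permutes {1..M} \<Longrightarrow> a \<in> carrier G \<Longrightarrow>
      act (\<sigma> \<circ> \<tau>) a = act \<sigma> (act \<tau> a)"
    and act_id: "\<And>a. a \<in> carrier G \<Longrightarrow> act id a = a"
    and act_faithful: "\<And>\<sigma>. \<sigma> permutes {1..M} \<Longrightarrow> (\<And>a. a \<in> carrier G \<Longrightarrow> act \<sigma> a = a) \<Longrightarrow> \<sigma> = id"
    and c: "c permutes {1..M}" and t: "t permutes {1..M}"
    and generate_all: "\<And>H. subgroup H (sym_group M) \<Longrightarrow> c \<in> H \<Longrightarrow> t \<in> H \<Longrightarrow> H = carrier (sym_group M)"
    and act_c: "\<And>a. a \<in> W \<Longrightarrow> \<gamma> (shift a) = act c (\<gamma> a)"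
    and act_t: "\<And>a. a \<in> W \<Longrightarrow> \<gamma> (T (cvec N 0) a) = act t (\<gamma> a)"
begin

lemma \<gamma>G: "a \<in> W \<Longrightarrow> \<gamma> a \<in> carrier G"
  using \<gamma> by (auto simp: iso_def hom_def)

lemma act_inv:
  assumes "\<sigma> permutes {1..M}" "a \<in> carrier G"
  shows "act \<sigma> (act (inv' \<sigma>) a) = a" "act (inv' \<sigma>) (act \<sigma> a) = a"
  using act_comp[OF assms(1) permutes_inv[OF assms(1)] assms(2)] act_comp[OF permutes_inv[OF assms(1)] assms(1,2)]
    act_id assms(2) permutes_inv_o[OF assms(1)] by simp_all

definition perm_mat :: "(bit vec \<Rightarrow> 'g) \<Rightarrow> (nat \<Rightarrow> nat) \<Rightarrow> bit mat" where
  "perm_mat \<phi> \<sigma> = matrix_via (N - 1) \<phi> (act \<sigma>)"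

lemma perm_mat_mult_vec:
  "\<phi> \<in> iso (vec_space_F2 (N - 1)) G \<Longrightarrow> \<sigma> permutes {1..M} \<Longrightarrow> x \<in> carrier_vec (N - 1) \<Longrightarrow>
     \<phi> (perm_mat \<phi> \<sigma> *\<^sub>v x) = act \<sigma> (\<phi> x)"
  unfolding perm_mat_def by (rule matrix_via_mult[OF group_G _ act_hom])

lemma perm_mat_eqI:
  "\<phi> \<in> iso (vec_space_F2 (N - 1)) G \<Longrightarrow> A \<in> carrier_mat (N - 1) (N - 1) \<Longrightarrow>
     (\<And>x. x \<in> carrier_vec (N - 1) \<Longrightarrow> \<phi> (A *\<^sub>v x) = act \<sigma> (\<phi> x)) \<Longrightarrow> perm_mat \<phi> \<sigma> = A"
  unfolding perm_mat_def by (rule matrix_via_unique[OF isoD(1)])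

lemma perm_mat_hom:
  assumes \<phi>: "\<phi> \<in> iso (vec_space_F2 (N - 1)) G"
  shows "perm_mat \<phi> \<in> hom (sym_group M) GL"
proof (rule homI)
  fix \<sigma> assume "\<sigma> \<in> carrier (sym_group M)"
  then have \<sigma>: "\<sigma> permutes {1..M}" by (simp add: sym_group_carrier)
  show "perm_mat \<phi> \<sigma> \<in> carrier GL"
    unfolding perm_mat_def
    by (rule matrix_via_GL[OF group_G \<phi> act_hom[OF \<sigma>] act_hom[OF permutes_inv[OF \<sigma>]]]) (use act_inv[OF \<sigma>] in auto)
  fix \<tau> assume "\<tau> \<in> carrier (sym_group M)"
  then have \<tau>: "\<tau> permutes {1..M}" by (simp add: sym_group_carrier)
  have m: "perm_mat \<phi> p \<in> carrier_mat (N - 1) (N - 1)" for p by (simp add: perm_mat_def)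
  have "perm_mat \<phi> (\<sigma> \<circ> \<tau>) = perm_mat \<phi> \<sigma> * perm_mat \<phi> \<tau>"
  proof (rule perm_mat_eqI[OF \<phi>])
    show "perm_mat \<phi> \<sigma> * perm_mat \<phi> \<tau> \<in> carrier_mat (N - 1) (N - 1)" by (rule mult_carrier_mat[OF m m])
    fix x :: "bit vec" assume x: "x \<in> carrier_vec (N - 1)"
    have "\<phi> (perm_mat \<phi> \<sigma> * perm_mat \<phi> \<tau> *\<^sub>v x) = \<phi> (perm_mat \<phi> \<sigma> *\<^sub>v (perm_mat \<phi> \<tau> *\<^sub>v x))"
      by (simp only: assoc_mult_mat_vec[OF m m x])
    also have "\<dots> = act \<sigma> (act \<tau> (\<phi> x))"
      by (simp only: perm_mat_mult_vec[OF \<phi> \<sigma> mult_mat_vec_carrier[OF m x]] perm_mat_mult_vec[OF \<phi> \<tau> x])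
    finally show "\<phi> (perm_mat \<phi> \<sigma> * perm_mat \<phi> \<tau> *\<^sub>v x) = act (\<sigma> \<circ> \<tau>) (\<phi> x)"
      by (simp only: act_comp[OF \<sigma> \<tau> isoD(2)[OF \<phi> x]])
  qed
  then show "perm_mat \<phi> (\<sigma> \<otimes>\<^bsub>sym_group M\<^esub> \<tau>) = perm_mat \<phi> \<sigma> \<otimes>\<^bsub>GL\<^esub> perm_mat \<phi> \<tau>"
    by (simp add: sym_group_mult)
qed

lemma perm_mat_inj:
  assumes \<phi>: "\<phi> \<in> iso (vec_space_F2 (N - 1)) G"
  shows "inj_on (perm_mat \<phi>) (carrier (sym_group M))"
proof (rule inj_onI)
  fix \<sigma> \<tau> assume "\<sigma> \<in> carrier (sym_group M)" "\<tau> \<in> carrier (sym_group M)" and eq: "perm_mat \<phi> \<sigma> = perm_mat \<phi> \<tau>"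
  then have \<sigma>: "\<sigma> permutes {1..M}" and \<tau>: "\<tau> permutes {1..M}" by (simp_all add: sym_group_carrier)
  have same: "act \<sigma> a = act \<tau> a" if a: "a \<in> carrier G" for a
    using perm_mat_mult_vec[OF \<phi> \<sigma> isoD(7)[OF \<phi> a]] perm_mat_mult_vec[OF \<phi> \<tau> isoD(7)[OF \<phi> a]] eq
      isoD(5)[OF \<phi> a] by simp
  have "inv' \<tau> \<circ> \<sigma> = id"
  proof (rule act_faithful)
    show "inv' \<tau> \<circ> \<sigma> permutes {1..M}" by (rule permutes_compose[OF \<sigma> permutes_inv[OF \<tau>]])
    show "act (inv' \<tau> \<circ> \<sigma>) a = a" if a: "a \<in> carrier G" for a
      using act_comp[OF permutes_inv[OF \<tau>] \<sigma> a] same[OF a] act_inv(2)[OF \<tau> a] by simp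
  qed
  then have "\<tau> \<circ> (inv' \<tau> \<circ> \<sigma>) = \<tau>" by simp
  then show "\<sigma> = \<tau>" using permutes_inv_o(1)[OF \<tau>] by (simp add: o_assoc)
qed

text \<open>The generators correspond to \<open>t \<circ> c\<close> and \<open>c\<close>. As
  \<open>t\<close> is recovered from them, they generate the whole symmetric group, and faithfulness
  makes the map to matrices injective.\<close>

theorem MD_iso_sym_group: "MD_F2 (N - 1) \<cong> sym_group M"
proof -
  define \<phi> where "\<phi> = \<gamma> \<circ> vecs"
  have \<phi>: "\<phi> \<in> iso (vec_space_F2 (N - 1)) G"
    unfolding \<phi>_def by (rule iso_set_trans[OF vecs_iso \<gamma>])
  have tc: "t \<circ> c permutes {1..M}" by (rule permutes_compose[OF c t])
  have B: "perm_mat \<phi> c = matB"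
    by (rule perm_mat_eqI[OF \<phi>]) (auto simp: \<phi>_def vecs_B act_c vecs_W)
  have A: "perm_mat \<phi> (t \<circ> c) = matA"
    by (rule perm_mat_eqI[OF \<phi>])
       (auto simp: \<phi>_def vecs_A act_c act_t vecs_W shift_W act_comp[OF t c] \<gamma>G)
  interpret h: group_hom "sym_group M" GL "perm_mat \<phi>"
    using perm_mat_hom[OF \<phi>] sym_group_is_group GL_group by (simp add: group_hom_def group_hom_axioms_def)
  have in_sym: "{t \<circ> c, c} \<subseteq> carrier (sym_group M)" using c tc by (simp add: sym_group_carrier)
  let ?H = "generate (sym_group M) {t \<circ> c, c}"
  have H: "subgroup ?H (sym_group M)" by (rule h.G.generate_is_subgroup[OF in_sym])
  have cH: "c \<in> ?H" "t \<circ> c \<in> ?H" by (auto intro: generate.incl)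
  have "inv' c \<in> ?H"
    using subgroup.m_inv_closed[OF H cH(1)] subgroup.mem_carrier[OF H cH(1)] by simp
  then have "(t \<circ> c) \<circ> inv' c \<in> ?H"
    using subgroup.m_closed[OF H cH(2)] by (simp add: sym_group_mult)
  then have "t \<in> ?H" using permutes_inv_o(1)[OF c] by (simp add: comp_assoc)
  then have H_all: "?H = carrier (sym_group M)" using generate_all[OF H cH(1)] by blast
  have "perm_mat \<phi> ` carrier (sym_group M) = MD_set"
    unfolding H_all[symmetric] MD_set_def h.generate_img[OF in_sym, symmetric] by (simp add: A B)
  then have "perm_mat \<phi> \<in> iso (sym_group M) (GL\<lparr>carrier := MD_set\<rparr>)"
    using perm_mat_hom[OF \<phi>] perm_mat_inj[OF \<phi>] by (auto simp: iso_def hom_def bij_betw_def)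
  then have "sym_group M \<cong> MD_F2 (N - 1)" unfolding MD_eq' by (rule is_isoI)
  then show ?thesis by (rule group.iso_sym[OF sym_group_is_group])
qed

text \<open>The counterpart of \<open>MD_vectors\<close>, with permutations in place of members of
  the monodromy group. It serves to show that every isometry of certain models is a
  permutation.\<close>

definition perm_vectors :: "(int \<Rightarrow> bit) set" where
  "perm_vectors = {r \<in> Q.nonsing N W. \<exists>\<sigma>. \<sigma> permutes {1..M} \<and> (\<forall>a\<in>W. \<gamma> (T r a) = act \<sigma> (\<gamma> a))}"

lemma monodromy_closed_perm_vectors: "monodromy_closed perm_vectors"
  unfolding monodromy_closed_def Q.trv_closed_def
proof (intro conjI ballI impI)
  show "cvec N 0 \<in> perm_vectors"
    using t act_t cvec_W q_cvec_0 by (auto simp: perm_vectors_def Q.nonsing_def)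
next
  fix r assume "r \<in> perm_vectors"
  then obtain \<sigma> where r: "r \<in> W" "qform N r = 1" and \<sigma>: "\<sigma> permutes {1..M}" "\<And>a. a \<in> W \<Longrightarrow> \<gamma> (T r a) = act \<sigma> (\<gamma> a)"
    by (auto simp: perm_vectors_def Q.nonsing_def)
  let ?\<tau> = "c \<circ> (\<sigma> \<circ> inv' c)"
  have \<sigma>c: "\<sigma> \<circ> inv' c permutes {1..M}" by (rule permutes_compose[OF permutes_inv[OF c] \<sigma>(1)])
  have "\<gamma> (T (shift r) a) = act ?\<tau> (\<gamma> a)" if a: "a \<in> W" for a
  proof -
    let ?b = "unshift a"
    have b: "?b \<in> W" by (rule shift_W(2)[OF a])
    have "T (shift r) a = T (shift r) (shift ?b)" by simp
    also have "\<dots> = shift (T r ?b)" unfolding Q.trv_def B_shift[OF b r(1)] by (simp add: shift_add)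
    finally have "\<gamma> (T (shift r) a) = act c (act \<sigma> (\<gamma> ?b))"
      using act_c[OF T_W[OF r(1) b]] \<sigma>(2)[OF b] by simp
    moreover have "\<gamma> ?b = act (inv' c) (\<gamma> a)"
      using act_c[OF b] act_inv(2)[OF c \<gamma>G[OF b]] by simp
    ultimately show ?thesis
      using act_comp[OF c \<sigma>c \<gamma>G[OF a]] act_comp[OF \<sigma>(1) permutes_inv[OF c] \<gamma>G[OF a]] by simp
  qed
  moreover have "?\<tau> permutes {1..M}" by (rule permutes_compose[OF \<sigma>c c])
  ultimately show "shift r \<in> perm_vectors"
    using r shift_W q_shift by (auto simp: perm_vectors_def Q.nonsing_def)
next
  fix r s assume "r \<in> perm_vectors" "s \<in> perm_vectors" and rs: "bform N r s = 1"
  then obtain \<sigma> \<tau> where r: "r \<in> W" "qform N r = 1" and s: "s \<in> W" "qform N s = 1"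
    and \<sigma>: "\<sigma> permutes {1..M}" "\<And>a. a \<in> W \<Longrightarrow> \<gamma> (T r a) = act \<sigma> (\<gamma> a)"
    and \<tau>: "\<tau> permutes {1..M}" "\<And>a. a \<in> W \<Longrightarrow> \<gamma> (T s a) = act \<tau> (\<gamma> a)"
    by (auto simp: perm_vectors_def Q.nonsing_def)
  have \<tau>\<sigma>: "\<tau> \<circ> \<sigma> permutes {1..M}" by (rule permutes_compose[OF \<sigma>(1) \<tau>(1)])
  have "\<gamma> (T (r + s) a) = act (\<sigma> \<circ> (\<tau> \<circ> \<sigma>)) (\<gamma> a)" if a: "a \<in> W" for a
    using a r s \<sigma> \<tau> act_comp[OF \<sigma>(1) \<tau>\<sigma> \<gamma>G[OF a]] act_comp[OF \<tau>(1) \<sigma>(1) \<gamma>G[OF a]]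
    by (simp add: Q.trv_of_sum[OF rs] T_W)
  moreover have "\<sigma> \<circ> (\<tau> \<circ> \<sigma>) permutes {1..M}" by (rule permutes_compose[OF \<tau>\<sigma> \<sigma>(1)])
  moreover have "r + s \<in> W" "qform N (r + s) = 1" using r s rs W_subsp by (simp_all add: Q.q_add)
  ultimately show "r + s \<in> perm_vectors" by (auto simp: perm_vectors_def Q.nonsing_def)
qed (auto simp: perm_vectors_def Q.nonsing_def)

lemma trvs_perm:
  assumes "set rs \<subseteq> perm_vectors"
  shows "\<exists>\<sigma>. \<sigma> permutes {1..M} \<and> (\<forall>a\<in>W. \<gamma> (Q.trvs N rs a) = act \<sigma> (\<gamma> a))"
  using assms
proof (induction rs)
  case Nil
  have "\<gamma> (Q.trvs N [] a) = act id (\<gamma> a)" if "a \<in> W" for a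
    by (simp only: Q.trvs_simps act_id[OF \<gamma>G[OF that]])
  then show ?case using permutes_id by blast
next
  case (Cons r rs)
  then obtain \<tau> where \<tau>: "\<tau> permutes {1..M}" "\<forall>a\<in>W. \<gamma> (Q.trvs N rs a) = act \<tau> (\<gamma> a)" by auto
  obtain \<sigma> where \<sigma>: "\<sigma> permutes {1..M}" "\<forall>a\<in>W. \<gamma> (T r a) = act \<sigma> (\<gamma> a)"
    using Cons by (auto simp: perm_vectors_def)
  have sub: "set rs \<subseteq> Q.nonsing N W" using Cons by (auto simp: perm_vectors_def)
  have "\<gamma> (Q.trvs N (r # rs) a) = act (\<sigma> \<circ> \<tau>) (\<gamma> a)" if a: "a \<in> W" for a
    using \<sigma>(2) \<tau>(2) a Q.trvs_closed[OF W_form(2) sub a] act_comp[OF \<sigma>(1) \<tau>(1) \<gamma>G[OF a]] by simp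
  moreover have "\<sigma> \<circ> \<tau> permutes {1..M}" by (rule permutes_compose[OF \<tau>(1) \<sigma>(1)])
  ultimately show ?case by blast
qed

text \<open>Surjectivity: an isometry is a product of transvections in non-singular vectors, and
  each of these acts as a permutation by \<open>all\<close>.\<close>

theorem perm_mat_iso_isometry_group:
  fixes Qf :: "'g \<Rightarrow> bit"
  assumes gen: "Q.gen_by_trv N W" and all: "Q.nonsing N W \<subseteq> perm_vectors"
    and Q\<gamma>: "\<And>a. a \<in> W \<Longrightarrow> Qf (\<gamma> a) = qform N a"
    and Qact: "\<And>\<sigma> a. \<sigma> permutes {1..M} \<Longrightarrow> a \<in> carrier G \<Longrightarrow> Qf (act \<sigma> a) = Qf a"
    and \<phi>: "\<phi> \<in> iso (vec_space_F2 (N - 1)) G" and QF: "\<And>x. x \<in> carrier_vec (N - 1) \<Longrightarrow> Qf (\<phi> x) = F x"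
  shows "perm_mat \<phi> \<in> iso (sym_group M) (isometry_group (N - 1) F)"
proof -
  have m: "perm_mat \<phi> p \<in> carrier_mat (N - 1) (N - 1)" for p by (simp add: perm_mat_def)
  have into: "perm_mat \<phi> \<sigma> \<in> carrier (isometry_group (N - 1) F)" if "\<sigma> \<in> carrier (sym_group M)" for \<sigma>
  proof -
    have \<sigma>: "\<sigma> permutes {1..M}" using that by (simp add: sym_group_carrier)
    have "F (perm_mat \<phi> \<sigma> *\<^sub>v x) = F x" if x: "x \<in> carrier_vec (N - 1)" for x
      using QF[OF mult_mat_vec_carrier[OF m x]] QF[OF x] perm_mat_mult_vec[OF \<phi> \<sigma> x]
        Qact[OF \<sigma> isoD(2)[OF \<phi> x]] by metis
    moreover have "perm_mat \<phi> \<sigma> \<in> carrier GL" using perm_mat_hom[OF \<phi>] that by (auto simp: hom_def)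
    ultimately show ?thesis by (simp add: isometry_group_def)
  qed
  \<comment> \<open>\<open>\<phi>\<close> is an arbitrary choice of coordinates on \<open>G\<close>;
    going back along \<open>\<gamma>\<close> gives the compatible ones on \<open>W\<close>, where
    the transvections live.\<close>
  define \<psi> where "\<psi> = inv_into W \<gamma> \<circ> \<phi>"
  have \<psi>: "\<psi> \<in> iso (vec_space_F2 (N - 1)) (periodic_group N)"
    unfolding \<psi>_def using iso_set_trans[OF \<phi> group.iso_set_sym[OF periodic_group \<gamma>]] by simp
  have bij: "bij_betw \<gamma> W (carrier G)" using \<gamma> by (simp add: iso_def)
  have \<gamma>\<psi>: "\<gamma> (\<psi> x) = \<phi> x" if "x \<in> carrier_vec (N - 1)" for x
    unfolding \<psi>_def comp_apply by (rule bij_betw_inv_into_right[OF bij isoD(2)[OF \<phi> that]])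
  have \<psi>W: "\<psi> x \<in> W" if "x \<in> carrier_vec (N - 1)" for x using isoD(2)[OF \<psi> that] by simp
  have surj: "\<exists>\<sigma>\<in>carrier (sym_group M). perm_mat \<phi> \<sigma> = g" if g: "g \<in> carrier (isometry_group (N - 1) F)" for g
  proof -
    have gGL: "g \<in> carrier GL" and gF: "\<And>x. x \<in> carrier_vec (N - 1) \<Longrightarrow> F (g *\<^sub>v x) = F x"
      using g by (auto simp: isometry_group_def)
    have gm: "g \<in> carrier_mat (N - 1) (N - 1)" using gGL by (simp add: GL_carrier)
    have q\<psi>: "qform N (\<psi> x) = F x" if x: "x \<in> carrier_vec (N - 1)" for x
      using Q\<gamma>[OF \<psi>W[OF x]] \<gamma>\<psi>[OF x] QF[OF x] by simp
    have "g \<in> carrier (isometry_group (N - 1) (\<lambda>x. qform N (\<psi> x)))"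
      using gGL gF q\<psi> mult_mat_vec_carrier[OF gm] by (simp add: isometry_group_def)
    then obtain rs where rs: "set rs \<subseteq> Q.nonsing N W"
        "\<And>x. x \<in> carrier_vec (N - 1) \<Longrightarrow> \<psi> (g *\<^sub>v x) = Q.trvs N rs (\<psi> x)"
      using isometry_is_trvs[OF gen _ \<psi>] by blast
    obtain \<sigma> where \<sigma>: "\<sigma> permutes {1..M}" "\<forall>a\<in>W. \<gamma> (Q.trvs N rs a) = act \<sigma> (\<gamma> a)"
      using trvs_perm[of rs] rs(1) all by blast
    have "perm_mat \<phi> \<sigma> = g"
    proof (rule perm_mat_eqI[OF \<phi> gm])
      fix x :: "bit vec" assume x: "x \<in> carrier_vec (N - 1)"
      have "\<phi> (g *\<^sub>v x) = \<gamma> (\<psi> (g *\<^sub>v x))" using \<gamma>\<psi>[OF mult_mat_vec_carrier[OF gm x]] by simp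
      also have "\<dots> = act \<sigma> (\<gamma> (\<psi> x))" using rs(2)[OF x] \<sigma>(2) \<psi>W[OF x] by simp
      finally show "\<phi> (g *\<^sub>v x) = act \<sigma> (\<phi> x)" using \<gamma>\<psi>[OF x] by simp
    qed
    then show ?thesis using \<sigma>(1) by (auto simp: sym_group_carrier)
  qed
  have "perm_mat \<phi> \<in> hom (sym_group M) (isometry_group (N - 1) F)"
    using perm_mat_hom[OF \<phi>] into by (auto simp: hom_def isometry_group_def)
  then show ?thesis
    using perm_mat_inj[OF \<phi>] into surj by (auto simp: iso_def bij_betw_def)
qed

end

declare One_nat_def [simp]

section \<open>Coordinate permutations of binary vectors\<close>

definition weight :: "nat \<Rightarrow> bit vec \<Rightarrow> nat" where
  "weight M x = (\<Sum>i<M. of_bool (x $ i = 1))"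

lemma sum_bit_eq_weight: "(\<Sum>i<M. x $ i) = (of_nat (weight M x) :: bit)"
proof -
  have *: "of_nat (of_bool (b = 1)) = (b :: bit)" for b by (cases b) auto
  show ?thesis unfolding weight_def of_nat_sum by (simp only: *)
qed

text \<open>The form counts the pairs \<open>i \<le> j\<close> inside the support of
  \<open>x\<close>. Depending on the weight alone, it is invariant under coordinate
  permutations.\<close>

lemma quad_eq_weight: "quad M x = of_nat (weight M x * (weight M x + 1) div 2)"
proof (induction M)
  case (Suc M)
  have "(\<Sum>j = i..<Suc M. x $ i * x $ j) = (\<Sum>j = i..<M. x $ i * x $ j) + x $ i * x $ M" if "i < M" for i
    using that by (simp add: add.commute)
  then have "(\<Sum>i<M. \<Sum>j = i..<Suc M. x $ i * x $ j) = quad M x + (\<Sum>i<M. x $ i) * x $ M"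
    by (simp add: quad_def sum.distrib sum_distrib_right)
  then have "quad (Suc M) x = quad M x + of_nat (weight M x) * x $ M + x $ M"
    by (simp add: quad_def sum_bit_eq_weight)
  moreover have "(weight M x + 1) * (weight M x + 1 + 1) div 2 = weight M x * (weight M x + 1) div 2 + (weight M x + 1)"
  proof -
    have "(weight M x + 1) * (weight M x + 1 + 1) = weight M x * (weight M x + 1) + 2 * (weight M x + 1)"
      by (simp add: algebra_simps)
    then show ?thesis by simp
  qed
  ultimately show ?case using Suc by (cases "x $ M") (auto simp: weight_def add_ac)
qed (simp add: quad_def weight_def)

lemma coord_perm_carrier [simp]: "coord_perm M \<sigma> x \<in> carrier_vec M"
  by (simp add: coord_perm_def)

lemma coord_perm_index: "i < M \<Longrightarrow> coord_perm M \<sigma> x $ i = x $ (inv' \<sigma> (i + 1) - 1)"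
  by (simp add: coord_perm_def)

lemma coord_perm_index_bij:
  fixes M :: nat
  assumes "\<sigma> permutes {1..M}"
  shows "bij_betw (\<lambda>i. inv' \<sigma> (i + 1) - 1) {..<M} {..<M}"
proof -
  have 1: "bij_betw (\<lambda>i. i + 1) {..<M} {1..M}"
    by (rule bij_betw_byWitness[of _ "\<lambda>i. i - 1"]) auto
  have 2: "bij_betw (inv' \<sigma>) {1..M} {1..M}" by (rule permutes_imp_bij[OF permutes_inv[OF assms]])
  have 3: "bij_betw (\<lambda>i. i - 1) {1..M} {..<M}"
    by (rule bij_betw_byWitness[of _ "\<lambda>i. i + 1"]) auto
  show ?thesis using bij_betw_trans[OF bij_betw_trans[OF 1 2] 3] by (simp add: comp_def)
qed

lemma coord_perm_index_less:
  fixes M :: nat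
  assumes "\<sigma> permutes {1..M}" "i < M"
  shows "inv' \<sigma> (i + 1) - 1 < M" "inv' \<sigma> (i + 1) - 1 + 1 = inv' \<sigma> (i + 1)"
proof -
  have "inv' \<sigma> (i + 1) \<in> {1..M}" using permutes_in_image[OF permutes_inv[OF assms(1)], of "i + 1"] assms(2) by simp
  then show "inv' \<sigma> (i + 1) - 1 < M" "inv' \<sigma> (i + 1) - 1 + 1 = inv' \<sigma> (i + 1)" by auto
qed

lemma coord_perm_add:
  assumes "\<sigma> permutes {1..M}" "x \<in> carrier_vec M" "y \<in> carrier_vec M"
  shows "coord_perm M \<sigma> (x + y) = coord_perm M \<sigma> x + coord_perm M \<sigma> y"
  by (rule eq_vecI) (use assms coord_perm_index_less(1)[OF assms(1)] in \<open>auto simp: coord_perm_def\<close>)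

lemma coord_perm_comp:
  assumes "\<sigma> permutes {1..M}" "\<tau> permutes {1..M}"
  shows "coord_perm M (\<sigma> \<circ> \<tau>) x = coord_perm M \<sigma> (coord_perm M \<tau> x)"
proof (rule eq_vecI)
  fix i assume "i < dim_vec (coord_perm M \<sigma> (coord_perm M \<tau> x))"
  then have i: "i < M" by (simp add: coord_perm_def)
  have "inv' (\<sigma> \<circ> \<tau>) (i + 1) = inv' \<tau> (inv' \<sigma> (i + 1))"
    using o_inv_distrib[OF permutes_bij[OF assms(1)] permutes_bij[OF assms(2)]] by (simp add: comp_def)
  then show "coord_perm M (\<sigma> \<circ> \<tau>) x $ i = coord_perm M \<sigma> (coord_perm M \<tau> x) $ i"
    using coord_perm_index_less[OF assms(1) i] i by (simp only: coord_perm_index)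
qed (simp add: coord_perm_def)

lemma coord_perm_id: "x \<in> carrier_vec M \<Longrightarrow> coord_perm M id x = x"
  by (rule eq_vecI) (auto simp: coord_perm_def inv_id)

lemma coord_perm_ones: "\<sigma> permutes {1..M} \<Longrightarrow> coord_perm M \<sigma> (ones_vec M) = ones_vec M"
proof (rule eq_vecI)
  fix i assume \<sigma>: "\<sigma> permutes {1..M}" and "i < dim_vec (ones_vec M)"
  then have i: "i < M" by (simp add: ones_vec_def)
  show "coord_perm M \<sigma> (ones_vec M) $ i = ones_vec M $ i"
    using coord_perm_index_less(1)[OF \<sigma> i] i by (simp only: coord_perm_index ones_vec_def index_vec)
qed (simp add: coord_perm_def ones_vec_def)

lemma weight_coord_perm:
  assumes "\<sigma> permutes {1..M}"
  shows "weight M (coord_perm M \<sigma> x) = weight M x"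
proof -
  have "weight M (coord_perm M \<sigma> x) = (\<Sum>i<M. of_bool (x $ (inv' \<sigma> (i + 1) - 1) = 1))"
    unfolding weight_def by (rule sum.cong) (simp_all add: coord_perm_index)
  also have "\<dots> = weight M x"
    unfolding weight_def by (rule sum.reindex_bij_betw[OF coord_perm_index_bij[OF assms]])
  finally show ?thesis .
qed

lemma sum_zero_space_simps [simp]:
  "x \<in> carrier (sum_zero_space M) \<longleftrightarrow> x \<in> carrier_vec M \<and> even (weight M x)"
  "mult (sum_zero_space M) = (+)" "one (sum_zero_space M) = 0\<^sub>v M"
  by (auto simp: sum_zero_space_def sum_bit_eq_weight of_nat_bit)

lemma even_weight_add:
  "x \<in> carrier_vec M \<Longrightarrow> y \<in> carrier_vec M \<Longrightarrow> even (weight M x) \<Longrightarrow> even (weight M y) \<Longrightarrow> even (weight M (x + y))"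
proof -
  assume *: "x \<in> carrier_vec M" "y \<in> carrier_vec M" "even (weight M x)" "even (weight M y)"
  then have "(\<Sum>i<M. (x + y) $ i) = (\<Sum>i<M. x $ i) + (\<Sum>i<M. y $ i)" by (simp add: sum.distrib)
  then have "(of_nat (weight M (x + y)) :: bit) = of_nat (weight M x) + of_nat (weight M y)"
    by (simp only: sum_bit_eq_weight)
  then have "(of_nat (weight M (x + y)) :: bit) = 0" using * by (simp add: of_nat_bit)
  then show ?thesis by (simp add: of_nat_bit split: if_splits)
qed

lemma comm_group_sum_zero_space: "comm_group (sum_zero_space M)"
proof (rule comm_groupI)
  fix x assume "x \<in> carrier (sum_zero_space M)"
  then show "\<exists>y\<in>carrier (sum_zero_space M). y \<otimes>\<^bsub>sum_zero_space M\<^esub> x = \<one>\<^bsub>sum_zero_space M\<^esub>"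
    by (intro bexI[of _ x]) (auto simp: vec_add_self_bit)
qed (auto simp: even_weight_add comm_add_vec, auto simp: weight_def)

lemma coord_perm_hom:
  assumes "\<sigma> permutes {1..M}"
  shows "coord_perm M \<sigma> \<in> hom (sum_zero_space M) (sum_zero_space M)"
  using assms by (auto simp: hom_def weight_coord_perm coord_perm_add)

text \<open>If position \<open>i\<close> receives the entry of another position \<open>i'\<close>,
  then a vector supported on \<open>i\<close> and a third position \<open>k\<close> loses its entry
  at \<open>i\<close>. Weight 2 keeps it in the sum-zero space.\<close>

lemma coord_perm_moves:
  assumes \<sigma>: "\<sigma> permutes {1..M}" "\<sigma> \<noteq> id" and M: "M \<ge> 3"
  obtains x i where "x \<in> carrier_vec M" "weight M x = 2" "i < M" "x $ i = 1" "coord_perm M \<sigma> x $ i = 0"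
proof -
  have "inv' \<sigma> \<noteq> id" using \<sigma> by (metis inv_inv_eq permutes_bij inv_id)
  then obtain j where j: "inv' \<sigma> j \<noteq> j" by (auto simp: fun_eq_iff)
  then have j1: "j \<in> {1..M}" using permutes_not_in[OF permutes_inv[OF \<sigma>(1)]] by blast
  define i where "i = j - 1"
  have i: "i < M" "i + 1 = j" using j1 by (auto simp: i_def)
  define i' where "i' = inv' \<sigma> (i + 1) - 1"
  have i': "i' < M" "i' \<noteq> i" using coord_perm_index_less[OF \<sigma>(1) i(1)] j i by (auto simp: i'_def)
  have "\<exists>k. k < M \<and> k \<noteq> i \<and> k \<noteq> i'"
  proof -
    have "{..<M} - {i, i'} \<noteq> {}"
    proof
      assume "{..<M} - {i, i'} = {}"
      then have "card {..<M} \<le> card {i, i'}" by (intro card_mono) auto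
      then show False using M card_insert_le_m1[of 2 "{i'}" i] i' by simp
    qed
    then show ?thesis by blast
  qed
  then obtain k where k: "k < M" "k \<noteq> i" "k \<noteq> i'" by blast
  define x :: "bit vec" where "x = vec M (\<lambda>l. if l = i \<or> l = k then 1 else 0)"
  have "weight M x = (\<Sum>l<M. of_bool (l = i) + of_bool (l = k))"
    unfolding weight_def using k by (intro sum.cong) (auto simp: x_def)
  also have "\<dots> = 2" using i k by (simp add: sum.distrib of_bool_def sum.delta)
  finally have "weight M x = 2" .
  moreover have "coord_perm M \<sigma> x $ i = x $ i'" using coord_perm_index[OF i(1)] by (simp only: i'_def)
  then have "coord_perm M \<sigma> x $ i = 0" using i' k by (simp add: x_def)
  ultimately show thesis using that[of x i] i by (simp add: x_def)
qed

context odd_period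
begin

text \<open>One period, read at 0, ..., \<open>N - 1\<close>; for \<open>M = N + 1\<close> a zero is
  appended.\<close>

definition restr :: "nat \<Rightarrow> (int \<Rightarrow> bit) \<Rightarrow> bit vec" where
  "restr M a = vec M (\<lambda>i. if i < N then a (int i) else 0)"

lemma restr_carrier [simp]: "restr M a \<in> carrier_vec M"
  by (simp add: restr_def)

lemma restr_add: "restr M (a + b) = restr M a + restr M b"
  by (rule eq_vecI) (auto simp: restr_def)

lemma eq_on_period: "a \<in> W \<Longrightarrow> b \<in> W \<Longrightarrow> (\<And>i. i < N \<Longrightarrow> a (int i) = b (int i)) \<Longrightarrow> a = b"
proof
  fix j assume ab: "a \<in> W" "b \<in> W" and eq: "\<And>i. i < N \<Longrightarrow> a (int i) = b (int i)"
  have "a (j mod int N) = b (j mod int N)" using eq[of "nat (j mod int N)"] N_pos by (simp add: nat_less_iff)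
  then show "a j = b j" using periodic_mod W_periodic ab by metis
qed

lemma restr_inj: "M \<ge> N \<Longrightarrow> inj_on (restr M) W"
proof (rule inj_onI)
  fix a b assume *: "M \<ge> N" "a \<in> W" "b \<in> W" "restr M a = restr M b"
  have "a (int i) = b (int i)" if "i < N" for i
    using arg_cong[OF *(4), of "\<lambda>v. v $ i"] that *(1) by (simp add: restr_def)
  then show "a = b" using eq_on_period *(2,3) by blast
qed

lemma sum_restr:
  assumes "M \<ge> N"
  shows "(\<Sum>i<M. restr M a $ i) = (\<Sum>i\<in>{0..<int N}. a i)"
proof -
  have "(\<Sum>i<M. restr M a $ i) = (\<Sum>i<M. if i < N then a (int i) else 0)"
    by (rule sum.cong) (auto simp: restr_def)
  also have "\<dots> = (\<Sum>i<N. a (int i))"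
    using assms by (intro sum.mono_neutral_cong_right) auto
  also have "\<dots> = (\<Sum>i\<in>{0..<int N}. a i)"
    by (rule sum.reindex_bij_witness[of _ nat int]) auto
  finally show ?thesis .
qed

lemma even_weight_restr: "M \<ge> N \<Longrightarrow> a \<in> W \<Longrightarrow> even (weight M (restr M a))"
  using sum_restr[of M a] by (auto simp: sum_bit_eq_weight of_nat_bit sum_zero_periodic_def split: if_splits)

lemma restr_hom: "M \<ge> N \<Longrightarrow> restr M \<in> hom (periodic_group N) (sum_zero_space M)"
  by (auto simp: hom_def restr_add even_weight_restr)

lemma restr_range:
  assumes M: "M \<ge> N" and x: "x \<in> carrier_vec M" "even (weight M x)" and zero: "\<And>i. N \<le> i \<Longrightarrow> i < M \<Longrightarrow> x $ i = 0"
  obtains a where "a \<in> W" "restr M a = x"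
proof -
  define a where "a = (\<lambda>j. x $ nat (j mod int N))"
  have per: "periodic N a" by (simp add: periodic_def a_def)
  have r: "restr M a = x"
    by (rule eq_vecI) (use x zero in \<open>auto simp: restr_def a_def mod_pos_pos_trivial\<close>)
  have "(\<Sum>i\<in>{0..<int N}. a i) = 0"
    using sum_restr[OF M, of a] x unfolding r by (simp add: sum_bit_eq_weight of_nat_bit)
  then have "a \<in> W" using per by (simp add: sum_zero_periodic_def)
  then show thesis using that r by blast
qed

lemma restr_shift:
  assumes "M \<ge> N" "a \<in> W"
  shows "restr M (shift a) = coord_perm M (cycle_perm N) (restr M a)"
proof (rule eq_vecI)
  fix i assume "i < dim_vec (coord_perm M (cycle_perm N) (restr M a))"
  then have i: "i < M" by (simp add: coord_perm_def)
  have last: "a (- 1) = a (int (N - 1))"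
  proof -
    have "int (N - 1) = - 1 + int N" using N_gt_1 by linarith
    then show ?thesis using W_periodic[OF assms(2)] by (simp only: periodic_def)
  qed
  have "coord_perm M (cycle_perm N) (restr M a) $ i = restr M a $ (inv_cycle_perm N (i + 1) - 1)"
    using coord_perm_index[OF i] by (simp only: inv_cycle_perm)
  also have "\<dots> = restr M (shift a) $ i"
  proof -
    consider "i = 0" | "0 < i" "i < N" | "N \<le> i" by linarith
    then show ?thesis
    proof cases
      case 1
      have "inv_cycle_perm N 1 = N" using N_pos by (simp add: inv_cycle_perm_def)
      moreover have "N - 1 < M" "N - 1 < N" using assms N_pos by auto
      ultimately show ?thesis using 1 i last N_pos by (simp add: restr_def shift_def)
    next
      case 2
      then have "inv_cycle_perm N (i + 1) = i" by (simp add: inv_cycle_perm_def)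
      moreover have "int (i - 1) = int i - 1" "i - 1 < M" "i - 1 < N" using 2 i by auto
      ultimately show ?thesis using 2 i by (simp add: restr_def shift_def)
    next
      case 3
      then have "inv_cycle_perm N (i + 1) = i + 1" by (simp add: inv_cycle_perm_def)
      then show ?thesis using 3 i by (simp add: restr_def)
    qed
  qed
  finally show "restr M (shift a) $ i = coord_perm M (cycle_perm N) (restr M a) $ i" ..
qed (simp add: restr_def coord_perm_def)

lemma diff_op_bij: "bij_betw diff_op W W"
proof -
  have into: "diff_op ` W \<subseteq> W"
    using periodic_diff_op sum_diff_op N_pos by (auto simp: sum_zero_periodic_def)
  have "inj_on diff_op W"
  proof (rule inj_onI)
    fix a b assume ab: "a \<in> W" "b \<in> W" "diff_op a = diff_op b"
    then have "diff_op (a + b) = 0" by (simp add: diff_op_add Q.two_torsion)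
    moreover have "a + b \<in> W" using ab W_subsp by blast
    ultimately have "a + b = 0" using sum_zero_periodic_const[OF odd_N] by blast
    then show "a = b" by (simp add: Q.add_eq_0_iff_eq)
  qed
  then show ?thesis using endo_inj_surj[OF W_form(1) into] by (simp add: bij_betw_def)
qed

lemma diff_op_W: "a \<in> W \<Longrightarrow> diff_op a \<in> W"
  using diff_op_bij by (auto simp: bij_betw_def)

end

text \<open>The Frobenius identity \<open>(1 + X) ^ (2 ^ m) = 1 + X ^ (2 ^ m)\<close> over the field
  with two elements.\<close>

lemma diff_op_pow_two: "(diff_op ^^ (2 ^ m)) a = (\<lambda>i. a i + a (i + 2 ^ m))"
proof (induction m arbitrary: a)
  case 0 then show ?case by (simp add: diff_op_def)
next
  case (Suc m)
  have two: "(2 :: nat) ^ Suc m = 2 ^ m + 2 ^ m" by simp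
  have "(diff_op ^^ (2 ^ Suc m)) a = (diff_op ^^ (2 ^ m)) ((diff_op ^^ (2 ^ m)) a)"
    by (simp only: two funpow_add comp_apply)
  also have "\<dots> = (\<lambda>i. (a i + a (i + 2 ^ m)) + (a (i + 2 ^ m) + a (i + 2 ^ m + 2 ^ m)))"
    by (simp only: Suc)
  also have "\<dots> = (\<lambda>i. a i + a (i + 2 ^ Suc m))"
    by (rule ext) (simp add: add.assoc)
  finally show ?case .
qed

section \<open>Sum-zero vectors modulo constants\<close>

abbreviation ones_subgroup :: "nat \<Rightarrow> bit vec set" where
  "ones_subgroup M \<equiv> generate (sum_zero_space M) {ones_vec M}"

lemma ones_vec_carrier [simp]: "ones_vec M \<in> carrier_vec M"
  by (simp add: ones_vec_def)

lemma weight_ones [simp]: "weight M (ones_vec M) = M"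
  by (simp add: weight_def ones_vec_def)

lemma weight_ones_add: "x \<in> carrier_vec M \<Longrightarrow> weight M (ones_vec M + x) = M - weight M x"
proof -
  assume x: "x \<in> carrier_vec M"
  have "(ones_vec M + x) $ i = 1 \<longleftrightarrow> x $ i \<noteq> 1" if "i < M" for i
    using that x by (cases "x $ i") (auto simp: ones_vec_def)
  then have "weight M (ones_vec M + x) + weight M x = (\<Sum>i<M. 1)"
    unfolding weight_def sum.distrib[symmetric] by (intro sum.cong) auto
  then show ?thesis by simp
qed

lemma weight_le: "weight M x \<le> M"
proof -
  have "weight M x \<le> (\<Sum>i<M. 1)" unfolding weight_def by (rule sum_mono) simp
  then show ?thesis by simp
qed

lemma ones_subgroup_eq: "even M \<Longrightarrow> ones_subgroup M = {0\<^sub>v M, ones_vec M}"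
proof
  assume M: "even M"
  interpret comm_group "sum_zero_space M" by (rule comm_group_sum_zero_space)
  have two: "ones_vec M + ones_vec M = 0\<^sub>v M" by (rule vec_add_self_bit) simp
  have "inv\<^bsub>sum_zero_space M\<^esub> ones_vec M = ones_vec M"
    by (rule inv_equality) (use M two in simp_all)
  then show "ones_subgroup M \<subseteq> {0\<^sub>v M, ones_vec M}"
  proof (intro subsetI)
    fix x assume "x \<in> ones_subgroup M"
    then show "x \<in> {0\<^sub>v M, ones_vec M}"
      by (induction rule: generate.induct) (use two \<open>inv\<^bsub>sum_zero_space M\<^esub> ones_vec M = ones_vec M\<close> in auto)
  qed
  show "{0\<^sub>v M, ones_vec M} \<subseteq> ones_subgroup M"
    using generate.one[of "sum_zero_space M" "{ones_vec M}"] by (auto intro: generate.incl)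
qed

definition ones_class :: "nat \<Rightarrow> bit vec \<Rightarrow> bit vec set" where
  "ones_class M x = {x, ones_vec M + x}"

lemma ones_class_eq_coset:
  "even M \<Longrightarrow> x \<in> carrier_vec M \<Longrightarrow> ones_class M x = ones_subgroup M #>\<^bsub>sum_zero_space M\<^esub> x"
  by (auto simp: ones_class_def r_coset_def ones_subgroup_eq)

lemma ones_subgroup_normal: "even M \<Longrightarrow> normal (ones_subgroup M) (sum_zero_space M)"
proof -
  assume "even M"
  interpret comm_group "sum_zero_space M" by (rule comm_group_sum_zero_space)
  show ?thesis by (intro subgroup_imp_normal generate_is_subgroup) (use \<open>even M\<close> in simp)
qed

lemma group_quotient: "even M \<Longrightarrow> group (sum_zero_quotient M)"
  unfolding sum_zero_quotient_def by (rule normal.factorgroup_is_group[OF ones_subgroup_normal])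

lemma quotient_carrier:
  "even M \<Longrightarrow> carrier (sum_zero_quotient M) = ones_class M ` carrier (sum_zero_space M)"
  by (auto simp: sum_zero_quotient_def FactGroup_def RCOSETS_def ones_class_eq_coset image_def)

lemma ones_class_hom: "even M \<Longrightarrow> ones_class M \<in> hom (sum_zero_space M) (sum_zero_quotient M)"
proof -
  assume M: "even M"
  have h: "(\<lambda>x. ones_subgroup M #>\<^bsub>sum_zero_space M\<^esub> x) \<in> hom (sum_zero_space M) (sum_zero_quotient M)"
    unfolding sum_zero_quotient_def by (rule normal.r_coset_hom_Mod[OF ones_subgroup_normal[OF M]])
  show ?thesis
    by (rule homI) (use h M in \<open>auto simp: hom_def ones_class_eq_coset[symmetric] even_weight_add Pi_iff\<close>)
qed

lemma ones_class_mult: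
  "even M \<Longrightarrow> x \<in> carrier (sum_zero_space M) \<Longrightarrow> y \<in> carrier (sum_zero_space M) \<Longrightarrow>
    ones_class M x \<otimes>\<^bsub>sum_zero_quotient M\<^esub> ones_class M y = ones_class M (x + y)"
  using ones_class_hom[of M] by (auto simp: hom_def)

lemma coord_perm_ones_class:
  "\<sigma> permutes {1..M} \<Longrightarrow> x \<in> carrier_vec M \<Longrightarrow> coord_perm M \<sigma> ` ones_class M x = ones_class M (coord_perm M \<sigma> x)"
  by (simp add: ones_class_def coord_perm_add coord_perm_ones)

lemma coord_perm_quotient_hom:
  assumes M: "even M" and \<sigma>: "\<sigma> permutes {1..M}"
  shows "(`) (coord_perm M \<sigma>) \<in> hom (sum_zero_quotient M) (sum_zero_quotient M)"
proof (rule homI)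
  fix C assume "C \<in> carrier (sum_zero_quotient M)"
  then obtain x where x: "x \<in> carrier (sum_zero_space M)" "C = ones_class M x" by (auto simp: quotient_carrier[OF M])
  then have x': "coord_perm M \<sigma> x \<in> carrier (sum_zero_space M)" using \<sigma> by (simp add: weight_coord_perm)
  have xv: "x \<in> carrier_vec M" using x by simp
  show "coord_perm M \<sigma> ` C \<in> carrier (sum_zero_quotient M)"
    unfolding x(2) coord_perm_ones_class[OF \<sigma> xv] quotient_carrier[OF M] using x' by (rule imageI)
  fix D assume "D \<in> carrier (sum_zero_quotient M)"
  then obtain y where y: "y \<in> carrier (sum_zero_space M)" "D = ones_class M y" by (auto simp: quotient_carrier[OF M])
  then have y': "coord_perm M \<sigma> y \<in> carrier (sum_zero_space M)" using \<sigma> by (simp add: weight_coord_perm)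
  have yv: "y \<in> carrier_vec M" using y by simp
  show "coord_perm M \<sigma> ` (C \<otimes>\<^bsub>sum_zero_quotient M\<^esub> D) =
      coord_perm M \<sigma> ` C \<otimes>\<^bsub>sum_zero_quotient M\<^esub> coord_perm M \<sigma> ` D"
    unfolding x(2) y(2) ones_class_mult[OF M x(1) y(1)] coord_perm_ones_class[OF \<sigma> xv] coord_perm_ones_class[OF \<sigma> yv]
      ones_class_mult[OF M x' y'] coord_perm_ones_class[OF \<sigma> add_carrier_vec[OF xv yv]] coord_perm_add[OF \<sigma> xv yv] ..
qed

text \<open>In degree 4 a vector of weight 2 is congruent to its complement, and the Klein four-group acts trivially.\<close>

lemma coord_perm_quotient_faithful:
  assumes M: "even M" "M > 4" and \<sigma>: "\<sigma> permutes {1..M}"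
    and fix_: "\<And>C. C \<in> carrier (sum_zero_quotient M) \<Longrightarrow> coord_perm M \<sigma> ` C = C"
  shows "\<sigma> = id"
proof (rule ccontr)
  assume ne: "\<sigma> \<noteq> id"
  have M3: "M \<ge> 3" using M by simp
  obtain x i where x: "x \<in> carrier_vec M" "weight M x = 2" "i < M" "x $ i = 1" "coord_perm M \<sigma> x $ i = 0"
    using coord_perm_moves[OF \<sigma> ne M3] by blast
  have "ones_class M x \<in> carrier (sum_zero_quotient M)"
    unfolding quotient_carrier[OF M(1)] using x by (intro imageI) simp
  then have "ones_class M (coord_perm M \<sigma> x) = ones_class M x"
    using fix_ coord_perm_ones_class[OF \<sigma> x(1)] by simp
  then have "coord_perm M \<sigma> x = x \<or> coord_perm M \<sigma> x = ones_vec M + x" by (auto simp: ones_class_def)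
  then show False
  proof
    assume "coord_perm M \<sigma> x = x" then show False using x by simp
  next
    assume "coord_perm M \<sigma> x = ones_vec M + x"
    then have "weight M x = M - weight M x" using weight_coord_perm[OF \<sigma>, of x] weight_ones_add[OF x(1)] by simp
    then show False using x M by simp
  qed
qed

lemma coord_perm_faithful:
  assumes M: "M \<ge> 3" and \<sigma>: "\<sigma> permutes {1..M}"
    and fix_: "\<And>x. x \<in> carrier (sum_zero_space M) \<Longrightarrow> coord_perm M \<sigma> x = x"
  shows "\<sigma> = id"
proof (rule ccontr)
  assume ne: "\<sigma> \<noteq> id"
  obtain x i where x: "x \<in> carrier_vec M" "weight M x = 2" "i < M" "x $ i = 1" "coord_perm M \<sigma> x $ i = 0"
    using coord_perm_moves[OF \<sigma> ne M] by blast
  then show False using fix_[of x] by simp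
qed

lemma transpose_permutes: "i \<in> {1..M} \<Longrightarrow> j \<in> {1..M} \<Longrightarrow> Transposition.transpose i j permutes {1..M}"
  by (rule permutes_swap_id)

lemma coord_perm_transpose_index:
  fixes M :: nat
  assumes "i < M"
  shows "coord_perm M (Transposition.transpose a b) x $ i = x $ (Transposition.transpose a b (i + 1) - 1)"
  using coord_perm_index[OF assms, of "Transposition.transpose a b" x] by (simp only: inv_transpose_eq)

context odd_period
begin

text \<open>Here \<open>diff_op ^^ N\<close> is \<open>(1 + X) * (1 + X ^ (N - 1))\<close>. With
  \<open>y = diff_op a\<close>, its value at 0 is \<open>y 0 + y (N - 1)\<close>, and
  \<open>diff_op (cvec N 0)\<close> is 1 exactly at 0 and \<open>N - 1\<close> within the period. So
  the transvection exchanges the first and the last entry of \<open>y\<close>, which is why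
  \<open>\<gamma>\<close> contains \<open>diff_op\<close>.\<close>

lemma model_space:
  assumes N: "N = 2 ^ m + 1" and m: "m > 0"
  shows "perm_model N N (sum_zero_space N) (\<lambda>a. restr N (diff_op a)) (coord_perm N) (cycle_perm N) (Transposition.transpose 1 N)"
proof -
  let ?\<gamma> = "\<lambda>a. restr N (diff_op a)"
  have "(2 :: nat) ^ 1 \<le> 2 ^ m" by (rule power_increasing) (use m in auto)
  then have N3: "N \<ge> 3" using N by simp
  have \<gamma>: "?\<gamma> \<in> iso (periodic_group N) (sum_zero_space N)"
  proof -
    have "bij_betw (restr N) W (carrier (sum_zero_space N))"
    proof (rule bij_betw_imageI[OF restr_inj])
      show "restr N ` W = carrier (sum_zero_space N)"
      proof (intro equalityI subsetI)
        fix x assume x: "x \<in> carrier (sum_zero_space N)"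
        then obtain a where "a \<in> W" "restr N a = x" using restr_range[of N x] by auto
        then show "x \<in> restr N ` W" by blast
      qed (auto simp: even_weight_restr)
    qed simp
    then have "bij_betw ?\<gamma> W (carrier (sum_zero_space N))"
      using bij_betw_trans[OF diff_op_bij] by (simp add: comp_def)
    moreover have "?\<gamma> \<in> hom (periodic_group N) (sum_zero_space N)"
      by (auto simp: hom_def restr_add diff_op_add even_weight_restr diff_op_W)
    ultimately show ?thesis by (simp add: iso_def)
  qed
  have act_t: "?\<gamma> (T (cvec N 0) a) = coord_perm N (Transposition.transpose 1 N) (?\<gamma> a)" if a: "a \<in> W" for a
  proof -
    let ?y = "diff_op a"
    have per: "a (i + int N) = a i" for i using W_periodic[OF a] by (simp add: periodic_def)
    have intN: "int N = 2 ^ m + 1" "int (N - 1) = 2 ^ m" using N by simp_all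
    have "(diff_op ^^ N) a = diff_op (\<lambda>i. a i + a (i + 2 ^ m))"
      unfolding N by (simp only: Suc_eq_plus1[symmetric] funpow.simps comp_apply diff_op_pow_two)
    then have "bform N a (cvec N 0) = (a 0 + a (2 ^ m)) + (a 1 + a (1 + 2 ^ m))"
      using B_cvec[OF a, of 0] by (simp add: diff_op_def)
    also have "a (1 + 2 ^ m) = a 0" using per[of 0] by (simp add: intN add.commute)
    finally have B: "bform N a (cvec N 0) = a 1 + a (2 ^ m)" by (simp add: add_ac)
    have y0: "?y 0 = a 0 + a 1" by (simp add: diff_op_def)
    have yl: "?y (int (N - 1)) = a (2 ^ m) + a 0"
      using per[of 0] by (simp add: diff_op_def intN)
    have c: "diff_op (cvec N 0) (int i) = (if i = 0 \<or> i = N - 1 then 1 else 0)" if "i < N" for i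
    proof -
      have "(int i + 1) mod int N = 0 \<longleftrightarrow> i = N - 1"
      proof (cases "i = N - 1")
        case True
        then have "int i + 1 = int N" using N3 by simp
        then show ?thesis using True by simp
      next
        case False
        then have "int i + 1 < int N" using that by linarith
        then have "(int i + 1) mod int N = int i + 1" by (intro mod_pos_pos_trivial) simp_all
        then have "(int i + 1) mod int N \<noteq> 0" by linarith
        then show ?thesis using False by blast
      qed
      then show ?thesis using that N3 by (auto simp: diff_op_def cvec_def mod_pos_pos_trivial)
    qed
    have T: "diff_op (T (cvec N 0) a) (int i) = ?y (int i) + bform N a (cvec N 0) * diff_op (cvec N 0) (int i)" for i
      by (cases "bform N a (cvec N 0)") (auto simp: Q.trv_def diff_op_add)
    show ?thesis
    proof (rule eq_vecI)
      fix i assume "i < dim_vec (coord_perm N (Transposition.transpose 1 N) (?\<gamma> a))"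
      then have i: "i < N" by (simp add: coord_perm_def)
      have "coord_perm N (Transposition.transpose 1 N) (?\<gamma> a) $ i = ?\<gamma> a $ (Transposition.transpose 1 N (i + 1) - 1)"
        by (rule coord_perm_transpose_index[OF i])
      also have "\<dots> = ?\<gamma> (T (cvec N 0) a) $ i"
      proof -
        consider "i = 0" | "i = N - 1" "i \<noteq> 0" | "i \<noteq> 0" "i \<noteq> N - 1" by blast
        then show ?thesis
        proof cases
          case 1
          have "Transposition.transpose 1 N (i + 1) - 1 = N - 1" using 1 by simp
          then have "?\<gamma> a $ (Transposition.transpose 1 N (i + 1) - 1) = ?y (int (N - 1))"
            using N3 by (simp only: restr_def index_vec) simp
          moreover have "?\<gamma> (T (cvec N 0) a) $ i = ?y 0 + bform N a (cvec N 0)"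
            using T[of 0] c[of 0] 1 N3 by (simp add: restr_def)
          ultimately show ?thesis using y0 yl B by (simp add: add_ac)
        next
          case 2
          have "Transposition.transpose 1 N (i + 1) - 1 = 0" using 2 N3 by simp
          then have "?\<gamma> a $ (Transposition.transpose 1 N (i + 1) - 1) = ?y 0"
            using N3 by (simp only: restr_def index_vec) simp
          moreover have "?\<gamma> (T (cvec N 0) a) $ i = ?y (int (N - 1)) + bform N a (cvec N 0)"
            using T[of "N - 1"] c[of "N - 1"] 2 N3 by (simp add: restr_def)
          ultimately show ?thesis using y0 yl B by (simp add: add_ac)
        next
          case 3
          have "Transposition.transpose 1 N (i + 1) - 1 = i"
            using 3 i by (subst transpose_apply_other) auto
          then show ?thesis using T[of i] c[of i] 3 i by (simp add: restr_def)
        qed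
      qed
      finally show "?\<gamma> (T (cvec N 0) a) $ i = coord_perm N (Transposition.transpose 1 N) (?\<gamma> a) $ i" ..
    qed (simp add: restr_def coord_perm_def)
  qed
  show ?thesis
  proof (intro perm_model.intro perm_model_axioms.intro odd_period_axioms)
    show "group (sum_zero_space N)" using comm_group_sum_zero_space by (rule comm_group.axioms)
    show "coord_perm N id x = x" if "x \<in> carrier (sum_zero_space N)" for x using that coord_perm_id by simp
    show "cycle_perm N permutes {1..N}" by (rule cycle_perm_permutes) simp
    show "Transposition.transpose 1 N permutes {1..N}" using N3 by (intro transpose_permutes) auto
    show "?\<gamma> (shift a) = coord_perm N (cycle_perm N) (?\<gamma> a)" if "a \<in> W" for a
      using restr_shift[OF order_refl diff_op_W[OF that]] diff_pow_shift[of 1 a] by (simp add: One_nat_def)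
    show "H = carrier (sym_group N)"
      if "subgroup H (sym_group N)" "cycle_perm N \<in> H" "Transposition.transpose 1 N \<in> H" for H
      using cycle_and_transposition_generate[OF that(1,2) N_gt_1 that(3)] .
  qed (use \<gamma> act_t coord_perm_hom coord_perm_comp coord_perm_faithful[OF N3] in auto)
qed

text \<open>Each class modulo constants has exactly one member with last entry zero.\<close>

lemma class_restr_iso:
  "(\<lambda>a. ones_class (N + 1) (restr (N + 1) a)) \<in> iso (periodic_group N) (sum_zero_quotient (N + 1))"
proof -
  let ?M = "N + 1"
  let ?\<gamma> = "\<lambda>a. ones_class ?M (restr ?M a)"
  have M: "even ?M" using odd_N by simp
  have r: "restr ?M \<in> hom (periodic_group N) (sum_zero_space ?M)" by (rule restr_hom) simp
  have hom: "?\<gamma> \<in> hom (periodic_group N) (sum_zero_quotient ?M)"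
    using hom_compose[OF r ones_class_hom[OF M]] by (simp add: comp_def)
  have last: "restr ?M a $ N = 0" for a by (simp add: restr_def)
  have lt: "N < ?M" by simp
  have "inj_on ?\<gamma> W"
  proof (rule inj_onI)
    fix a b assume ab: "a \<in> W" "b \<in> W" "?\<gamma> a = ?\<gamma> b"
    then have "restr ?M a = restr ?M b \<or> restr ?M a = ones_vec ?M + restr ?M b" by (auto simp: ones_class_def)
    moreover have "(ones_vec ?M + restr ?M b) $ N = 1"
      by (simp add: ones_vec_def restr_def)
    ultimately have "restr ?M a = restr ?M b" using last[of a] by auto
    then show "a = b" using restr_inj[of ?M] ab by (auto simp: inj_on_def)
  qed
  moreover have "?\<gamma> ` W = carrier (sum_zero_quotient ?M)"
  proof (intro equalityI subsetI)
    fix C assume "C \<in> ?\<gamma> ` W" then show "C \<in> carrier (sum_zero_quotient ?M)" using hom by (auto simp: hom_def)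
  next
    fix C assume "C \<in> carrier (sum_zero_quotient ?M)"
    then obtain x where x: "x \<in> carrier_vec ?M" "even (weight ?M x)" "C = ones_class ?M x"
      by (auto simp: quotient_carrier[OF M])
    have cls: "ones_class ?M (ones_vec ?M + x) = ones_class ?M x"
    proof -
      have "ones_vec ?M + (ones_vec ?M + x) = x"
        using x(1) by (intro eq_vecI) (auto simp: ones_vec_def simp flip: add.assoc)
      then show ?thesis by (auto simp: ones_class_def)
    qed
    obtain x' where x': "x' \<in> carrier_vec ?M" "even (weight ?M x')" "C = ones_class ?M x'" "x' $ N = 0"
    proof (cases "x $ N = 0")
      case True then show thesis using that x by blast
    next
      case False
      have "(ones_vec ?M + x) $ N = 0" using False x(1) by (simp add: ones_vec_def)
      moreover have "even (weight ?M (ones_vec ?M + x))"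
        by (rule even_weight_add) (use x M in auto)
      moreover have "ones_vec ?M + x \<in> carrier_vec ?M" using x(1) by simp
      ultimately show thesis using that cls x(3) by blast
    qed
    have "x' $ i = 0" if "N \<le> i" "i < ?M" for i
    proof -
      have "i = N" using that by simp
      then show ?thesis using x'(4) by simp
    qed
    then obtain a where "a \<in> W" "restr ?M a = x'" using restr_range[OF _ x'(1,2)] by auto
    then show "C \<in> ?\<gamma> ` W" using x'(3) by blast
  qed
  ultimately show ?thesis using hom by (simp add: iso_def bij_betw_def)
qed

text \<open>Here \<open>diff_op ^^ (N + 1)\<close> is \<open>1 + X ^ (N + 1)\<close>, which acts as
  \<open>1 + X\<close>. So \<open>diff_op ^^ N\<close> is the identity on \<open>W\<close>, and the
  pairing with \<open>cvec N 0\<close> is \<open>a 0\<close>. With a zero appended,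
  \<open>cvec N 0\<close> is the complement of the vector supported on the first and the last entry;
  modulo constants, adding it when \<open>a 0 = 1\<close> exchanges these two entries, the last one
  being 0.\<close>

lemma model_quotient:
  assumes N: "N = 2 ^ m - 1" and m: "m > 2"
  shows "perm_model N (N + 1) (sum_zero_quotient (N + 1)) (\<lambda>a. ones_class (N + 1) (restr (N + 1) a))
    (\<lambda>\<sigma>. (`) (coord_perm (N + 1) \<sigma>)) (cycle_perm N) (Transposition.transpose 1 (N + 1))"
proof -
  let ?M = "N + 1"
  let ?\<gamma> = "\<lambda>a. ones_class ?M (restr ?M a)"
  have "(2 :: nat) ^ 3 \<le> 2 ^ m" by (rule power_increasing) (use m in auto)
  then have N7: "N \<ge> 7" and N1: "N + 1 = 2 ^ m" using N by auto
  have M: "even ?M" "?M > 4" using odd_N N7 by auto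
  have t: "Transposition.transpose 1 ?M permutes {1..?M}" by (intro transpose_permutes) auto
  have act_t: "?\<gamma> (T (cvec N 0) a) = coord_perm ?M (Transposition.transpose 1 ?M) ` ?\<gamma> a" if a: "a \<in> W" for a
  proof -
    have per: "a (i + int N) = a i" for i using W_periodic[OF a] by (simp add: periodic_def)
    have "diff_op ((diff_op ^^ N) a + a) = 0"
    proof -
      have "diff_op ((diff_op ^^ N) a) = (diff_op ^^ (2 ^ m)) a"
        by (simp only: N1[symmetric] Suc_eq_plus1[symmetric] funpow.simps comp_apply)
      also have "\<dots> = diff_op a"
      proof
        fix i
        have "i + 2 ^ m = (i + 1) + int N" using N1 by (metis add.assoc add.commute of_nat_1 of_nat_add of_nat_numeral of_nat_power)
        then have "a (i + 2 ^ m) = a (i + 1)" using per[of "i + 1"] by (simp only:)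
        then show "(diff_op ^^ (2 ^ m)) a i = diff_op a i"
          by (simp add: diff_op_pow_two diff_op_def)
      qed
      finally show ?thesis by (simp add: diff_op_add Q.two_torsion)
    qed
    moreover have "(diff_op ^^ k) a \<in> W" for k
      using a diff_op_W by (induction k) auto
    then have "(diff_op ^^ N) a + a \<in> W" using a W_subsp by blast
    ultimately have "(diff_op ^^ N) a + a = 0" using sum_zero_periodic_const[OF odd_N] by blast
    then have "(diff_op ^^ N) a = a" by (simp add: Q.add_eq_0_iff_eq)
    then have B: "bform N a (cvec N 0) = a 0" using B_cvec[OF a, of 0] by simp
    let ?x = "restr ?M a" and ?t = "Transposition.transpose 1 ?M"
    have idx: "coord_perm ?M ?t ?x $ i = (if i = 0 then 0 else if i = N then a 0 else a (int i))" if i: "i < ?M" for i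
    proof -
      consider "i = 0" | "i = N" "i \<noteq> 0" | "i \<noteq> 0" "i \<noteq> N" by blast
      then show ?thesis
      proof cases
        case 1
        have "?t (i + 1) - 1 = N" using 1 by simp
        then show ?thesis using coord_perm_transpose_index[OF i, of 1 ?M ?x] 1 by (simp add: restr_def)
      next
        case 2
        have "?t (i + 1) - 1 = 0" using 2 by simp
        then show ?thesis using coord_perm_transpose_index[OF i, of 1 ?M ?x] 2 N_pos by (simp add: restr_def)
      next
        case 3
        have "?t (i + 1) - 1 = i" using 3 i by (subst transpose_apply_other) auto
        then show ?thesis using coord_perm_transpose_index[OF i, of 1 ?M ?x] 3 i by (simp add: restr_def)
      qed
    qed
    have "?\<gamma> (T (cvec N 0) a) = ones_class ?M (coord_perm ?M ?t ?x)"
    proof (cases "a 0 = 0")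
      case True
      then have "T (cvec N 0) a = a" using B by (simp add: Q.trv_perp)
      moreover have "coord_perm ?M ?t ?x = ?x"
      proof (rule eq_vecI)
        fix i assume "i < dim_vec ?x"
        then have i: "i < ?M" by (simp add: restr_def)
        show "coord_perm ?M ?t ?x $ i = ?x $ i" using idx[OF i] i True by (auto simp: restr_def)
      qed (simp add: restr_def coord_perm_def)
      ultimately show ?thesis by simp
    next
      case False
      then have a0: "a 0 = 1" by simp
      then have T: "T (cvec N 0) a = a + cvec N 0" using B by (simp add: Q.trv_def)
      have "restr ?M (a + cvec N 0) = ones_vec ?M + coord_perm ?M ?t ?x"
      proof (rule eq_vecI)
        fix i assume "i < dim_vec (ones_vec ?M + coord_perm ?M ?t ?x)"
        then have i: "i < ?M" by (simp add: coord_perm_def)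
        have c: "cvec N 0 (int i) = (if i = 0 then 0 else 1)" if "i < N"
          using that by (simp add: cvec_def mod_pos_pos_trivial)
        have "(ones_vec ?M + coord_perm ?M ?t ?x) $ i = 1 + coord_perm ?M ?t ?x $ i"
          using i by (simp add: ones_vec_def coord_perm_def)
        then show "restr ?M (a + cvec N 0) $ i = (ones_vec ?M + coord_perm ?M ?t ?x) $ i"
          using idx[OF i] i c a0 N_pos by (auto simp: restr_def add.commute)
      qed (simp add: restr_def coord_perm_def)
      moreover have "ones_vec ?M + (ones_vec ?M + coord_perm ?M ?t ?x) = coord_perm ?M ?t ?x"
        by (rule eq_vecI) (auto simp: ones_vec_def coord_perm_def simp flip: add.assoc)
      ultimately show ?thesis unfolding T by (auto simp: ones_class_def)
    qed
    then show ?thesis using coord_perm_ones_class[OF t restr_carrier] by simp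
  qed
  show ?thesis
  proof (intro perm_model.intro perm_model_axioms.intro odd_period_axioms)
    show "group (sum_zero_quotient ?M)" by (rule group_quotient[OF M(1)])
    show "?\<gamma> \<in> iso (periodic_group N) (sum_zero_quotient ?M)" by (rule class_restr_iso)
    show "(`) (coord_perm ?M \<sigma>) \<in> hom (sum_zero_quotient ?M) (sum_zero_quotient ?M)" if "\<sigma> permutes {1..?M}" for \<sigma>
      by (rule coord_perm_quotient_hom[OF M(1) that])
    show "coord_perm ?M (\<sigma> \<circ> \<tau>) ` C = coord_perm ?M \<sigma> ` coord_perm ?M \<tau> ` C"
      if "\<sigma> permutes {1..?M}" "\<tau> permutes {1..?M}" for \<sigma> \<tau> C
      unfolding image_image using coord_perm_comp[OF that] by (simp add: image_def)
    show "coord_perm ?M id ` C = C" if "C \<in> carrier (sum_zero_quotient ?M)" for C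
      using that by (auto simp: quotient_carrier[OF M(1)] ones_class_def coord_perm_id)
    show "\<sigma> = id" if "\<sigma> permutes {1..?M}" "\<And>C. C \<in> carrier (sum_zero_quotient ?M) \<Longrightarrow> coord_perm ?M \<sigma> ` C = C" for \<sigma>
      by (rule coord_perm_quotient_faithful[OF M that])
    show "cycle_perm N permutes {1..?M}" by (rule cycle_perm_permutes) simp
    show "?\<gamma> (shift a) = coord_perm ?M (cycle_perm N) ` ?\<gamma> a" if "a \<in> W" for a
      using restr_shift[OF _ that, of ?M] coord_perm_ones_class[OF cycle_perm_permutes[of N ?M] restr_carrier] by simp
    show "H = carrier (sym_group ?M)"
      if "subgroup H (sym_group ?M)" "cycle_perm N \<in> H" "Transposition.transpose 1 ?M \<in> H" for H
      using cycle_and_star_transposition_generate[OF that] .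
  qed (rule t, rule act_t)
qed

end

theorem MD_sym_group:
  shows "m > 1 \<Longrightarrow> MD_F2 (2 ^ m) \<cong> sym_group (2 ^ m + 1)"
    and "m > 2 \<Longrightarrow> MD_F2 (2 ^ m - 2) \<cong> sym_group (2 ^ m)"
proof -
  show "MD_F2 (2 ^ m) \<cong> sym_group (2 ^ m + 1)" if m: "m > 1"
  proof -
    interpret odd_period "2 ^ m + 1" by unfold_locales (use m in auto)
    show ?thesis using perm_model.MD_iso_sym_group[OF model_space[OF refl]] m by simp
  qed
  show "MD_F2 (2 ^ m - 2) \<cong> sym_group (2 ^ m)" if m: "m > 2"
  proof -
    have "(2 :: nat) ^ 3 \<le> 2 ^ m" by (rule power_increasing) (use m in auto)
    then have e: "(2 :: nat) ^ m - 1 - 1 = 2 ^ m - 2" "(2 :: nat) ^ m - 1 + 1 = 2 ^ m" "(2 :: nat) ^ m - 1 > 1" by auto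
    interpret odd_period "2 ^ m - 1" by unfold_locales (use m e in auto)
    show ?thesis using perm_model.MD_iso_sym_group[OF model_quotient[OF refl m]] by (simp only: e)
  qed
qed

context perm_model
begin

lemma perm_mat_quad_isometry:
  fixes Qf :: "'g \<Rightarrow> bit"
  assumes gen: "Q.gen_by_trv N W" and all: "Q.nonsing N W \<subseteq> perm_vectors"
    and Q\<gamma>: "\<And>a. a \<in> W \<Longrightarrow> Qf (\<gamma> a) = qform N a"
    and Qact: "\<And>\<sigma> a. \<sigma> permutes {1..M} \<Longrightarrow> a \<in> carrier G \<Longrightarrow> Qf (act \<sigma> a) = Qf a"
    and type: "Q.has_type N W (N - 1) F"
  shows "\<exists>\<phi>. quad_isometry (vec_space_F2 (N - 1)) (F (N - 1)) G Qf \<phi>"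
    and "quad_isometry (vec_space_F2 (N - 1)) (F (N - 1)) G Qf \<phi> \<Longrightarrow>
      perm_mat \<phi> \<in> iso (sym_group M) (isometry_group (N - 1) (F (N - 1)))"
proof -
  obtain \<chi> where \<chi>: "\<chi> \<in> iso (vec_space_F2 (N - 1)) (periodic_group N)"
    "\<And>x. x \<in> carrier_vec (N - 1) \<Longrightarrow> qform N (\<chi> x) = F (N - 1) x" by (rule type_iso[OF type]) blast
  have "\<gamma> \<circ> \<chi> \<in> iso (vec_space_F2 (N - 1)) G" by (rule iso_set_trans[OF \<chi>(1) \<gamma>])
  moreover have "Qf ((\<gamma> \<circ> \<chi>) x) = F (N - 1) x" if "x \<in> carrier_vec (N - 1)" for x
    using Q\<gamma>[of "\<chi> x"] isoD(2)[OF \<chi>(1) that] \<chi>(2)[OF that] by simp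
  ultimately show "\<exists>\<phi>. quad_isometry (vec_space_F2 (N - 1)) (F (N - 1)) G Qf \<phi>"
    unfolding quad_isometry_def by (intro exI[of _ "\<gamma> \<circ> \<chi>"]) simp
  assume "quad_isometry (vec_space_F2 (N - 1)) (F (N - 1)) G Qf \<phi>"
  then have \<phi>: "\<phi> \<in> iso (vec_space_F2 (N - 1)) G" "\<And>x. x \<in> carrier_vec (N - 1) \<Longrightarrow> Qf (\<phi> x) = F (N - 1) x"
    by (simp_all add: quad_isometry_def)
  show "perm_mat \<phi> \<in> iso (sym_group M) (isometry_group (N - 1) (F (N - 1)))"
    by (rule perm_mat_iso_isometry_group[OF gen all Q\<gamma> Qact \<phi>])
qed

end

section \<open>Exceptional isomorphisms\<close>

lemma quad_coord_perm: "\<sigma> permutes {1..M} \<Longrightarrow> quad M (coord_perm M \<sigma> x) = quad M x"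
  by (simp add: quad_eq_weight weight_coord_perm)

text \<open>For \<open>M = 4 * k\<close> the complement of a vector of weight \<open>2 * v\<close>
  has weight \<open>2 * u\<close> with \<open>v + u = 2 * k\<close>. The form at weight
  \<open>2 * v\<close> is \<open>v * (2 * v + 1)\<close>, which has the parity of
  \<open>v\<close>.\<close>

lemma quad_quotient_class:
  assumes M: "4 dvd M" and x: "x \<in> carrier (sum_zero_space M)"
  shows "quad_quotient M (ones_class M x) = quad M x"
proof -
  obtain k where k: "M = 4 * k" using M by auto
  have xv: "x \<in> carrier_vec M" and "even (weight M x)" using x by simp_all
  then obtain v where v: "weight M x = 2 * v" by auto
  then obtain u where u: "2 * k = v + u" using weight_le[of M x] k le_Suc_ex[of v "2 * k"] by auto
  have w': "M - weight M x = 2 * u" using k v u by simp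
  have half: "2 * j * (2 * j + 1) div 2 = j * (2 * j + 1)" for j :: nat by (simp add: mult.assoc)
  have "even v \<longleftrightarrow> even u" using u by presburger
  then have "quad M (ones_vec M + x) = quad M x"
    by (simp only: quad_eq_weight weight_ones_add[OF xv] w') (simp only: v half, simp add: of_nat_bit)
  then show ?thesis by (simp add: quad_quotient_def ones_class_def)
qed

lemma quad_5: "quad 5 x = x $ 0 + x $ 1 + x $ 2 + x $ 3 + x $ 4 + x $ 0 * x $ 1 + x $ 0 * x $ 2 + x $ 0 * x $ 3
    + x $ 0 * x $ 4 + x $ 1 * x $ 2 + x $ 1 * x $ 3 + x $ 1 * x $ 4 + x $ 2 * x $ 3 + x $ 2 * x $ 4 + x $ 3 * x $ 4"
  by (simp add: quad_def eval_nat_numeral lessThan_Suc atLeastLessThanSuc add_ac)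

text \<open>7 choose 1, 2 and 3 are all odd, and two distinct residues modulo 7 differ by exactly
  one of 1, 2, 3 up to sign; so both sides are the sum over all pairs.\<close>

lemma qform_7_eq_quad:
  assumes "periodic 7 a"
  shows "qform 7 a = quad 7 (vec 7 (\<lambda>i. a (int i)))"
proof -
  have set: "{0..<int 7} = {0, 1, 2, 3, 4, 5, 6}" "{1..7 div 2 :: nat} = {1, 2, 3}" by auto
  have per: "a 7 = a 0" "a 8 = a 1" "a 9 = a 2"
    using assms[unfolded periodic_def, rule_format, of 0] assms[unfolded periodic_def, rule_format, of 1]
      assms[unfolded periodic_def, rule_format, of 2] by simp_all
  have choose: "(of_nat (7 choose 1) :: bit) = 1" "(of_nat (7 choose 2) :: bit) = 1" "(of_nat (7 choose 3) :: bit) = 1"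
  proof -
    have "7 choose 1 = (7 :: nat)" "7 choose 2 = (21 :: nat)" "7 choose 3 = (35 :: nat)" by (simp_all add: eval_nat_numeral)
    then show "(of_nat (7 choose 1) :: bit) = 1" "(of_nat (7 choose 2) :: bit) = 1" "(of_nat (7 choose 3) :: bit) = 1"
      by (simp_all only: of_nat_bit) simp_all
  qed
  have "qform 7 a = a 0 + a 1 + a 2 + a 3 + a 4 + a 5 + a 6 + a 0 * a 1 + a 0 * a 2 + a 0 * a 3 + a 0 * a 4 + a 0 * a 5
    + a 0 * a 6 + a 1 * a 2 + a 1 * a 3 + a 1 * a 4 + a 1 * a 5 + a 1 * a 6 + a 2 * a 3 + a 2 * a 4 + a 2 * a 5 + a 2 * a 6
    + a 3 * a 4 + a 3 * a 5 + a 3 * a 6 + a 4 * a 5 + a 4 * a 6 + a 5 * a 6" (is "_ = ?R")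
    unfolding qform_def set using choose by (simp add: per mult.commute add_ac)
  also have "\<dots> = quad 7 (vec 7 (\<lambda>i. a (int i)))"
    by (simp add: quad_def eval_nat_numeral lessThan_Suc atLeastLessThanSuc add_ac)
  finally show ?thesis .
qed


lemma choose_5: "(5 :: nat) choose 1 = 5" "(5 :: nat) choose 2 = 10" "(5 :: nat) choose 3 = 10"
  by (simp_all add: eval_nat_numeral)

lemma choose_7: "(7 :: nat) choose 1 = 7" "(7 :: nat) choose 2 = 21" "(7 :: nat) choose 3 = 35" 
    "(7 :: nat) choose 4 = 35" "(7 :: nat) choose 5 = 21" "(7 :: nat) choose 6 = 7"
  by (simp_all add: eval_nat_numeral)

context odd_period
begin

lemma gen_by_trv_W: "Q.path4 N a b c d \<Longrightarrow> Q.span_path4 a b c d \<subseteq> W \<Longrightarrow> Q.gen_by_trv N W"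
  using Q.gen_by_trv_main[OF _ W_form] by blast

lemma span_path4_W: "{a, b, c, d} \<subseteq> W \<Longrightarrow> Q.span_path4 a b c d \<subseteq> W"
  unfolding Q.span_path4_def by (intro Q.adjoin_subset W_form W_subsp) (auto simp: W_subsp)

end

theorem S5_natural_embedding:
  shows "\<exists>\<phi>. quad_isometry (vec_space_F2 4) (F_minus 4) (sum_zero_space 5) (quad 5) \<phi>"
    and "quad_isometry (vec_space_F2 4) (F_minus 4) (sum_zero_space 5) (quad 5) \<phi> \<Longrightarrow>
      nat_embedding_space 4 \<phi> \<in> iso (sym_group 5) (O_minus_F2 4)"
proof -
  interpret odd_period 5 by unfold_locales auto
  let ?\<gamma> = "\<lambda>a. restr 5 (diff_op a)"
  interpret P: perm_model 5 5 "sum_zero_space 5" ?\<gamma> "coord_perm 5" "cycle_perm 5" "Transposition.transpose 1 5"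
    by (rule model_space[of 2]) simp_all
  define C where "C = (\<lambda>i :: nat. cvec 5 (int i))"
  have B: "bform 5 (C i) (C j) = of_nat (5 choose (j - i))" if "i < j" "j < 5" for i j
    using B_cvec_cvec[OF that] by (simp add: C_def)
  have CW: "C i \<in> W" and qC: "qform 5 (C i) = 1" for i by (simp_all add: C_def cvec_W q_cvec)
  \<comment> \<open>Among these four only neighbours pair to 1, since 5 is odd and 10 is even; they
    already span all 16 elements of \<open>W\<close>.\<close>
  have path: "Q.path4 5 (C 0) (C 1) (C 2) (C 3)"
    unfolding Q.path4_def using B[of 0 1] B[of 1 2] B[of 2 3] B[of 0 2] B[of 1 3] B[of 0 3]
    by (simp add: qC choose_5 of_nat_bit)
  have sub: "Q.span_path4 (C 0) (C 1) (C 2) (C 3) \<subseteq> W" by (rule span_path4_W) (simp add: CW)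
  have "card W = 16" using card_sum_zero_periodic(2)[of 5] by simp
  then have span: "Q.span_path4 (C 0) (C 1) (C 2) (C 3) = W"
    using card_subset_eq[OF W_form(1) sub] Q.card_path4[OF path] by simp
  have closed: "Q.trv_closed 5 P.perm_vectors" and CP: "C i \<in> P.perm_vectors" for i
    using P.monodromy_closed_perm_vectors cvec_in_closed[OF P.monodromy_closed_perm_vectors]
    by (auto simp: monodromy_closed_def C_def)
  have all: "Q.nonsing 5 W \<subseteq> P.perm_vectors"
    using Q.path4_in_closed[OF path closed CP CP CP CP] by (simp only: span)
  \<comment> \<open>The fifth value of a period is eliminated by the sum-zero condition; a check of
    16 cases remains.\<close>
  have quad_\<gamma>: "quad 5 (?\<gamma> a) = qform 5 a" if a: "a \<in> W" for a
  proof -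
    have set: "{0..<int 5} = {0, 1, 2, 3, 4}" "{1..5 div 2 :: nat} = {1, 2}" by auto
    have per: "a 5 = a 0" "a 6 = a 1"
      using W_periodic[OF a, unfolded periodic_def, rule_format, of 0]
        W_periodic[OF a, unfolded periodic_def, rule_format, of 1] by simp_all
    have "(\<Sum>i\<in>{0..<int 5}. a i) = 0" using a by (simp add: sum_zero_periodic_def)
    then have sum: "a 4 = a 0 + a 1 + a 2 + a 3"
      unfolding set by (cases "a 0"; cases "a 1"; cases "a 2"; cases "a 3"; cases "a 4") simp_all
    have c: "(of_nat (5 choose 1) :: bit) = 1" "(of_nat (5 choose 2) :: bit) = 0"
      by (simp_all only: choose_5 of_nat_bit) simp_all
    have q: "qform 5 a = a 0 + a 1 + a 2 + a 3 + a 4 + a 0 * a 1 + a 1 * a 2 + a 2 * a 3 + a 3 * a 4 + a 4 * a 0"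
      unfolding qform_def set using c by (simp add: per add_ac)
    have y: "?\<gamma> a $ 0 = a 0 + a 1" "?\<gamma> a $ 1 = a 1 + a 2" "?\<gamma> a $ 2 = a 2 + a 3" "?\<gamma> a $ 3 = a 3 + a 4"
      "?\<gamma> a $ 4 = a 4 + a 0" by (simp_all add: restr_def diff_op_def per)
    show ?thesis
      unfolding quad_5 y q sum by (cases "a 0"; cases "a 1"; cases "a 2"; cases "a 3") simp_all
  qed
  note * = P.perm_mat_quad_isometry[OF gen_by_trv_W[OF path sub] all quad_\<gamma> quad_coord_perm
    type_sum_zero_periodic(2)[OF odd_N]]
  show "\<exists>\<phi>. quad_isometry (vec_space_F2 4) (F_minus 4) (sum_zero_space 5) (quad 5) \<phi>"
    using *(1) by (simp add: chi8_def)
  have emb: "nat_embedding_space 4 \<phi> = P.perm_mat \<phi>"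
    by (rule ext) (simp add: nat_embedding_space_def P.perm_mat_def)
  show "quad_isometry (vec_space_F2 4) (F_minus 4) (sum_zero_space 5) (quad 5) \<phi> \<Longrightarrow>
      nat_embedding_space 4 \<phi> \<in> iso (sym_group 5) (O_minus_F2 4)"
    unfolding emb O_eq_isometry_group using *(2) by (simp add: chi8_def)
qed


lemma weight_eq_card: "weight M x = card {i. i < M \<and> x $ i = 1}"
  by (simp add: weight_def of_bool_def sum.If_cases lessThan_def Collect_conj_eq[symmetric])

theorem S8_natural_embedding:
  shows "\<exists>\<phi>. quad_isometry (vec_space_F2 6) (F_plus 6) (sum_zero_quotient 8) (quad_quotient 8) \<phi>"
    and "quad_isometry (vec_space_F2 6) (F_plus 6) (sum_zero_quotient 8) (quad_quotient 8) \<phi> \<Longrightarrow>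
      nat_embedding_quotient 6 \<phi> \<in> iso (sym_group 8) (O_plus_F2 6)"
proof -
  interpret odd_period 7 by unfold_locales auto
  let ?\<gamma> = "\<lambda>a. ones_class 8 (restr 8 a)"
  interpret P: perm_model 7 8 "sum_zero_quotient 8" ?\<gamma> "\<lambda>\<sigma>. (`) (coord_perm 8 \<sigma>)" "cycle_perm 7" "Transposition.transpose 1 8"
    using model_quotient[of 3] by simp
  define C where "C = (\<lambda>i :: nat. cvec 7 (int i))"
  have B: "bform 7 (C i) (C j) = 1" if "i < 7" "j < 7" "i \<noteq> j" for i j
  proof -
    have odd: "odd (7 choose k)" if "1 \<le> k" "k \<le> 6" for k :: nat
    proof -
      have "k = 1 \<or> k = 2 \<or> k = 3 \<or> k = 4 \<or> k = 5 \<or> k = 6" using that by linarith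
      then show ?thesis using choose_7 by (elim disjE) simp_all
    qed
    have "bform 7 (C i) (C j) = 1" if "i < j" "j < 7" for i j
      using B_cvec_cvec[OF that] odd[of "j - i"] that by (simp add: C_def of_nat_bit)
    then show ?thesis using that Q.B_commute by (metis linorder_neqE_nat)
  qed
  have CW: "C i \<in> W" and qC: "qform 7 (C i) = 1" for i by (simp_all add: C_def cvec_W q_cvec)
  \<comment> \<open>For \<open>N = 7\<close> any two distinct \<open>C i\<close> pair to 1, so the
    path is formed from \<open>C 0\<close> and sums of neighbours.\<close>
  have path: "Q.path4 7 (C 0) (C 0 + C 1) (C 1 + C 2) (C 2 + C 3)"
    unfolding Q.path4_def by (simp add: Q.form_simps qC B)
  have sub: "Q.span_path4 (C 0) (C 0 + C 1) (C 1 + C 2) (C 2 + C 3) \<subseteq> W"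
    by (rule span_path4_W) (simp add: CW W_subsp)
  have closed: "Q.trv_closed 7 P.perm_vectors" and CP: "C i \<in> P.perm_vectors" for i
    using P.monodromy_closed_perm_vectors cvec_in_closed[OF P.monodromy_closed_perm_vectors]
    by (auto simp: monodromy_closed_def C_def)
  have quad_restr: "quad 8 (restr 8 a) = qform 7 a" if a: "a \<in> W" for a
  proof -
    have "weight 8 (restr 8 a) = weight 7 (vec 7 (\<lambda>i. a (int i)))"
    proof -
      have "j < 8 \<and> restr 8 a $ j = 1 \<longleftrightarrow> j < 7 \<and> vec 7 (\<lambda>i. a (int i)) $ j = 1" for j
        by (cases "j < 7") (simp_all add: restr_def)
      then show ?thesis unfolding weight_eq_card by simp
    qed
    then show ?thesis using qform_7_eq_quad[OF W_periodic[OF a]] by (simp add: quad_eq_weight)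
  qed
  have C_index: "C i (int j) = (if j = i then 0 else 1)" if "i < 7" "j < 7" for i j
    using that by (simp add: C_def cvec_def mod_pos_pos_trivial)
  have all: "Q.nonsing 7 W \<subseteq> P.perm_vectors"
  proof
    fix a assume "a \<in> Q.nonsing 7 W"
    then have a: "a \<in> W" "qform 7 a = 1" by (auto simp: Q.nonsing_def)
    define S where "S = {i. i < 7 \<and> a (int i) = 1}"
    have S7: "S \<subseteq> {..<7}" by (auto simp: S_def)
    have "j < 8 \<and> restr 8 a $ j = 1 \<longleftrightarrow> j < 7 \<and> a (int j) = 1" for j
      by (cases "j < 7") (simp_all add: restr_def)
    then have "{i. i < 8 \<and> restr 8 a $ i = 1} = S" by (simp add: S_def)
    then have w: "weight 8 (restr 8 a) = card S" by (simp add: weight_eq_card)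
    have "card S \<le> 7" using card_mono[OF _ S7] by simp
    moreover have "even (card S)" using even_weight_restr[of 8 a] a w by simp
    moreover have "odd (card S * (card S + 1) div 2)"
      using quad_restr[OF a(1)] a(2) by (simp add: quad_eq_weight w of_nat_bit split: if_splits)
    \<comment> \<open>Weights 0 and 4 give value 0. Weights 2 and 6 belong to
      \<open>C i + C j\<close> and \<open>C i\<close>: 21 + 7 = 28 vectors, as many as there are
      transpositions in degree 8.\<close>
    ultimately have "card S = 2 \<or> card S = 6"
    proof -
      assume *: "card S \<le> 7" "even (card S)" "odd (card S * (card S + 1) div 2)"
      then obtain k where k: "card S = 2 * k" by auto
      then have "k = 0 \<or> k = 1 \<or> k = 2 \<or> k = 3" using *(1) by linarith
      then show ?thesis using k *(3) by auto
    qed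
    then show "a \<in> P.perm_vectors"
    proof
      assume "card S = 2"
      then obtain i j where ij: "S = {i, j}" "i \<noteq> j" by (auto simp: card_2_iff)
      then have lt: "i < 7" "j < 7" using S7 by auto
      have "a (int k) = (C i + C j) (int k)" if "k < 7" for k
      proof -
        have "a (int k) = 1 \<longleftrightarrow> k = i \<or> k = j" using ij(1) that by (auto simp: S_def set_eq_iff)
        then show ?thesis
          using C_index[OF lt(1) that] C_index[OF lt(2) that] ij(2) by (cases "k = i"; cases "k = j") simp_all
      qed
      then have "a = C i + C j" using eq_on_period[of a "C i + C j"] a(1) CW W_subsp by simp
      moreover have "C i + C j \<in> P.perm_vectors" using closed CP B[OF lt ij(2)] by (auto simp: Q.trv_closed_def)
      ultimately show ?thesis by simp
    next
      assume "card S = 6"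
      then have "card ({..<7} - S) = 1" using S7 by (simp add: card_Diff_subset finite_subset)
      then obtain i where i: "{..<7} - S = {i}" by (rule card_1_singletonE)
      then have lt: "i < 7" by auto
      have "a (int k) = C i (int k)" if "k < 7" for k
      proof -
        have "k \<in> S \<longleftrightarrow> k \<notin> {i}" unfolding i[symmetric] using that by simp
        then have "a (int k) = 1 \<longleftrightarrow> k \<noteq> i" using that by (simp add: S_def)
        then show ?thesis using C_index[OF lt that] by (cases "k = i") simp_all
      qed
      then have "a = C i" using eq_on_period[of a "C i"] a(1) CW by simp
      then show ?thesis using CP by simp
    qed
  qed
  have even: "restr 8 a \<in> carrier (sum_zero_space 8)" if "a \<in> W" for a
    using even_weight_restr[of 8 a] that by simp
  have quad_\<gamma>: "quad_quotient 8 (?\<gamma> a) = qform 7 a" if "a \<in> W" for a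
    using quad_quotient_class[OF _ even[OF that]] quad_restr[OF that] by simp
  have quad_act: "quad_quotient 8 (coord_perm 8 \<sigma> ` A) = quad_quotient 8 A"
    if \<sigma>: "\<sigma> permutes {1..8}" and A: "A \<in> carrier (sum_zero_quotient 8)" for \<sigma> A
  proof -
    obtain x where x: "x \<in> carrier (sum_zero_space 8)" "A = ones_class 8 x"
      using A quotient_carrier[of 8] by auto
    then have "coord_perm 8 \<sigma> x \<in> carrier (sum_zero_space 8)" using weight_coord_perm[OF \<sigma>] by simp
    then show ?thesis
      using x coord_perm_ones_class[OF \<sigma>, of x] quad_quotient_class[of 8] quad_coord_perm[OF \<sigma>] by simp
  qed
  note * = P.perm_mat_quad_isometry[OF gen_by_trv_W[OF path sub] all quad_\<gamma> quad_act
    type_sum_zero_periodic(1)[OF odd_N]]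
  show "\<exists>\<phi>. quad_isometry (vec_space_F2 6) (F_plus 6) (sum_zero_quotient 8) (quad_quotient 8) \<phi>"
    using *(1) by (simp add: chi8_def)
  have emb: "nat_embedding_quotient 6 \<phi> = P.perm_mat \<phi>"
    by (rule ext) (simp add: nat_embedding_quotient_def P.perm_mat_def)
  show "quad_isometry (vec_space_F2 6) (F_plus 6) (sum_zero_quotient 8) (quad_quotient 8) \<phi> \<Longrightarrow>
      nat_embedding_quotient 6 \<phi> \<in> iso (sym_group 8) (O_plus_F2 6)"
    unfolding emb O_eq_isometry_group using *(2) by (simp add: chi8_def)
qed

theorem proposition2p11:
  shows
    "(\<forall>n :: nat. 4 \<le> n \<and> n \<le> 120 \<and> even n \<longrightarrow>
        ((\<exists>m \<ge> 2. n = 2 ^ m) \<longrightarrow> MD_F2 n \<cong> sym_group (n + 1)) \<and>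
        ((\<exists>m \<ge> 3. n = 2 ^ m - 2) \<longrightarrow> MD_F2 n \<cong> sym_group (n + 2)) \<and>
        ((\<forall>m \<ge> 2. n \<noteq> 2 ^ m \<and> n \<noteq> 2 ^ m - 2) \<and> (n mod 8 = 0 \<or> n mod 8 = 6)
           \<longrightarrow> MD_F2 n \<cong> O_plus_F2 n) \<and>
        ((\<forall>m \<ge> 2. n \<noteq> 2 ^ m \<and> n \<noteq> 2 ^ m - 2) \<and> (n mod 8 = 2 \<or> n mod 8 = 4)
           \<longrightarrow> MD_F2 n \<cong> O_minus_F2 n))
     \<and> ((\<exists>\<phi>. quad_isometry (vec_space_F2 4) (F_minus 4) (sum_zero_space 5) (quad 5) \<phi>) \<and>
        (\<forall>\<phi>. quad_isometry (vec_space_F2 4) (F_minus 4) (sum_zero_space 5) (quad 5) \<phi> \<longrightarrow>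
           nat_embedding_space 4 \<phi> \<in> iso (sym_group 5) (O_minus_F2 4)))
     \<and> ((\<exists>\<phi>. quad_isometry (vec_space_F2 6) (F_plus 6) (sum_zero_quotient 8) (quad_quotient 8) \<phi>) \<and>
        (\<forall>\<phi>. quad_isometry (vec_space_F2 6) (F_plus 6) (sum_zero_quotient 8) (quad_quotient 8) \<phi> \<longrightarrow>
           nat_embedding_quotient 6 \<phi> \<in> iso (sym_group 8) (O_plus_F2 6)))"
proof (intro conjI allI impI S5_natural_embedding S8_natural_embedding)
  fix n :: nat
  assume n: "4 \<le> n \<and> n \<le> 120 \<and> even n"
  show "MD_F2 n \<cong> sym_group (n + 1)" if "\<exists>m\<ge>2. n = 2 ^ m"
    using that MD_sym_group(1) by auto
  show "MD_F2 n \<cong> sym_group (n + 2)" if "\<exists>m\<ge>3. n = 2 ^ m - 2"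
  proof -
    obtain m where m: "m \<ge> 3" "n = 2 ^ m - 2" using \<open>\<exists>m\<ge>3. n = 2 ^ m - 2\<close> by blast
    then have "n + 2 = 2 ^ m" using n by linarith
    then show ?thesis using MD_sym_group(2)[of m] m by simp
  qed
  \<comment> \<open>\<open>n = 2 ^ m - 2\<close> becomes \<open>n + 1 = 2 ^ m - 1\<close>; exponents
    below 2 only give numbers that are too small for \<open>n \<ge> 4\<close>.\<close>
  have generic: "generic_period (n + 1)" if "\<forall>m\<ge>2. n \<noteq> 2 ^ m \<and> n \<noteq> 2 ^ m - 2"
  proof -
    have "n + 1 \<noteq> 2 ^ m + 1 \<and> n + 1 \<noteq> 2 ^ m - 1" for m :: nat
    proof (cases "m \<ge> 2")
      case True
      then have "n \<noteq> 2 ^ m \<and> n \<noteq> 2 ^ m - 2" using that by blast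
      then show ?thesis using n by linarith
    next
      case False
      then have "m = 0 \<or> m = 1" by linarith
      then show ?thesis using n by auto
    qed
    then show ?thesis using n by (simp add: generic_period_def)
  qed
  show "MD_F2 n \<cong> O_plus_F2 n"
    if "(\<forall>m\<ge>2. n \<noteq> 2 ^ m \<and> n \<noteq> 2 ^ m - 2) \<and> (n mod 8 = 0 \<or> n mod 8 = 6)"
    using MD_orthogonal(1) generic that n by simp
  show "MD_F2 n \<cong> O_minus_F2 n"
    if "(\<forall>m\<ge>2. n \<noteq> 2 ^ m \<and> n \<noteq> 2 ^ m - 2) \<and> (n mod 8 = 2 \<or> n mod 8 = 4)"
    using MD_orthogonal(2) generic that n by simp
qed

end
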